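(* Let $\Omega\subset\mathbb{R}^d$ be a bounded polyhedral domain and let $\mathcal{T}$ be a triangulation of $\Omega$. Let $B_{\mathring{P}_0}=\{u\in \mathring{P}_0(\mathcal{T}) : \mathrm{TV}(u,\Omega)\le 1\}$. Then the set of extremal points of $B_{\mathring{P}_0}$ is $$\operatorname{Ext}\big(B_{\mathring{P}_0}\big)=\left\{\frac{1}{\mathrm{Per}(E,\Omega)}\,\mathring{\mathbb{1}}_E \;\middle|\; E\in \mathcal{S}_{\mathcal{T}}(\Omega)\ \text{simple}\right\}.$$
   Context: $\Omega\subset\mathbb{R}^d$ is an open, bounded, connected polyhedron with strongly Lipschitz boundary. A triangulation $\mathcal{T}=\{T_1,\dots,T_{n}\}$ of $\Omega$ is a finite collection of pairwise disjoint open simplices with $\overline{\Omega}=\bigcup_{i}\overline{T_i}$. $\mathcal{S}_{\mathcal{T}}(\Omega)$ is the class of open sets obtained as the interior of a union of closures of simplices belonging to $\mathcal{T}$. $P_0(\mathcal{T})$ is the space of functions on $\Omega$ that are constant on each simplex of $\mathcal{T}$ (identified a.e.). For $u\in L^1(\Omega)$: $\mathrm{TV}(u,\Omega)=\sup\{\int_\Omega u\,\mathrm{div}\,\psi\,dx : \psi\in C^1_c(\Omega;\mathbb{R}^d),\ \sup_x|\psi(x)|\le 1\}$ with $|\cdot|$ the Euclidean norm; $a_u=\frac{1}{\mathcal{L}^d(\Omega)}\int_\Omega u\,dx$ and $\mathring{u}=u-a_u$. $\mathring{P}_0(\mathcal{T})=\{u\in P_0(\mathcal{T}): a_u=0\}$.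 $\mathrm{Per}(E,\Omega)=\mathrm{TV}(\mathbb{1}_E,\Omega)$. A set of finite perimeter $E\subseteq\Omega$ is decomposable if $E=E_1\cup E_2$ (up to null sets) for two disjoint sets $E_1,E_2$ of positive measure with $\mathrm{Per}(E,\Omega)=\mathrm{Per}(E_1,\Omega)+\mathrm{Per}(E_2,\Omega)$, and indecomposable otherwise. $E$ is simple if both $E$ and $\Omega\setminus E$ are indecomposable; in the formula only simple sets with $\mathrm{Per}(E,\Omega)>0$ are considered. An element $u$ of a convex set $B$ is extremal if there are no $s\in(0,1)$ and $u_1\ne u_2$ in $B$ with $u=(1-s)u_1+su_2$.
   Formalization: The triangulation is assumed to have at least two simplices; with a single simplex the ball is {0}, whose only element 0 is extremal, while no simple set in S_T has positive perimeter, so the stated equality fails. *)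

theory Defs
  imports "HOL-Analysis.Analysis"
begin

text \<open>Local epigraph condition: near every boundary point, \<open>\<Omega>\<close> is the strict epigraph,
  in some unit direction \<open>e\<close>, of a Lipschitz function on the hyperplane orthogonal to \<open>e\<close>.\<close>

definition strongly_lipschitz_boundary :: "'a::euclidean_space set \<Rightarrow> bool" where
  "strongly_lipschitz_boundary \<Omega> \<longleftrightarrow>
     (\<forall>x\<in>frontier \<Omega>. \<exists>U e L (\<gamma> :: 'a \<Rightarrow> real).
        open U \<and> x \<in> U \<and> norm e = 1 \<and> L-lipschitz_on {z. z \<bullet> e = 0} \<gamma> \<and>
        \<Omega> \<inter> U = {y \<in> U. \<gamma> (y - (y \<bullet> e) *\<^sub>R e) < y \<bullet> e})"

text \<open>The library's \<^const>\<open>polyhedron\<close> is convex; here a polyhedron need not be convex, only a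
  finite union of polytopes.\<close>

definition polyhedral_domain :: "'a::euclidean_space set \<Rightarrow> bool" where
  "polyhedral_domain \<Omega> \<longleftrightarrow>
     open \<Omega> \<and> bounded \<Omega> \<and> connected \<Omega> \<and> \<Omega> \<noteq> {} \<and>
     (\<exists>\<P>. finite \<P> \<and> (\<forall>P\<in>\<P>. polytope P) \<and> closure \<Omega> = \<Union>\<P>) \<and>
     strongly_lipschitz_boundary \<Omega>"

definition open_simplex :: "'a::euclidean_space set \<Rightarrow> bool" where
  "open_simplex T \<longleftrightarrow> (\<exists>S. int DIM('a) simplex S \<and> T = interior S)"

text \<open>Unlike the library's \<^const>\<open>triangulation\<close>, the cells are open and full-dimensional, and
  hanging nodes are allowed.\<close>

definition is_triangulation_of :: "'a::euclidean_space set set \<Rightarrow> 'a set \<Rightarrow> bool" where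
  "is_triangulation_of \<T> \<Omega> \<longleftrightarrow>
     finite \<T> \<and> (\<forall>T\<in>\<T>. open_simplex T) \<and> pairwise disjnt \<T> \<and>
     closure \<Omega> = (\<Union>T\<in>\<T>. closure T)"

definition simplex_union_sets :: "'a::euclidean_space set set \<Rightarrow> 'a set set" where
  "simplex_union_sets \<T> = {interior (\<Union>T\<in>\<F>. closure T) | \<F>. \<F> \<subseteq> \<T>}"

text \<open>Elements of a function space over \<open>\<Omega>\<close> are represented by total functions, taken modulo
  \<open>ae_eq \<Omega>\<close> (values outside \<open>\<Omega>\<close> are irrelevant). The sets of functions below are saturated, that
  is, unions of equivalence classes.\<close>

definition ae_eq :: "'a::euclidean_space set \<Rightarrow> ('a \<Rightarrow> real) \<Rightarrow> ('a \<Rightarrow> real) \<Rightarrow> bool" where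
  "ae_eq \<Omega> u v \<longleftrightarrow> (AE x\<in>\<Omega> in lebesgue. u x = v x)"

definition P0 :: "'a::euclidean_space set \<Rightarrow> 'a set set \<Rightarrow> ('a \<Rightarrow> real) set" where
  "P0 \<Omega> \<T> = {u. \<exists>v. (\<forall>T\<in>\<T>. v constant_on T) \<and> ae_eq \<Omega> u v}"

definition avg :: "'a::euclidean_space set \<Rightarrow> ('a \<Rightarrow> real) \<Rightarrow> real" where
  "avg \<Omega> u = (1 / measure lebesgue \<Omega>) * (LINT x:\<Omega>|lebesgue. u x)"

definition centred :: "'a::euclidean_space set \<Rightarrow> ('a \<Rightarrow> real) \<Rightarrow> 'a \<Rightarrow> real" where
  "centred \<Omega> u = (\<lambda>x. u x - avg \<Omega> u)"

definition P0_centred :: "'a::euclidean_space set \<Rightarrow> 'a set set \<Rightarrow> ('a \<Rightarrow> real) set" where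
  "P0_centred \<Omega> \<T> = {u \<in> P0 \<Omega> \<T>. avg \<Omega> u = 0}"

text \<open>A field in $C^1_c(\Omega;R^d)$ is represented by its extension by zero to the whole space.\<close>

definition C1c_fields :: "'a::euclidean_space set \<Rightarrow> ('a \<Rightarrow> 'a) set" where
  "C1c_fields \<Omega> =
     {\<psi>. (\<exists>\<psi>' :: 'a \<Rightarrow> 'a \<Rightarrow>\<^sub>L 'a.
            (\<forall>x. (\<psi> has_derivative blinfun_apply (\<psi>' x)) (at x)) \<and> continuous_on UNIV \<psi>') \<and>
         compact (closure {x. \<psi> x \<noteq> 0}) \<and> closure {x. \<psi> x \<noteq> 0} \<subseteq> \<Omega>}"

definition divergence :: "('a::euclidean_space \<Rightarrow> 'a) \<Rightarrow> 'a \<Rightarrow> real" where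
  "divergence \<psi> x = (\<Sum>b\<in>Basis. frechet_derivative \<psi> (at x) b \<bullet> b)"

text \<open>Only meaningful for \<open>u\<close> integrable over \<open>\<Omega>\<close>.\<close>

definition TV :: "('a::euclidean_space \<Rightarrow> real) \<Rightarrow> 'a set \<Rightarrow> ereal" where
  "TV u \<Omega> = (SUP \<psi> \<in> {\<psi> \<in> C1c_fields \<Omega>. \<forall>x. norm (\<psi> x) \<le> 1}.
               ereal (LINT x:\<Omega>|lebesgue. u x * divergence \<psi> x))"

definition Per :: "'a::euclidean_space set \<Rightarrow> 'a set \<Rightarrow> ereal" where
  "Per E \<Omega> = TV (indicat_real E) \<Omega>"

definition finite_perimeter :: "'a::euclidean_space set \<Rightarrow> 'a set \<Rightarrow> bool" where
  "finite_perimeter \<Omega> E \<longleftrightarrow> E \<subseteq> \<Omega> \<and> E \<in> sets lebesgue \<and> Per E \<Omega> < \<infinity>"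

definition decomposable :: "'a::euclidean_space set \<Rightarrow> 'a set \<Rightarrow> bool" where
  "decomposable \<Omega> E \<longleftrightarrow> finite_perimeter \<Omega> E \<and>
     (\<exists>E1 E2. E1 \<in> sets lebesgue \<and> E2 \<in> sets lebesgue \<and> E1 \<subseteq> \<Omega> \<and> E2 \<subseteq> \<Omega> \<and>
        E1 \<inter> E2 = {} \<and> emeasure lebesgue E1 > 0 \<and> emeasure lebesgue E2 > 0 \<and>
        sym_diff E (E1 \<union> E2) \<in> null_sets lebesgue \<and>
        Per E \<Omega> = Per E1 \<Omega> + Per E2 \<Omega>)"

definition indecomposable :: "'a::euclidean_space set \<Rightarrow> 'a set \<Rightarrow> bool" where
  "indecomposable \<Omega> E \<longleftrightarrow> finite_perimeter \<Omega> E \<and> \<not> decomposable \<Omega> E"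

definition simple_set :: "'a::euclidean_space set \<Rightarrow> 'a set \<Rightarrow> bool" where
  "simple_set \<Omega> E \<longleftrightarrow> indecomposable \<Omega> E \<and> indecomposable \<Omega> (\<Omega> - E)"

definition unit_ball_P0 :: "'a::euclidean_space set \<Rightarrow> 'a set set \<Rightarrow> ('a \<Rightarrow> real) set" where
  "unit_ball_P0 \<Omega> \<T> = {u \<in> P0_centred \<Omega> \<T>. TV u \<Omega> \<le> 1}"

text \<open>Extremal points, with equality in the ambient vector space being \<open>ae_eq \<Omega>\<close>.\<close>

definition extremal_points ::
    "'a::euclidean_space set \<Rightarrow> ('a \<Rightarrow> real) set \<Rightarrow> ('a \<Rightarrow> real) set" where
  "extremal_points \<Omega> B =
     {u \<in> B. \<not> (\<exists>s u1 u2. 0 < s \<and> s < 1 \<and> u1 \<in> B \<and> u2 \<in> B \<and> \<not> ae_eq \<Omega> u1 u2 \<and>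
                 ae_eq \<Omega> u (\<lambda>x. (1 - s) * u1 x + s * u2 x))}"

end

theory Submission
  imports Defs
begin

text \<open>
  On piecewise constant functions the total variation is the total variation of a weighted graph. Its
  vertices are the simplices, its edges the pieces of facets between them, and for coefficients \<open>v\<close>
  \[ TV(v) = \sum_e w_e \, | v_{i(e)} - v_{j(e)} | . \]
  Once this is known (lemma \<open>TV_pw_const\<close>), the theorem is about finitely many coefficients.

  If \<open>v\<close> is extremal and takes a value \<open>b\<close> strictly between two others, then the truncations \<open>min v b\<close> and
  \<open>max v b\<close> share the variation of \<open>v\<close> additively and, centred and normalised, show that \<open>v\<close> is not extremal
  (\<open>extremal_two_values\<close>). So \<open>v\<close> has two values and is a normalised centred indicator of a set \<open>E\<close>. A
  decomposition of \<open>E\<close>, or of its complement, would split \<open>v\<close> again (\<open>extremal_imp_indecomposable\<close>).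
  Conversely, let \<open>E\<close> be simple and its normalised centred indicator a convex combination of two elements of
  the ball. Equality in the triangle inequality at each edge forces both of them to be constant across the edges
  inside \<open>E\<close> and inside the complement; as these sets are indecomposable, both are constant on each of the two
  sets. Being centred they are multiples of the given function, and the bound on the norm leaves no choice for the
  factors (\<open>simple_imp_extremal\<close>).

  Two analytic facts support this. The first is the graph formula. The facets span finitely many hyperplanes, and
  near a point that lies on only one of them a piecewise constant function is a multiple of the indicator of a
  half-space plus a constant. Points on two hyperplanes form a set of codimension two, near which test fields can be
  cut off at arbitrarily small cost; the remaining part of a field splits into fields supported in disjoint
  neighbourhoods of the edges. The weight \<open>w_e\<close> is the perimeter of a half-space in such a
  neighbourhood, so surface measure and the Gauss-Green formula for polyhedra do not appear.

  The second is the constancy theorem (\<open>divergence_free_indicator_trivial\<close>): a set of zero perimeter in a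
  connected open set is null or has null complement. It is used twice: on \<open>\<Omega>\<close>, where it makes the variation
  of a non-constant function positive, and on a single simplex, where it shows that the parts of a decomposition
  of \<open>E\<close>, which may be arbitrary measurable sets, are unions of simplices up to null sets.
\<close>

section \<open>Continuously differentiable maps and cut-off functions\<close>

text \<open>Asking for continuity of the derivative direction by direction gives the same class as continuity
  in operator norm, because the domain is finite-dimensional, and makes sums and products immediate.\<close>

definition C1 :: "('a::euclidean_space \<Rightarrow> 'b::real_normed_vector) \<Rightarrow> bool" where
  "C1 f \<longleftrightarrow> (\<exists>D. (\<forall>x. (f has_derivative D x) (at x)) \<and> (\<forall>h. continuous_on UNIV (\<lambda>x. D x h)))"

lemma C1I:
  assumes "\<And>x. (f has_derivative D x) (at x)" "\<And>h. continuous_on UNIV (\<lambda>x. D x h)"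
  shows "C1 f"
  using assms unfolding C1_def by blast

lemma C1_iff_blinfun:
  fixes f :: "'a::euclidean_space \<Rightarrow> 'b::real_normed_vector"
  shows "C1 f \<longleftrightarrow> (\<exists>f' :: 'a \<Rightarrow> 'a \<Rightarrow>\<^sub>L 'b.
            (\<forall>x. (f has_derivative blinfun_apply (f' x)) (at x)) \<and> continuous_on UNIV f')"
proof
  assume "C1 f"
  then obtain D where D: "\<And>x. (f has_derivative D x) (at x)" "\<And>h. continuous_on UNIV (\<lambda>x. D x h)"
    unfolding C1_def by blast
  have bl: "bounded_linear (D x)" for x using D(1) by (rule has_derivative_bounded_linear)
  have "continuous_on UNIV (\<lambda>x. Blinfun (D x))"
    by (rule continuous_on_blinfun_componentwise) (simp add: bounded_linear_Blinfun_apply bl D(2))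
  then show "\<exists>f' :: 'a \<Rightarrow> 'a \<Rightarrow>\<^sub>L 'b.
            (\<forall>x. (f has_derivative blinfun_apply (f' x)) (at x)) \<and> continuous_on UNIV f'"
    using D(1) by (intro exI[of _ "\<lambda>x. Blinfun (D x)"]) (simp add: bounded_linear_Blinfun_apply bl)
next
  assume "\<exists>f' :: 'a \<Rightarrow> 'a \<Rightarrow>\<^sub>L 'b.
            (\<forall>x. (f has_derivative blinfun_apply (f' x)) (at x)) \<and> continuous_on UNIV f'"
  then obtain f' :: "'a \<Rightarrow> 'a \<Rightarrow>\<^sub>L 'b" where
    "\<And>x. (f has_derivative blinfun_apply (f' x)) (at x)" "continuous_on UNIV f'" by blast
  then show "C1 f"
    by (intro C1I[of f "\<lambda>x. blinfun_apply (f' x)"]) (auto intro!: continuous_intros)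
qed

lemma C1_has_derivative:
  assumes "C1 f" shows "(f has_derivative frechet_derivative f (at x)) (at x)"
proof -
  from assms obtain D where "(f has_derivative D x) (at x)" unfolding C1_def by blast
  then show ?thesis by (metis frechet_derivative_at)
qed

lemma C1_continuous_derivative:
  assumes "C1 f" shows "continuous_on UNIV (\<lambda>x. frechet_derivative f (at x) h)"
proof -
  from assms obtain D where D: "\<And>x. (f has_derivative D x) (at x)" "continuous_on UNIV (\<lambda>x. D x h)"
    unfolding C1_def by blast
  have "D x = frechet_derivative f (at x)" for x using D(1) by (rule frechet_derivative_at)
  with D(2) show ?thesis by simp
qed

lemma C1_continuous: assumes "C1 f" shows "continuous_on S f"
  by (rule has_derivative_continuous_on[OF has_derivative_at_withinI[OF C1_has_derivative[OF assms]]])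

lemma C1_const [simp]: "C1 (\<lambda>x. c)"
  by (rule C1I[where D="\<lambda>_ _. 0"]) auto

lemma C1_add: assumes "C1 f" "C1 g" shows "C1 (\<lambda>x. f x + g x)"
proof (rule C1I)
  show "((\<lambda>x. f x + g x) has_derivative
      (\<lambda>h. frechet_derivative f (at x) h + frechet_derivative g (at x) h)) (at x)" for x
    by (rule has_derivative_add[OF C1_has_derivative C1_has_derivative]) (fact assms)+
  show "continuous_on UNIV (\<lambda>x. frechet_derivative f (at x) h + frechet_derivative g (at x) h)" for h
    by (rule continuous_on_add[OF C1_continuous_derivative C1_continuous_derivative]) (fact assms)+
qed

lemma C1_scaleR:
  fixes f :: "'a::euclidean_space \<Rightarrow> real"
  assumes "C1 f" "C1 g" shows "C1 (\<lambda>x. f x *\<^sub>R g x)"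
proof (rule C1I)
  show "((\<lambda>x. f x *\<^sub>R g x) has_derivative
      (\<lambda>h. f x *\<^sub>R frechet_derivative g (at x) h + frechet_derivative f (at x) h *\<^sub>R g x)) (at x)" for x
    by (rule has_derivative_scaleR[OF C1_has_derivative C1_has_derivative]) (fact assms)+
  show "continuous_on UNIV
      (\<lambda>x. f x *\<^sub>R frechet_derivative g (at x) h + frechet_derivative f (at x) h *\<^sub>R g x)" for h
    by (intro continuous_on_add continuous_on_scaleR C1_continuous_derivative C1_continuous assms)
qed

lemma C1_mult:
  fixes f :: "'a::euclidean_space \<Rightarrow> real"
  assumes "C1 f" "C1 g" shows "C1 (\<lambda>x. f x * g x)"
  using C1_scaleR[OF assms] by simp

lemma C1_uminus: assumes "C1 f" shows "C1 (\<lambda>x. - f x)"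
  using C1_scaleR[OF C1_const[of "-1"] assms] by simp

lemma C1_diff: assumes "C1 f" "C1 g" shows "C1 (\<lambda>x. f x - g x)"
  using C1_add[OF assms(1) C1_uminus[OF assms(2)]] by simp

lemma C1_prod:
  fixes f :: "'i \<Rightarrow> 'a::euclidean_space \<Rightarrow> real"
  shows "(\<And>i. i \<in> I \<Longrightarrow> C1 (f i)) \<Longrightarrow> C1 (\<lambda>x. \<Prod>i\<in>I. f i x)"
  by (induction I rule: infinite_finite_induct) (auto intro: C1_mult)

lemma C1_inner_left: "C1 (\<lambda>x. a \<bullet> x)"
  by (rule C1I[where D="\<lambda>_ h. a \<bullet> h"])
     (auto intro!: bounded_linear_imp_has_derivative bounded_linear_inner_right)

lemma C1_norm_sq: "C1 (\<lambda>x. (norm (x - a))\<^sup>2)"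
proof (rule C1I)
  show "((\<lambda>x. (norm (x - a))\<^sup>2) has_derivative (\<lambda>h. (x - a) \<bullet> h + h \<bullet> (x - a))) (at x)" for x
    unfolding power2_norm_eq_inner
    by (rule has_derivative_inner) (auto intro!: derivative_eq_intros)
  show "continuous_on UNIV (\<lambda>x. (x - a) \<bullet> h + h \<bullet> (x - a))" for h
    by (intro continuous_intros)
qed

lemma has_derivative_comp_real:
  fixes f :: "'a::euclidean_space \<Rightarrow> real"
  assumes "\<And>t. (r has_real_derivative r' t) (at t)" "C1 f"
  shows "((\<lambda>x. r (f x)) has_derivative (\<lambda>h. r' (f x) * frechet_derivative f (at x) h)) (at x)"
  using has_derivative_compose[OF C1_has_derivative[OF assms(2)] assms(1)[unfolded has_field_derivative_def]]
  by simp

lemma C1_comp_real: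
  fixes f :: "'a::euclidean_space \<Rightarrow> real"
  assumes r: "\<And>t. (r has_real_derivative r' t) (at t)" "continuous_on UNIV r'" and f: "C1 f"
  shows "C1 (\<lambda>x. r (f x))"
proof (rule C1I)
  show "((\<lambda>x. r (f x)) has_derivative (\<lambda>h. r' (f x) * frechet_derivative f (at x) h)) (at x)" for x
    by (rule has_derivative_comp_real[OF r(1) f])
  show "continuous_on UNIV (\<lambda>x. r' (f x) * frechet_derivative f (at x) h)" for h
    by (intro continuous_on_mult C1_continuous_derivative f
        continuous_on_compose2[OF r(2)] C1_continuous[OF f] subset_UNIV)
qed

text \<open>A quadratic spline: \<open>0\<close> up to \<open>0\<close>, \<open>1\<close> from \<open>1\<close> on, and continuously differentiable because the square
  of the positive part is. Every cut-off below is built from it.\<close>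

definition ramp :: "real \<Rightarrow> real" where
  "ramp t = 2 * (max 0 t)\<^sup>2 - 4 * (max 0 (t - 1/2))\<^sup>2 + 2 * (max 0 (t - 1))\<^sup>2"

definition ramp' :: "real \<Rightarrow> real" where
  "ramp' t = 4 * max 0 t - 8 * max 0 (t - 1/2) + 4 * max 0 (t - 1)"

lemma has_real_derivative_pos_part_sq:
  "((\<lambda>t. (max 0 t)\<^sup>2) has_real_derivative 2 * max 0 t) (at (t::real))"
proof (cases "t = 0")
  case True
  have "((\<lambda>h. (max 0 h)\<^sup>2 / h) \<longlongrightarrow> 0) (at (0::real))"
  proof (rule tendsto_rabs_zero_cancel, rule tendsto_sandwich[where f="\<lambda>_. 0" and h="\<lambda>h. \<bar>h\<bar>"])
    show "\<forall>\<^sub>F h in at 0. \<bar>(max 0 h)\<^sup>2 / h\<bar> \<le> \<bar>h :: real\<bar>"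
      by (rule always_eventually) (auto simp: max_def power2_eq_square)
  qed (auto intro!: tendsto_eq_intros)
  then show ?thesis using True by (simp add: DERIV_def)
next
  case False
  have "((\<lambda>t. if t < 0 then 0 else t\<^sup>2) has_real_derivative 2 * max 0 t) (at t)"
  proof (cases "t < 0")
    case True
    have "((\<lambda>t::real. 0::real) has_real_derivative 2 * max 0 t) (at t)" using True by simp
    then show ?thesis
      by (rule has_field_derivative_transform_within_open[where S="{..<0}"]) (use True in auto)
  next
    case f: False
    with False have t: "t > 0" by simp
    have "((\<lambda>t::real. t\<^sup>2) has_real_derivative 2 * max 0 t) (at t)" using t
      by (auto intro!: derivative_eq_intros)
    then show ?thesis
      by (rule has_field_derivative_transform_within_open[where S="{0<..}"]) (use t in auto)
  qed
  moreover have "(\<lambda>t::real. (max 0 t)\<^sup>2) = (\<lambda>t. if t < 0 then 0 else t\<^sup>2)"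
    by (auto simp: fun_eq_iff max_def)
  ultimately show ?thesis by simp
qed

lemma ramp_deriv: "(ramp has_real_derivative ramp' t) (at t)"
proof -
  have d: "((\<lambda>t. (max 0 (t - c))\<^sup>2) has_real_derivative 2 * max 0 (t - c)) (at t)" for c
    using DERIV_shift[of "\<lambda>t. (max 0 t)\<^sup>2" "2 * max 0 (t - c)" t "-c"]
      has_real_derivative_pos_part_sq[of "t - c"] by simp
  show ?thesis
    unfolding ramp_def ramp'_def
    by (rule derivative_eq_intros d has_real_derivative_pos_part_sq refl)+ simp
qed

lemma ramp'_continuous: "continuous_on S ramp'"
  unfolding ramp'_def by (intro continuous_intros)

lemma ramp_le0: "t \<le> 0 \<Longrightarrow> ramp t = 0" by (simp add: ramp_def)
lemma ramp_ge1: "t \<ge> 1 \<Longrightarrow> ramp t = 1" by (simp add: ramp_def power2_eq_square algebra_simps)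
lemma ramp'_nonneg: "0 \<le> ramp' t" by (auto simp: ramp'_def max_def)
lemma ramp'_le2: "ramp' t \<le> 2" by (auto simp: ramp'_def max_def)
lemma ramp'_zero: "t \<le> 0 \<or> t \<ge> 1 \<Longrightarrow> ramp' t = 0" by (auto simp: ramp'_def max_def)

lemma ramp_mono: "s \<le> t \<Longrightarrow> ramp s \<le> ramp t"
  by (rule DERIV_nonneg_imp_nondecreasing) (use ramp_deriv ramp'_nonneg in blast)+

lemma ramp_range: "0 \<le> ramp t" "ramp t \<le> 1"
  using ramp_mono[of "min t 0" t] ramp_mono[of t "max t 1"] by (auto simp: ramp_le0 ramp_ge1)

lemma ramp_tendsto_indicator: "(\<lambda>k. ramp (real k * t)) \<longlonglongrightarrow> of_bool (t > 0)"
proof (cases "t > 0")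
  case True
  then obtain N where N: "1 < real N * t" using reals_Archimedean3 by blast
  have "ramp (real k * t) = 1" if "k \<ge> N" for k
  proof (rule ramp_ge1)
    have "real N * t \<le> real k * t" using True that by (intro mult_right_mono) auto
    with N show "1 \<le> real k * t" by linarith
  qed
  then have "\<forall>\<^sub>F k in sequentially. ramp (real k * t) = 1" by (auto simp: eventually_sequentially)
  then show ?thesis using True by (simp add: tendsto_eventually)
next
  case False
  then have "ramp (real k * t) = 0" for k by (intro ramp_le0) (simp add: mult_nonneg_nonpos)
  then show ?thesis using False by simp
qed

lemma C1_ramp: "C1 f \<Longrightarrow> C1 (\<lambda>x. ramp (f x))"
  by (rule C1_comp_real[OF ramp_deriv ramp'_continuous])

text \<open>A finite cover of \<open>K\<close> by balls whose doubles stay in \<open>T\<close> suffices: each ball carries a radial profile that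
  vanishes on the ball and is \<open>1\<close> off its double, and one minus the product of the profiles is the cut-off.\<close>

lemma C1_cutoff:
  fixes T :: "'a::euclidean_space set"
  assumes "open T" "compact K" "K \<subseteq> T"
  obtains \<kappa> K' where "C1 \<kappa>" "\<And>x. 0 \<le> \<kappa> x" "\<And>x. \<kappa> x \<le> (1::real)" "\<And>x. x \<in> K \<Longrightarrow> \<kappa> x = 1"
    "compact K'" "K' \<subseteq> T" "\<And>x. x \<notin> K' \<Longrightarrow> \<kappa> x = 0"
proof -
  have "\<forall>x\<in>K. \<exists>r>0. cball x r \<subseteq> T"
    using assms(1,3) unfolding open_contains_cball by blast
  then obtain r where r: "\<And>x. x \<in> K \<Longrightarrow> r x > 0 \<and> cball x (r x) \<subseteq> T" by metis
  have "K \<subseteq> (\<Union>x\<in>K. ball x (r x / 2))" using r by force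
  then obtain D where D: "D \<subseteq> K" "finite D" "K \<subseteq> (\<Union>x\<in>D. ball x (r x / 2))"
    by (rule compactE_image[OF assms(2), rotated]) auto
  define \<beta> where "\<beta> c x = ramp ((4 / (r c)\<^sup>2 * (norm (x - c))\<^sup>2 - 1) / 3)" for c x
  define \<kappa> where "\<kappa> x = 1 - (\<Prod>c\<in>D. \<beta> c x)" for x
  have \<beta>: "0 \<le> \<beta> c x" "\<beta> c x \<le> 1" for c x unfolding \<beta>_def using ramp_range by auto
  have \<beta>0: "\<beta> c x = 0" if "c \<in> D" "x \<in> ball c (r c / 2)" for c x
  proof -
    have rc: "r c > 0" using that(1) D(1) r by auto
    have "norm (x - c) \<le> r c / 2" using that(2) by (simp add: dist_norm norm_minus_commute)
    then have "(norm (x - c))\<^sup>2 \<le> (r c / 2)\<^sup>2" by (intro power_mono) auto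
    then have "4 / (r c)\<^sup>2 * (norm (x - c))\<^sup>2 \<le> 1" using rc by (simp add: field_simps power2_eq_square)
    then show ?thesis unfolding \<beta>_def by (intro ramp_le0) simp
  qed
  have \<beta>1: "\<beta> c x = 1" if "c \<in> D" "x \<notin> cball c (r c)" for c x
  proof -
    have rc: "r c > 0" using that(1) D(1) r by auto
    have "r c \<le> norm (x - c)" using that(2) by (simp add: dist_norm norm_minus_commute)
    then have "(r c)\<^sup>2 \<le> (norm (x - c))\<^sup>2" using rc by (intro power_mono) auto
    then have "4 / (r c)\<^sup>2 * (norm (x - c))\<^sup>2 \<ge> 4" using rc by (simp add: field_simps power2_eq_square)
    then show ?thesis unfolding \<beta>_def by (intro ramp_ge1) simp
  qed
  have "C1 \<kappa>" unfolding \<kappa>_def \<beta>_def divide_inverse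
    by (intro C1_diff C1_const C1_prod C1_ramp C1_mult C1_norm_sq)
  moreover have "0 \<le> \<kappa> x" "\<kappa> x \<le> 1" for x
    unfolding \<kappa>_def using \<beta> by (auto intro!: prod_le_1 prod_nonneg)
  moreover have "\<kappa> x = 1" if xK: "x \<in> K" for x
  proof -
    obtain c where "c \<in> D" "x \<in> ball c (r c / 2)" using D(3) xK by blast
    then have "(\<Prod>c\<in>D. \<beta> c x) = 0" using \<beta>0 D(2) by (intro prod_zero) auto
    then show ?thesis unfolding \<kappa>_def by simp
  qed
  moreover have "compact (\<Union>c\<in>D. cball c (r c))" using D(2) by (intro compact_UN) auto
  moreover have "(\<Union>c\<in>D. cball c (r c)) \<subseteq> T" using D(1) r by blast
  moreover have "\<kappa> x = 0" if "x \<notin> (\<Union>c\<in>D. cball c (r c))" for x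
    unfolding \<kappa>_def using that \<beta>1 by simp
  ultimately show thesis by (rule that)
qed

section \<open>Compactly supported fields and their divergence\<close>

lemma C1c_fields_iff:
  "\<psi> \<in> C1c_fields S \<longleftrightarrow> C1 \<psi> \<and> (\<exists>K. compact K \<and> K \<subseteq> S \<and> (\<forall>x. x \<notin> K \<longrightarrow> \<psi> x = 0))"
proof
  assume L: "\<psi> \<in> C1c_fields S"
  have "\<psi> x = 0" if "x \<notin> closure {x. \<psi> x \<noteq> 0}" for x
    using that closure_subset[of "{x. \<psi> x \<noteq> 0}"] by blast
  with L show "C1 \<psi> \<and> (\<exists>K. compact K \<and> K \<subseteq> S \<and> (\<forall>x. x \<notin> K \<longrightarrow> \<psi> x = 0))"
    unfolding C1_iff_blinfun C1c_fields_def by blast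
next
  assume R: "C1 \<psi> \<and> (\<exists>K. compact K \<and> K \<subseteq> S \<and> (\<forall>x. x \<notin> K \<longrightarrow> \<psi> x = 0))"
  then obtain K where K: "compact K" "K \<subseteq> S" "\<And>x. x \<notin> K \<Longrightarrow> \<psi> x = 0" by blast
  have sub: "closure {x. \<psi> x \<noteq> 0} \<subseteq> K"
    using K by (intro closure_minimal) (auto simp: compact_imp_closed)
  then have "compact (closure {x. \<psi> x \<noteq> 0})"
    using K(1) by (metis closed_closure compact_Int_closed inf.absorb_iff2)
  with sub K(2) R show "\<psi> \<in> C1c_fields S"
    unfolding C1c_fields_def C1_iff_blinfun by auto
qed

lemma C1c_fieldsE:
  assumes "\<psi> \<in> C1c_fields S"
  obtains K where "C1 \<psi>" "compact K" "K \<subseteq> S" "\<And>x. x \<notin> K \<Longrightarrow> \<psi> x = 0"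
  using assms unfolding C1c_fields_iff by blast

lemma C1c_fields_mono: "\<psi> \<in> C1c_fields S \<Longrightarrow> S \<subseteq> S' \<Longrightarrow> \<psi> \<in> C1c_fields S'"
  unfolding C1c_fields_def by blast

lemma C1c_fields_zero: "(\<lambda>_. 0) \<in> C1c_fields S"
  unfolding C1c_fields_iff by (intro conjI exI[of _ "{}"]) auto

lemma C1c_fields_mult:
  fixes \<eta> :: "'a::euclidean_space \<Rightarrow> real"
  assumes "C1 \<eta>" "\<psi> \<in> C1c_fields S" shows "(\<lambda>x. \<eta> x *\<^sub>R \<psi> x) \<in> C1c_fields S"
proof -
  obtain K where "C1 \<psi>" "compact K" "K \<subseteq> S" "\<And>x. x \<notin> K \<Longrightarrow> \<psi> x = 0"
    using assms(2) unfolding C1c_fields_iff by auto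
  then show ?thesis unfolding C1c_fields_iff
    by (intro conjI C1_scaleR assms(1) exI[of _ K]) auto
qed

lemma C1c_fields_scaleR: "\<psi> \<in> C1c_fields S \<Longrightarrow> (\<lambda>x. c *\<^sub>R \<psi> x) \<in> C1c_fields S"
  by (rule C1c_fields_mult) simp

lemma C1c_fields_uminus: "\<psi> \<in> C1c_fields S \<Longrightarrow> (\<lambda>x. - \<psi> x) \<in> C1c_fields S"
  using C1c_fields_scaleR[of \<psi> S "-1"] by simp

lemma C1c_fields_add:
  assumes "\<psi> \<in> C1c_fields S" "\<phi> \<in> C1c_fields S" shows "(\<lambda>x. \<psi> x + \<phi> x) \<in> C1c_fields S"
proof -
  obtain K L where K: "C1 \<psi>" "compact K" "K \<subseteq> S" "\<And>x. x \<notin> K \<Longrightarrow> \<psi> x = 0"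
      and L: "C1 \<phi>" "compact L" "L \<subseteq> S" "\<And>x. x \<notin> L \<Longrightarrow> \<phi> x = 0"
    using assms by (metis C1c_fieldsE)
  then show ?thesis unfolding C1c_fields_iff
    by (intro conjI C1_add exI[of _ "K \<union> L"]) (auto simp: compact_Un)
qed

lemma C1c_fields_sum:
  "(\<And>i. i \<in> I \<Longrightarrow> \<psi> i \<in> C1c_fields S) \<Longrightarrow> (\<lambda>x. \<Sum>i\<in>I. \<psi> i x) \<in> C1c_fields S"
  by (induction I rule: infinite_finite_induct) (auto intro: C1c_fields_add C1c_fields_zero)

text \<open>Multiplying a field by an indicator keeps it continuously differentiable when the support does not meet the
  jump of the indicator. This is how test fields are broken up along cells.\<close>

lemma C1c_fields_restrict:
  fixes \<phi> :: "'a::euclidean_space \<Rightarrow> 'a"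
  assumes \<phi>: "C1 \<phi>" "compact K" "\<And>x. x \<notin> K \<Longrightarrow> \<phi> x = 0"
    and S: "open S" "open S'" "S \<inter> S' = {}" "K \<subseteq> S \<union> S'" "K \<inter> S \<subseteq> W"
  shows "(\<lambda>x. indicat_real S x *\<^sub>R \<phi> x) \<in> C1c_fields W"
  unfolding C1c_fields_iff
proof (intro conjI exI[of _ "K \<inter> S"])
  have oK: "open (- K)" using \<phi>(2) by (simp add: compact_imp_closed open_Compl)
  show "C1 (\<lambda>x. indicat_real S x *\<^sub>R \<phi> x)"
  proof (rule C1I)
    show "((\<lambda>x. indicat_real S x *\<^sub>R \<phi> x) has_derivative (\<lambda>h. indicat_real S x *\<^sub>R frechet_derivative \<phi> (at x) h)) (at x)" for x
    proof (cases "x \<in> S")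
      case True
      show ?thesis
        by (rule has_derivative_transform_within_open[of \<phi> _ _ _ S])
           (use True S(1) C1_has_derivative[OF \<phi>(1)] in auto)
    next
      case False
      then have "x \<in> S' \<union> - K" using S(4) by blast
      moreover have "open (S' \<union> - K)" using S(2) oK by (rule open_Un)
      moreover have "indicat_real S y *\<^sub>R \<phi> y = 0" if "y \<in> S' \<union> - K" for y
        using that S(3) \<phi>(3)[of y] by (auto simp: indicator_def)
      ultimately have "((\<lambda>x. indicat_real S x *\<^sub>R \<phi> x) has_derivative (\<lambda>_. 0)) (at x)"
        by (intro has_derivative_transform_within_open[OF has_derivative_const[of 0]]) auto
      then show ?thesis using False by simp
    qed
    show "continuous_on UNIV (\<lambda>x. indicat_real S x *\<^sub>R frechet_derivative \<phi> (at x) h)" for h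
    proof -
      have z: "frechet_derivative \<phi> (at x) h = 0" if "x \<notin> K" for x
      proof -
        have "(\<phi> has_derivative (\<lambda>_. 0)) (at x)"
          by (rule has_derivative_transform_within_open[of "\<lambda>_. 0" _ _ _ "-K"])
             (use that oK \<phi>(3) in auto)
        then show ?thesis by (metis frechet_derivative_at)
      qed
      have "continuous_on S (\<lambda>x. indicat_real S x *\<^sub>R frechet_derivative \<phi> (at x) h)"
        by (rule continuous_on_eq[OF continuous_on_subset[OF C1_continuous_derivative[OF \<phi>(1)]]]) auto
      moreover have "continuous_on (S' \<union> - K) (\<lambda>x. indicat_real S x *\<^sub>R frechet_derivative \<phi> (at x) h)"
        by (rule continuous_on_eq[OF continuous_on_const[of _ 0]]) (use S(3) z in \<open>auto simp: indicator_def\<close>)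
      ultimately have "continuous_on (S \<union> (S' \<union> - K)) (\<lambda>x. indicat_real S x *\<^sub>R frechet_derivative \<phi> (at x) h)"
        by (rule continuous_on_open_Un[OF S(1) open_Un[OF S(2) oK]])
      moreover have "S \<union> (S' \<union> - K) = UNIV" using S(4) by blast
      ultimately show ?thesis by simp
    qed
  qed
  have "K \<inter> S = K \<inter> - S'" using S(3,4) by blast
  then show "compact (K \<inter> S)" using \<phi>(2) S(2) by (simp add: compact_Int_closed closed_Compl)
  show "\<forall>x. x \<notin> K \<inter> S \<longrightarrow> indicat_real S x *\<^sub>R \<phi> x = 0" using \<phi>(3) by (auto simp: indicator_def)
qed (fact S(5))

lemma divergence_eq:
  "(\<psi> has_derivative D) (at x) \<Longrightarrow> divergence \<psi> x = (\<Sum>b\<in>Basis. D b \<bullet> b)"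
  unfolding divergence_def by (metis frechet_derivative_at)

lemma divergence_cong_open:
  assumes "C1 \<psi>" "open U" "x \<in> U" "\<And>y. y \<in> U \<Longrightarrow> \<psi> y = \<phi> y"
  shows "divergence \<phi> x = divergence \<psi> x"
proof -
  have "(\<phi> has_derivative frechet_derivative \<psi> (at x)) (at x)"
    by (rule has_derivative_transform_within_open[OF C1_has_derivative[OF assms(1)] assms(2,3)])
       (use assms(4) in auto)
  then show ?thesis by (metis divergence_eq divergence_def)
qed

lemma divergence_zero_outside:
  assumes "closed K" "\<And>x. x \<notin> K \<Longrightarrow> \<psi> x = 0" "x \<notin> K"
  shows "divergence \<psi> x = 0"
proof -
  have "open (- K)" using assms(1) by (rule open_Compl)
  then show ?thesis
    using divergence_cong_open[of "\<lambda>_. 0" "-K" x \<psi>] divergence_eq[of "\<lambda>_. 0" "\<lambda>_. 0"] assms by auto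
qed

lemma divergence_add:
  "C1 \<psi> \<Longrightarrow> C1 \<phi> \<Longrightarrow> divergence (\<lambda>x. \<psi> x + \<phi> x) x = divergence \<psi> x + divergence \<phi> x"
  by (subst divergence_eq[OF has_derivative_add[OF C1_has_derivative C1_has_derivative]])
     (auto simp: divergence_def inner_add_left sum.distrib)

lemma divergence_mult:
  fixes \<eta> :: "'a::euclidean_space \<Rightarrow> real"
  assumes "C1 \<eta>" "C1 \<psi>"
  shows "divergence (\<lambda>x. \<eta> x *\<^sub>R \<psi> x) x
    = \<eta> x * divergence \<psi> x + frechet_derivative \<eta> (at x) (\<psi> x)"
proof -
  interpret linear "frechet_derivative \<eta> (at x)"
    using C1_has_derivative[OF assms(1)] by (rule has_derivative_linear)
  have "frechet_derivative \<eta> (at x) (\<psi> x) = frechet_derivative \<eta> (at x) (\<Sum>b\<in>Basis. (\<psi> x \<bullet> b) *\<^sub>R b)"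
    by (simp add: euclidean_representation)
  also have "\<dots> = (\<Sum>b\<in>Basis. frechet_derivative \<eta> (at x) b * (\<psi> x \<bullet> b))"
    by (simp add: sum scale mult.commute)
  finally show ?thesis
    by (subst divergence_eq[OF has_derivative_scaleR[OF C1_has_derivative[OF assms(1)] C1_has_derivative[OF assms(2)]]])
       (simp add: divergence_def inner_add_left sum.distrib sum_distrib_left)
qed

lemma divergence_scaleR: "C1 \<psi> \<Longrightarrow> divergence (\<lambda>x. c *\<^sub>R \<psi> x) x = c * divergence \<psi> x"
  by (subst divergence_mult) (simp_all add: frechet_derivative_const)

lemma continuous_divergence: "C1 \<psi> \<Longrightarrow> continuous_on UNIV (divergence \<psi>)"
  unfolding divergence_def by (intro continuous_intros C1_continuous_derivative)

lemma integrable_continuous_compact_support: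
  fixes f :: "'a::euclidean_space \<Rightarrow> real"
  assumes "continuous_on UNIV f" "compact K" "\<And>x. x \<notin> K \<Longrightarrow> f x = 0"
  shows "integrable lebesgue f"
proof -
  have "set_integrable lborel K f"
    unfolding set_integrable_def
    by (rule borel_integrable_compact[OF assms(2) continuous_on_subset[OF assms(1)]]) simp
  moreover have "(\<lambda>x. indicator K x *\<^sub>R f x) = f" using assms(3) by (force simp: indicator_def)
  ultimately have i: "integrable lborel f" unfolding set_integrable_def by simp
  then show ?thesis by (subst integrable_completion) auto
qed

lemma bounded_continuous_compact_support:
  fixes f :: "'a::euclidean_space \<Rightarrow> real"
  assumes "continuous_on UNIV f" "compact K" "\<And>x. x \<notin> K \<Longrightarrow> f x = 0"
  obtains M where "M > 0" "\<And>x. \<bar>f x\<bar> \<le> M"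
proof -
  have "bounded (f ` K)"
    by (rule compact_imp_bounded[OF compact_continuous_image[OF continuous_on_subset[OF assms(1)] assms(2)]]) simp
  then obtain M where M: "M > 0" "\<And>y. y \<in> f ` K \<Longrightarrow> \<bar>y\<bar> \<le> M" unfolding bounded_pos by auto
  have "\<bar>f x\<bar> \<le> M" for x using M assms(3)[of x] by (cases "x \<in> K") auto
  with M(1) that show ?thesis by blast
qed

lemma integrable_bounded_mult:
  fixes f :: "'a::euclidean_space \<Rightarrow> real"
  assumes "integrable lebesgue f" "u \<in> borel_measurable lebesgue" "\<And>x. \<bar>u x\<bar> \<le> M"
  shows "integrable lebesgue (\<lambda>x. u x * f x)"
proof (rule Bochner_Integration.integrable_bound)
  show "integrable lebesgue (\<lambda>x. M * f x)" using assms(1) by simp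
  show "AE x in lebesgue. norm (u x * f x) \<le> norm (M * f x)"
    using assms(3) by (intro AE_I2) (auto simp: abs_mult intro!: mult_right_mono intro: order_trans[OF _ abs_ge_self])
  show "(\<lambda>x. u x * f x) \<in> borel_measurable lebesgue" using assms(1,2) by (auto dest: borel_measurable_integrable)
qed

lemma C1c_fields_integrable_divergence:
  assumes "\<psi> \<in> C1c_fields S" shows "integrable lebesgue (divergence \<psi>)"
proof -
  obtain K where "C1 \<psi>" "compact K" "K \<subseteq> S" "\<And>x. x \<notin> K \<Longrightarrow> \<psi> x = 0"
    using assms unfolding C1c_fields_iff by auto
  then show ?thesis
    by (intro integrable_continuous_compact_support[of _ K] continuous_divergence)
       (auto intro: divergence_zero_outside compact_imp_closed)
qed

lemma C1_difference_quotient_bound: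
  fixes f :: "'a::euclidean_space \<Rightarrow> real"
  assumes f: "C1 f" "compact K" "\<And>x. x \<notin> K \<Longrightarrow> f x = 0"
  obtains M where "M > 0" "\<And>x t. \<bar>f (x + t *\<^sub>R b) - f x\<bar> \<le> M * \<bar>t\<bar>"
proof -
  have z: "frechet_derivative f (at x) b = 0" if "x \<notin> K" for x
  proof -
    have "(f has_derivative (\<lambda>_. 0)) (at x)"
      by (rule has_derivative_transform_within_open[of "\<lambda>_. 0" _ _ _ "-K"])
         (use that f(2,3) in \<open>auto simp: compact_imp_closed\<close>)
    then show ?thesis by (metis frechet_derivative_at)
  qed
  obtain M where M: "M > 0" "\<And>x. \<bar>frechet_derivative f (at x) b\<bar> \<le> M"
    using bounded_continuous_compact_support[OF C1_continuous_derivative[OF f(1)] f(2) z] by blast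
  have "\<bar>f (x + t *\<^sub>R b) - f x\<bar> \<le> M * \<bar>t\<bar>" for x t
  proof -
    have d: "((\<lambda>s. f (x + s *\<^sub>R b)) has_real_derivative frechet_derivative f (at (x + s *\<^sub>R b)) b) (at s)" for s
    proof -
      have a: "((\<lambda>s. x + s *\<^sub>R b) has_derivative (\<lambda>s. s *\<^sub>R b)) (at s)"
        by (auto intro!: derivative_eq_intros)
      have "((\<lambda>s. f (x + s *\<^sub>R b)) has_derivative (\<lambda>r. frechet_derivative f (at (x + s *\<^sub>R b)) (r *\<^sub>R b))) (at s)"
        by (rule has_derivative_compose[OF a C1_has_derivative[OF f(1)]])
      moreover have "frechet_derivative f (at (x + s *\<^sub>R b)) (r *\<^sub>R b) = frechet_derivative f (at (x + s *\<^sub>R b)) b * r" for r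
        using linear_scale[OF has_derivative_linear[OF C1_has_derivative[OF f(1)]]] by simp
      ultimately show ?thesis unfolding has_field_derivative_def by simp
    qed
    have "norm (f (x + t *\<^sub>R b) - f (x + 0 *\<^sub>R b)) \<le> M * norm (t - 0)"
      by (rule field_differentiable_bound[of UNIV "\<lambda>s. f (x + s *\<^sub>R b)"]) (use d M in auto)
    then show ?thesis by simp
  qed
  with M(1) that show ?thesis by blast
qed

text \<open>The difference quotients of a \<open>C\<^sup>1\<close> function with compact support are uniformly bounded and vanish off a
  fixed ball, so dominated convergence applies. Integration by parts, in every form needed here, comes from this
  limit and the translation invariance of Lebesgue measure; no surface integrals enter.\<close>

lemma integral_difference_quotient_tendsto:
  fixes f :: "'a::euclidean_space \<Rightarrow> real"
  assumes f: "C1 f" "compact K" "\<And>x. x \<notin> K \<Longrightarrow> f x = 0" and A: "A \<in> sets lebesgue"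
  shows "((\<lambda>t. LINT x|lebesgue. indicator A x * ((f (x + t *\<^sub>R b) - f x) / t))
     \<longlongrightarrow> (LINT x|lebesgue. indicator A x * frechet_derivative f (at x) b)) (at 0)"
  unfolding tendsto_at_iff_sequentially
proof (intro allI impI)
  fix X :: "nat \<Rightarrow> real" assume X: "\<forall>i. X i \<in> UNIV - {0}" "X \<longlonglongrightarrow> 0"
  obtain M where M: "M > 0" "\<And>x t. \<bar>f (x + t *\<^sub>R b) - f x\<bar> \<le> M * \<bar>t\<bar>"
    using C1_difference_quotient_bound[OF f] by blast
  obtain B where B: "B > 0" "\<And>i. \<bar>X i\<bar> \<le> B"
    using convergent_imp_Bseq[OF convergentI[OF X(2)]] unfolding Bseq_def by auto
  obtain R where R: "\<And>x. x \<in> K \<Longrightarrow> norm x \<le> R"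
    using compact_imp_bounded[OF f(2)] unfolding bounded_iff by blast
  define C where "C = cball (0::'a) (R + B * norm b)"
  have fm: "f \<in> borel_measurable borel" using C1_continuous[OF f(1)] by (rule borel_measurable_continuous_onI)
  show "((\<lambda>t. LINT x|lebesgue. indicator A x * ((f (x + t *\<^sub>R b) - f x) / t)) \<circ> X) \<longlonglongrightarrow>
     (LINT x|lebesgue. indicator A x * frechet_derivative f (at x) b)"
    unfolding o_def
  proof (rule integral_dominated_convergence[where w="\<lambda>x. indicator C x * M"])
    have "(\<lambda>x. frechet_derivative f (at x) b) \<in> borel_measurable lebesgue"
      using borel_measurable_continuous_onI[OF C1_continuous_derivative[OF f(1)]]
      by (intro measurable_completion) simp
    then show "(\<lambda>x. indicator A x * frechet_derivative f (at x) b) \<in> borel_measurable lebesgue"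
      using A by measurable
    fix i
    have "(\<lambda>x. (f (x + X i *\<^sub>R b) - f x) / X i) \<in> borel_measurable lebesgue"
    proof (intro measurable_completion)
      have "(\<lambda>x. f (x + X i *\<^sub>R b)) \<in> borel_measurable borel"
        by (rule measurable_compose[OF _ fm]) measurable
      then show "(\<lambda>x. (f (x + X i *\<^sub>R b) - f x) / X i) \<in> borel_measurable lborel"
        using fm by simp
    qed
    then show "(\<lambda>x. indicator A x * ((f (x + X i *\<^sub>R b) - f x) / X i)) \<in> borel_measurable lebesgue"
      using A by measurable
    show "AE x in lebesgue. norm (indicator A x * ((f (x + X i *\<^sub>R b) - f x) / X i)) \<le> indicator C x * M"
    proof (intro AE_I2)
      fix x
      show "norm (indicator A x * ((f (x + X i *\<^sub>R b) - f x) / X i)) \<le> indicator C x * M"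
      proof (cases "x \<in> C")
        case True
        have "\<bar>(f (x + X i *\<^sub>R b) - f x) / X i\<bar> \<le> M"
          using M(2)[of x "X i"] X(1) by (simp add: abs_divide divide_le_eq)
        then show ?thesis using True M(1) by (auto simp: indicator_def)
      next
        case False
        have "norm (X i *\<^sub>R b) \<le> B * norm b" using B(2)[of i] by (simp add: mult_right_mono)
        with False have "norm x > R + norm (X i *\<^sub>R b)" unfolding C_def by (simp)
        moreover from this have "norm (x + X i *\<^sub>R b) > R"
          using norm_diff_ineq[of x "X i *\<^sub>R b"] by linarith
        ultimately have "norm x > R" "norm (x + X i *\<^sub>R b) > R" using norm_ge_zero[of "X i *\<^sub>R b"] by linarith+
        then have "x \<notin> K" "x + X i *\<^sub>R b \<notin> K" using R by fastforce+
        then show ?thesis using f(3) False by simp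
      qed
    qed
  next
    have "integrable lebesgue (indicat_real C)" unfolding C_def using emeasure_lborel_cball_finite[of "0::'a"] by (simp add: integrable_indicator_iff less_top)
    then show "integrable lebesgue (\<lambda>x. indicator C x * M)" by simp
  next
    show "AE x in lebesgue. (\<lambda>i. indicator A x * ((f (x + X i *\<^sub>R b) - f x) / X i))
        \<longlonglongrightarrow> indicator A x * frechet_derivative f (at x) b"
    proof (intro AE_I2 tendsto_mult tendsto_const)
      fix x
      interpret linear "frechet_derivative f (at x)"
        by (rule has_derivative_linear[OF C1_has_derivative[OF f(1)]])
      have "((\<lambda>s. x + s *\<^sub>R b) has_derivative (\<lambda>s. s *\<^sub>R b)) (at 0)"
        by (auto intro!: derivative_eq_intros)
      from has_derivative_compose[OF this, of f "frechet_derivative f (at x)"] C1_has_derivative[OF f(1), of x]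
      have "((\<lambda>s. f (x + s *\<^sub>R b)) has_derivative (\<lambda>s. frechet_derivative f (at x) (s *\<^sub>R b))) (at 0)" by simp
      then have "((\<lambda>s. f (x + s *\<^sub>R b)) has_real_derivative frechet_derivative f (at x) b) (at 0)"
        unfolding has_field_derivative_def by (simp add: scale mult_commute_abs)
      then have "((\<lambda>h. (f (x + h *\<^sub>R b) - f x) / h) \<longlongrightarrow> frechet_derivative f (at x) b) (at 0)"
        unfolding DERIV_def by simp
      then show "(\<lambda>i. (f (x + X i *\<^sub>R b) - f x) / X i) \<longlonglongrightarrow> frechet_derivative f (at x) b"
        using X unfolding tendsto_at_iff_sequentially o_def by blast
    qed
  qed
qed

lemma lebesgue_integral_translation:
  fixes f :: "'a::euclidean_space \<Rightarrow> real"
  assumes "f \<in> borel_measurable borel"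
  shows "(LINT x|lebesgue. f (x + a)) = (LINT x|lebesgue. f x)"
proof -
  have "(LINT x|lebesgue. f (x + a)) = (LINT x|lborel. f (a + x))"
    using assms by (subst integral_completion) (auto simp: add.commute)
  also have "\<dots> = (LINT x|distr lborel borel ((+) a). f x)"
    using assms by (subst integral_distr) auto
  also have "\<dots> = (LINT x|lebesgue. f x)"
    using assms by (simp add: lborel_distr_plus integral_completion)
  finally show ?thesis .
qed

text \<open>By translation invariance every difference quotient already integrates to zero.\<close>

lemma integral_directional_derivative_zero:
  fixes f :: "'a::euclidean_space \<Rightarrow> real"
  assumes f: "C1 f" "compact K" "\<And>x. x \<notin> K \<Longrightarrow> f x = 0"
  shows "(LINT x|lebesgue. frechet_derivative f (at x) b) = 0"
proof -
  have fm: "f \<in> borel_measurable borel"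
    using C1_continuous[OF f(1)] by (rule borel_measurable_continuous_onI)
  have i: "integrable lebesgue f"
    by (rule integrable_continuous_compact_support[OF C1_continuous[OF f(1)] f(2,3)])
  have it: "integrable lebesgue (\<lambda>x. f (x + a))" for a
  proof (rule integrable_continuous_compact_support)
    show "continuous_on UNIV (\<lambda>x. f (x + a))"
      by (rule continuous_on_compose2[OF C1_continuous[OF f(1), of UNIV]]) (auto intro!: continuous_intros)
    show "compact ((\<lambda>x. x - a) ` K)"
      by (rule compact_continuous_image[OF _ f(2)]) (intro continuous_intros)
    fix x assume "x \<notin> (\<lambda>x. x - a) ` K"
    then have "x + a \<notin> K" by (metis add_diff_cancel_right' image_eqI)
    then show "f (x + a) = 0" by (rule f(3))
  qed
  have *: "(LINT x|lebesgue. indicator UNIV x * ((f (x + t *\<^sub>R b) - f x) / t)) = 0" for t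
    using it i lebesgue_integral_translation[OF fm] by (simp add: integral_divide_zero)
  have "((\<lambda>t::real. 0) \<longlongrightarrow> (LINT x|lebesgue. frechet_derivative f (at x) b)) (at 0)"
    using integral_difference_quotient_tendsto[OF f, of UNIV b] unfolding * by simp
  then show ?thesis using tendsto_unique[OF at_neq_bot[of "0::real"] tendsto_const] by metis
qed

lemma integral_divergence_zero:
  assumes "\<psi> \<in> C1c_fields S"
  shows "(LINT x|lebesgue. divergence \<psi> x) = 0"
proof -
  obtain K where K: "C1 \<psi>" "compact K" "K \<subseteq> S" "\<And>x. x \<notin> K \<Longrightarrow> \<psi> x = 0"
    using assms unfolding C1c_fields_iff by auto
  have d: "((\<lambda>x. \<psi> x \<bullet> b) has_derivative (\<lambda>h. frechet_derivative \<psi> (at x) h \<bullet> b)) (at x)" for b x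
    by (rule has_derivative_inner_left[OF C1_has_derivative[OF K(1)]])
  then have fd: "frechet_derivative (\<lambda>x. \<psi> x \<bullet> b) (at x) h = frechet_derivative \<psi> (at x) h \<bullet> b" for b x h
    by (metis frechet_derivative_at)
  have c: "C1 (\<lambda>x. \<psi> x \<bullet> b)" for b
    by (rule C1I[OF d]) (intro continuous_intros C1_continuous_derivative K)
  have z: "(LINT x|lebesgue. frechet_derivative \<psi> (at x) b \<bullet> b) = 0" for b
    using integral_directional_derivative_zero[OF c K(2), of b b] K(4) by (simp add: fd)
  have dz: "frechet_derivative \<psi> (at x) b = 0" if "x \<notin> K" for x b
  proof -
    have "(\<psi> has_derivative (\<lambda>_. 0)) (at x)"
      by (rule has_derivative_transform_within_open[of "\<lambda>_. 0" _ _ _ "-K"])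
         (use that K(2,4) in \<open>auto simp: compact_imp_closed\<close>)
    then show ?thesis by (metis frechet_derivative_at)
  qed
  have "integrable lebesgue (\<lambda>x. frechet_derivative \<psi> (at x) b \<bullet> b)" for b
    by (rule integrable_continuous_compact_support[OF _ K(2)])
       (auto intro!: continuous_intros C1_continuous_derivative K(1) simp: dz)
  then show ?thesis unfolding divergence_def by (simp add: z)
qed

section \<open>Sets of zero perimeter\<close>

text \<open>Along the segment, the derivative of the integral of the moving function \<open>g\<close> over \<open>A\<close> is the integral
  over \<open>A\<close> of the divergence of the field \<open>- g h\<close>, which vanishes by hypothesis.\<close>

lemma integral_translate_within:
  fixes g :: "'a::euclidean_space \<Rightarrow> real"
  assumes A: "A \<in> sets lebesgue"
    and div0: "\<And>\<psi>. \<psi> \<in> C1c_fields S \<Longrightarrow> (LINT x|lebesgue. indicator A x * divergence \<psi> x) = 0"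
    and g: "C1 g" "compact K" "\<And>x. x \<notin> K \<Longrightarrow> g x = 0"
    and seg: "\<And>x s. x \<in> K \<Longrightarrow> 0 \<le> s \<Longrightarrow> s \<le> 1 \<Longrightarrow> x + s *\<^sub>R h \<in> S"
  shows "(LINT x|lebesgue. indicator A x * g (x - h)) = (LINT x|lebesgue. indicator A x * g x)"
proof -
  define F where "F s = (LINT x|lebesgue. indicator A x * g (x - s *\<^sub>R h))" for s
  have shift: "C1 (\<lambda>x. g (x - s *\<^sub>R h))" "compact ((\<lambda>x. x + s *\<^sub>R h) ` K)"
     "x \<notin> (\<lambda>x. x + s *\<^sub>R h) ` K \<Longrightarrow> g (x - s *\<^sub>R h) = 0" for s x
  proof -
    show "C1 (\<lambda>x. g (x - s *\<^sub>R h))"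
    proof (rule C1I)
      show "((\<lambda>x. g (x - s *\<^sub>R h)) has_derivative frechet_derivative g (at (x - s *\<^sub>R h))) (at x)" for x
        by (rule has_derivative_compose[of "\<lambda>x. x - s *\<^sub>R h" "\<lambda>h. h" x UNIV g, OF _ C1_has_derivative[OF g(1)]])
           (auto intro!: derivative_eq_intros)
      show "continuous_on UNIV (\<lambda>x. frechet_derivative g (at (x - s *\<^sub>R h)) k)" for k
        by (rule continuous_on_compose2[OF C1_continuous_derivative[OF g(1)], of UNIV "\<lambda>x. x - s *\<^sub>R h"])
           (auto intro!: continuous_intros)
    qed
    show "compact ((\<lambda>x. x + s *\<^sub>R h) ` K)"
      by (rule compact_continuous_image[OF _ g(2)]) (intro continuous_intros)
    assume "x \<notin> (\<lambda>x. x + s *\<^sub>R h) ` K"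
    then have "x - s *\<^sub>R h \<notin> K" by (metis diff_add_cancel image_eqI)
    then show "g (x - s *\<^sub>R h) = 0" by (rule g(3))
  qed
  have int: "integrable lebesgue (\<lambda>x. indicator A x * g (x - s *\<^sub>R h))" for s
    using A by (intro integrable_bounded_mult[where M=1] integrable_continuous_compact_support[OF C1_continuous[OF shift(1)] shift(2,3)])
      (auto simp: indicator_def)
  have "(F has_real_derivative 0) (at s)" if s: "0 \<le> s" "s \<le> 1" for s
  proof -
    have "(\<lambda>x. g (x - s *\<^sub>R h) *\<^sub>R (- h)) \<in> C1c_fields S"
      unfolding C1c_fields_iff using seg s shift(2,3)[where s=s]
      by (intro conjI C1_scaleR shift(1) C1_const exI[of _ "(\<lambda>x. x + s *\<^sub>R h) ` K"]) auto
    from div0[OF this]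
    have "(LINT x|lebesgue. indicator A x * frechet_derivative (\<lambda>x. g (x - s *\<^sub>R h)) (at x) (- h)) = 0"
      by (subst (asm) divergence_mult[OF shift(1) C1_const])
         (simp add: divergence_eq[of "\<lambda>_. - h" "\<lambda>_. 0"])
    with integral_difference_quotient_tendsto[OF shift(1)[of s] shift(2)[of s] shift(3)[where s=s] A, where b="- h"]
    have "((\<lambda>t. LINT x|lebesgue. indicator A x * ((g (x + t *\<^sub>R - h - s *\<^sub>R h) - g (x - s *\<^sub>R h)) / t)) \<longlongrightarrow> 0) (at 0)"
      by simp
    moreover have *: "(LINT x|lebesgue. indicator A x * ((g (x + t *\<^sub>R - h - s *\<^sub>R h) - g (x - s *\<^sub>R h)) / t))
       = (F (s + t) - F s) / t" for t
    proof -
      have "(\<lambda>x. indicator A x * ((g (x + t *\<^sub>R - h - s *\<^sub>R h) - g (x - s *\<^sub>R h)) / t))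
        = (\<lambda>x. (indicator A x * g (x - (s + t) *\<^sub>R h) - indicator A x * g (x - s *\<^sub>R h)) / t)"
        by (auto simp: fun_eq_iff algebra_simps indicator_def diff_divide_distrib)
      then show ?thesis unfolding F_def by (simp add: Bochner_Integration.integral_diff[OF int int])
    qed
    ultimately show ?thesis unfolding * DERIV_def by simp
  qed
  then have "F 1 = F 0"
    by (intro DERIV_isconst_end[of 0 1 F]) (auto intro!: DERIV_continuous_on[of "{0..1}" F "\<lambda>_. 0"] intro: has_field_derivative_at_within)
  then show ?thesis unfolding F_def by simp
qed

text \<open>Smooth radial functions increase to the indicator of the ball, so the invariance under translation passes
  from functions to balls.\<close>

lemma ball_measure_translate:
  fixes S :: "'a::euclidean_space set"
  assumes A: "A \<in> sets lebesgue" and S: "convex S"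
    and div0: "\<And>\<psi>. \<psi> \<in> C1c_fields S \<Longrightarrow> (LINT x|lebesgue. indicator A x * divergence \<psi> x) = 0"
    and xy: "cball x d \<subseteq> S" "cball y d \<subseteq> S"
  shows "measure lebesgue (A \<inter> ball x d) = measure lebesgue (A \<inter> ball y d)"
proof (cases "d > 0")
  case True
  define g where "g n z = ramp (real n * (d\<^sup>2 - (norm (z - x))\<^sup>2))" for n and z :: 'a
  have C: "C1 (g n)" for n
    unfolding g_def by (intro C1_ramp C1_mult C1_diff C1_norm_sq C1_const)
  have z: "g n z = 0" if "z \<notin> cball x d" for n z
  proof -
    have "norm (z - x) \<ge> d" using that by (simp add: dist_norm norm_minus_commute)
    then have "d\<^sup>2 \<le> (norm (z - x))\<^sup>2" using True by (intro power_mono) auto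
    then show ?thesis unfolding g_def by (intro ramp_le0) (simp add: mult_nonneg_nonpos)
  qed
  have lim: "(\<lambda>n. g n z) \<longlonglongrightarrow> indicator (ball x d) z" for z
  proof -
    have "d\<^sup>2 - (norm (z - x))\<^sup>2 > 0 \<longleftrightarrow> norm (z - x) < d"
      using True power2_less_imp_less[of "norm (z - x)" d] power_strict_mono[of "norm (z - x)" d 2] by auto
    moreover have "norm (z - x) < d \<longleftrightarrow> z \<in> ball x d" by (simp add: dist_norm norm_minus_commute)
    ultimately show ?thesis
      using ramp_tendsto_indicator[of "d\<^sup>2 - (norm (z - x))\<^sup>2"] unfolding g_def by (simp add: indicator_def)
  qed
  have eq: "(LINT z|lebesgue. indicator A z * g n (z - (y - x))) = (LINT z|lebesgue. indicator A z * g n z)" for n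
  proof (rule integral_translate_within[OF A div0 C compact_cball z])
    fix z and s :: real assume zs: "z \<in> cball x d" "0 \<le> s" "s \<le> 1"
    have "dist y (z + (y - x)) = dist x z" by (simp add: dist_norm algebra_simps)
    then have "z \<in> S" "z + (y - x) \<in> S" using zs(1) xy by (auto simp: subset_iff)
    then have "(1 - s) *\<^sub>R z + s *\<^sub>R (z + (y - x)) \<in> S"
      using zs by (intro convexD[OF S]) auto
    then show "z + s *\<^sub>R (y - x) \<in> S" by (simp add: algebra_simps)
  qed
  have dom: "(\<lambda>n. LINT z|lebesgue. indicator A z * g n (z - a)) \<longlonglongrightarrow> measure lebesgue (A \<inter> ball (x + a) d)" for a
  proof -
    have "(\<lambda>n. LINT z|lebesgue. indicator A z * g n (z - a)) \<longlonglongrightarrow>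
        (LINT z|lebesgue. indicator A z * indicator (ball x d) (z - a))"
    proof (rule integral_dominated_convergence[where w="indicator (cball (x + a) d)"])
      have "g n \<in> borel_measurable borel" for n
        using C1_continuous[OF C] by (rule borel_measurable_continuous_onI)
      then have "(\<lambda>z. g n (z - a)) \<in> borel_measurable lebesgue" for n
        by (intro measurable_completion) (rule measurable_compose[of "\<lambda>z. z - a" _ borel], auto)
      then show "(\<lambda>z. indicator A z * g n (z - a)) \<in> borel_measurable lebesgue" for n
        using A by measurable
      have "(\<lambda>z. indicat_real (ball x d) (z - a)) \<in> borel_measurable lebesgue"
        by (intro measurable_completion)
           (rule measurable_compose[of "\<lambda>z. z - a" _ borel], auto intro!: borel_measurable_indicator)
      then show "(\<lambda>z. indicat_real A z * indicat_real (ball x d) (z - a)) \<in> borel_measurable lebesgue"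
        using A by measurable
      show "integrable lebesgue (indicat_real (cball (x + a) d))"
        using emeasure_lborel_cball_finite[of "x + a"] by (simp add: integrable_indicator_iff less_top)
      show "AE z in lebesgue. (\<lambda>n. indicator A z * g n (z - a)) \<longlonglongrightarrow> indicator A z * indicator (ball x d) (z - a)"
        by (intro AE_I2 tendsto_mult lim tendsto_const)
      show "AE z in lebesgue. norm (indicator A z * g n (z - a)) \<le> indicat_real (cball (x + a) d) z" for n
      proof (intro AE_I2)
        fix z
        show "norm (indicator A z * g n (z - a)) \<le> indicat_real (cball (x + a) d) z"
        proof (cases "z \<in> cball (x + a) d")
          case True
          then show ?thesis using ramp_range unfolding g_def by (auto simp: indicator_def)
        next
          case False
          then have "z - a \<notin> cball x d" by (simp add: dist_norm algebra_simps)
          then show ?thesis using z False by simp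
        qed
      qed
    qed
    also have "(\<lambda>z. indicator A z * indicator (ball x d) (z - a)) = indicat_real (A \<inter> ball (x + a) d)"
      by (auto simp: indicator_def fun_eq_iff dist_norm algebra_simps)
    finally show ?thesis using A by (simp add: Int_commute)
  qed
  from dom[of "y - x"] dom[of 0] show ?thesis unfolding eq using LIMSEQ_unique by auto
qed (simp add: not_less ball_empty)

text \<open>A weak substitute for the Lebesgue density theorem: cover \<open>C\<close>, up to a null set, by disjoint small balls inside an
  open set of nearly the same measure. Each ball has at most the proportion \<open>q\<close> of its volume in \<open>C\<close>, so \<open>C\<close>
  would have at most about \<open>q\<close> times its own measure.\<close>

lemma negligible_if_density_less_1:
  fixes C :: "'a::euclidean_space set"
  assumes C: "C \<in> lmeasurable" and q: "q < 1"
    and dens: "\<And>x. x \<in> C \<Longrightarrow> \<exists>r>0. \<forall>d. 0 < d \<and> d \<le> r \<longrightarrow>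
        measure lebesgue (C \<inter> ball x d) \<le> q * measure lebesgue (ball x d)"
  shows "negligible C"
proof (rule ccontr)
  assume "\<not> negligible C"
  then have m: "measure lebesgue C > 0" using C by (metis negligible_iff_measure zero_less_measure_iff)
  \<comment> \<open>The constant \<open>p\<close> replaces \<open>q\<close> to be positive; \<open>e\<close> is chosen so that \<open>p (measure C + e) = measure C\<close>.\<close>
  define p where "p = max q (1/2)"
  have p: "0 < p" "p < 1" "q \<le> p" using q unfolding p_def by auto
  define e where "e = measure lebesgue C * (1 - p) / p"
  have "e > 0" using m p unfolding e_def by simp
  from sets_lebesgue_outer_open[OF fmeasurableD[OF C] this] obtain U where
    U: "open U" "C \<subseteq> U" "U - C \<in> lmeasurable" "emeasure lebesgue (U - C) < ennreal e" .
  have "U = C \<union> (U - C)" using U(2) by blast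
  then have Um: "U \<in> lmeasurable" using C U(3) by (metis fmeasurable.Un)
  have "measure lebesgue (U - C) < e"
    using U(3,4) \<open>e > 0\<close> by (simp add: emeasure_eq_measure2 ennreal_less_iff)
  moreover have "measure lebesgue (U - C) = measure lebesgue U - measure lebesgue C"
    using Um C U(2) by (intro measurable_measure_Diff) auto
  ultimately have Ue: "measure lebesgue U < measure lebesgue C + e" by simp
  define K where "K = {(x, d). x \<in> C \<and> 0 < d \<and> ball x d \<subseteq> U \<and>
       measure lebesgue (C \<inter> ball x d) \<le> q * measure lebesgue (ball x d)}"
  have cov: "\<exists>i. i \<in> K \<and> x \<in> ball (fst i) (snd i) \<and> snd i < d" if xd: "x \<in> C" "0 < d" for x d
  proof -
    obtain r where r: "r > 0" "\<And>d. 0 < d \<Longrightarrow> d \<le> r \<Longrightarrow>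
        measure lebesgue (C \<inter> ball x d) \<le> q * measure lebesgue (ball x d)" using dens[OF xd(1)] by blast
    obtain s where s: "s > 0" "ball x s \<subseteq> U" using U(1,2) xd(1) unfolding open_contains_ball by blast
    define t where "t = min (min r s) (d/2)"
    have "t > 0" "t \<le> r" "t < d" "ball x t \<subseteq> ball x s" using r s xd unfolding t_def by auto
    then have "(x, t) \<in> K" using r s xd unfolding K_def by auto
    then show ?thesis using \<open>t > 0\<close> \<open>t < d\<close> by force
  qed
  obtain D where D: "countable D" "D \<subseteq> K"
     "pairwise (\<lambda>i j. disjnt (ball (fst i) (snd i)) (ball (fst j) (snd j))) D"
     "negligible (C - (\<Union>i\<in>D. ball (fst i) (snd i)))"
    by (rule Vitali_covering_theorem_balls[of C K fst snd]) (use cov in auto)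
  have dj: "disjoint_family_on (\<lambda>i. ball (fst i) (snd i)) D"
    using D(3) by (auto simp: pairwise_def disjoint_family_on_def disjnt_def)
  then have dj': "disjoint_family_on (\<lambda>i. C \<inter> ball (fst i) (snd i)) D"
    unfolding disjoint_family_on_def by blast
  have Cs: "C \<in> sets lebesgue" using C by auto
  define W where "W = (\<Union>i\<in>D. ball (fst i) (snd i))"
  have "open W" unfolding W_def by auto
  then have W: "W \<in> sets lebesgue" by auto
  have "emeasure lebesgue C = emeasure lebesgue ((C - W) \<union> (C \<inter> W))"
    by (rule arg_cong[where f="emeasure lebesgue"]) blast
  also have "\<dots> \<le> emeasure lebesgue (C - W) + emeasure lebesgue (C \<inter> W)"
    using Cs W by (intro emeasure_subadditive) auto
  also have "emeasure lebesgue (C - W) = 0"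
    using D(4) unfolding W_def negligible_iff_null_sets by auto
  also have "0 + emeasure lebesgue (C \<inter> W) = emeasure lebesgue (\<Union>i\<in>D. C \<inter> ball (fst i) (snd i))"
    unfolding W_def by simp
  also have "\<dots> = (\<integral>\<^sup>+i. emeasure lebesgue (C \<inter> ball (fst i) (snd i)) \<partial>count_space D)"
    using Cs D(1) dj' by (intro emeasure_UN_countable) auto
  also have "\<dots> \<le> (\<integral>\<^sup>+i. ennreal p * emeasure lebesgue (ball (fst i) (snd i)) \<partial>count_space D)"
  proof (intro nn_integral_mono)
    fix i assume "i \<in> space (count_space D)"
    then have "i \<in> K" using D(2) by auto
    then have "measure lebesgue (C \<inter> ball (fst i) (snd i)) \<le> q * measure lebesgue (ball (fst i) (snd i))"
      unfolding K_def by auto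
    also have "\<dots> \<le> p * measure lebesgue (ball (fst i) (snd i))"
      using p by (intro mult_right_mono) auto
    finally have "ennreal (measure lebesgue (C \<inter> ball (fst i) (snd i))) \<le> ennreal (p * measure lebesgue (ball (fst i) (snd i)))"
      by (rule ennreal_leI)
    moreover have "C \<inter> ball (fst i) (snd i) \<in> lmeasurable" "ball (fst i) (snd i) \<in> lmeasurable"
      using C by (auto intro: fmeasurable_Int_fmeasurable)
    ultimately show "emeasure lebesgue (C \<inter> ball (fst i) (snd i)) \<le> ennreal p * emeasure lebesgue (ball (fst i) (snd i))"
      using p by (simp add: emeasure_eq_measure2 ennreal_mult)
  qed
  also have "\<dots> = ennreal p * emeasure lebesgue (\<Union>i\<in>D. ball (fst i) (snd i))"
    using D(1) dj by (subst emeasure_UN_countable) (auto simp: nn_integral_cmult)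
  also have "\<dots> \<le> ennreal p * emeasure lebesgue U"
  proof (intro mult_left_mono emeasure_mono UN_least)
    fix i assume "i \<in> D"
    then have "(fst i, snd i) \<in> K" using D(2) by auto
    then show "ball (fst i) (snd i) \<subseteq> U" unfolding K_def by blast
  qed (use U(1) in auto)
  finally have "measure lebesgue C \<le> p * measure lebesgue U"
    using C Um p by (simp add: emeasure_eq_measure2 flip: ennreal_mult)
  also have "\<dots> < p * (measure lebesgue C + e)" using Ue p by simp
  also have "\<dots> = measure lebesgue C" using p unfolding e_def by (simp add: field_simps)
  finally show False by simp
qed

text \<open>The proportion of \<open>A\<close> in a ball of radius \<open>d\<close> is independent of the centre. If \<open>A\<close> is not null, this proportion
  stays above some \<open>e > 0\<close> at one point as \<open>d\<close> shrinks, hence at all points, and then the complement of \<open>A\<close> has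
  density at most \<open>1 - e\<close> everywhere and is null.\<close>

lemma divergence_free_indicator_trivial_on_ball:
  fixes x0 :: "'a::euclidean_space"
  assumes A: "A \<in> sets lebesgue"
    and div0: "\<And>\<psi>. \<psi> \<in> C1c_fields (ball x0 R) \<Longrightarrow> (LINT x|lebesgue. indicator A x * divergence \<psi> x) = 0"
    and R: "R = 2 * \<rho>" "\<rho> > 0"
  shows "negligible (A \<inter> ball x0 \<rho>) \<or> negligible (ball x0 \<rho> - A)"
proof (rule disjCI)
  define B where "B = ball x0 \<rho>"
  assume "\<not> negligible (ball x0 \<rho> - A)"
  then have *: "\<not> negligible (B - A)" by (simp add: B_def)
  show "negligible (A \<inter> ball x0 \<rho>)"
  proof (rule ccontr)
    assume "\<not> ?thesis"
    then have "\<not> negligible (A \<inter> B)" by (simp add: B_def)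
    then obtain x r e where x: "x \<in> A \<inter> B" and re: "r > 0" "e > 0"
      and big: "\<And>d U. \<lbrakk>0 < d; d \<le> r; A \<inter> B \<inter> ball x d \<subseteq> U; U \<in> lmeasurable\<rbrakk>
        \<Longrightarrow> e * measure lebesgue (ball x d) \<le> measure lebesgue U"
      unfolding negligible_eq_zero_density by (metis not_le)
    have BA: "B - A \<in> lmeasurable"
      unfolding B_def by (rule fmeasurableI2[of "ball x0 \<rho>"]) (use A in auto)
    have "negligible (B - A)"
    proof (rule negligible_if_density_less_1[OF BA, of "1 - e"])
      fix y assume y: "y \<in> B - A"
      show "\<exists>r>0. \<forall>d. 0 < d \<and> d \<le> r \<longrightarrow>
        measure lebesgue ((B - A) \<inter> ball y d) \<le> (1 - e) * measure lebesgue (ball y d)"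
      proof (intro exI[of _ "min r (\<rho>/2)"] conjI allI impI)
        show "min r (\<rho>/2) > 0" using re R by simp
        fix d assume d: "0 < d \<and> d \<le> min r (\<rho>/2)"
        have sub: "cball z d \<subseteq> ball x0 R" if "z \<in> B" for z
        proof
          fix w assume "w \<in> cball z d"
          then have "dist x0 w \<le> dist x0 z + d" using dist_triangle[of x0 w z] by simp
          then show "w \<in> ball x0 R" using that d R unfolding B_def by simp
        qed
        have Am: "A \<inter> ball z d \<in> lmeasurable" for z
          using A by (subst Int_commute) (rule fmeasurable_Int_fmeasurable, auto)
        have "e * measure lebesgue (ball x d) \<le> measure lebesgue (A \<inter> ball x d)"
          using d by (intro big Am) auto
        also have "\<dots> = measure lebesgue (A \<inter> ball y d)"
          by (rule ball_measure_translate[OF A convex_ball div0 sub sub]) (use x y in auto)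
        finally have 1: "e * measure lebesgue (ball y d) \<le> measure lebesgue (A \<inter> ball y d)"
          using d by (simp add: content_ball_conv_unit_ball[of d x] content_ball_conv_unit_ball[of d y])
        have "measure lebesgue ((B - A) \<inter> ball y d) \<le> measure lebesgue (ball y d - A \<inter> ball y d)"
          using A BA Am by (intro measure_mono_fmeasurable fmeasurable.Diff) auto
        also have "\<dots> = measure lebesgue (ball y d) - measure lebesgue (A \<inter> ball y d)"
          using Am by (intro measurable_measure_Diff) (auto simp: fmeasurableD)
        finally show "measure lebesgue ((B - A) \<inter> ball y d) \<le> (1 - e) * measure lebesgue (ball y d)"
          using 1 by (simp add: algebra_simps)
      qed
    qed (use re in auto)
    with * show False by simp
  qed
qed

text \<open>The constancy theorem for sets: zero perimeter in a connected open set means null or of null complement.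
  The points near which \<open>A\<close> is null and those near which its complement is null form a partition of \<open>S\<close> into
  open sets.\<close>

lemma divergence_free_indicator_trivial:
  fixes S :: "'a::euclidean_space set"
  assumes A: "A \<in> sets lebesgue" and S: "open S" "connected S"
    and div0: "\<And>\<psi>. \<psi> \<in> C1c_fields S \<Longrightarrow> (LINT x|lebesgue. indicator A x * divergence \<psi> x) = 0"
  shows "negligible (A \<inter> S) \<or> negligible (S - A)"
proof -
  have glob: "negligible Z" if loc: "\<And>x. x \<in> Z \<Longrightarrow> \<exists>r>0. negligible (Z \<inter> ball x r)" for Z :: "'a set"
    unfolding locally_negligible_alt[of Z]
  proof
    fix x assume x: "x \<in> Z"
    then obtain r where "r > 0" "negligible (Z \<inter> ball x r)" using loc[OF x] by blast
    with x show "\<exists>U. openin (top_of_set Z) U \<and> x \<in> U \<and> negligible U"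
      by (intro exI[of _ "Z \<inter> ball x r"]) (auto simp: openin_open_Int)
  qed
  define P where "P Z = {x \<in> S. \<exists>r>0. negligible (Z \<inter> ball x r)}" for Z
  have oP: "open (P Z)" for Z unfolding open_contains_ball
  proof
    fix x assume "x \<in> P Z"
    then obtain r where r: "x \<in> S" "r > 0" "negligible (Z \<inter> ball x r)" unfolding P_def by blast
    obtain t where t: "t > 0" "ball x t \<subseteq> S" using S(1) r(1) open_contains_ball by metis
    have "ball x (min r t) \<subseteq> P Z"
    proof
      fix y assume y: "y \<in> ball x (min r t)"
      then have "y \<in> ball x r" by simp
      then obtain s where s: "s > 0" "ball y s \<subseteq> ball x r" by (meson open_ball open_contains_ball)
      have "negligible (Z \<inter> ball y s)" by (rule negligible_subset[OF r(3)]) (use s in auto)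
      then show "y \<in> P Z" using s y t unfolding P_def by auto
    qed
    then show "\<exists>e>0. ball x e \<subseteq> P Z" using r t by (metis min_less_iff_conj)
  qed
  have un: "S \<subseteq> P A \<union> P (- A)"
  proof
    fix x assume x: "x \<in> S"
    obtain t where t: "t > 0" "ball x t \<subseteq> S" using S(1) x open_contains_ball by metis
    have "negligible (A \<inter> ball x (t/2)) \<or> negligible (ball x (t/2) - A)"
    proof (rule divergence_free_indicator_trivial_on_ball[OF A])
      fix \<psi> assume "\<psi> \<in> C1c_fields (ball x t)"
      then show "(LINT x|lebesgue. indicator A x * divergence \<psi> x) = 0"
        by (intro div0 C1c_fields_mono[OF _ t(2)])
    qed (use t in auto)
    moreover have "ball x (t/2) - A = - A \<inter> ball x (t/2)" by blast
    moreover have "t/2 > 0" using t(1) by simp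
    ultimately have "x \<in> P A \<or> x \<in> P (- A)" using x unfolding P_def by auto
    then show "x \<in> P A \<union> P (- A)" by simp
  qed
  have dj: "P A \<inter> P (- A) = {}"
  proof (rule ccontr)
    assume "P A \<inter> P (- A) \<noteq> {}"
    then obtain x r s where x: "r > 0" "s > 0" "negligible (A \<inter> ball x r)" "negligible (- A \<inter> ball x s)"
      unfolding P_def by blast
    have "negligible (ball x (min r s))"
      by (rule negligible_subset[OF negligible_Un[OF x(3,4)]]) auto
    then show False using x open_not_negligible[of "ball x (min r s)"] by simp
  qed
  have "P A \<inter> S = {} \<or> P (- A) \<inter> S = {}"
    using connectedD[OF S(2) oP oP] dj un by blast
  then have SP: "S = P A \<or> S = P (- A)" using un unfolding P_def by blast
  have "negligible (Z \<inter> S)" if Z: "S = P Z" for Z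
  proof (rule glob)
    fix x assume "x \<in> Z \<inter> S"
    then obtain r where r: "r > 0" "negligible (Z \<inter> ball x r)" using Z unfolding P_def by blast
    have "negligible (Z \<inter> S \<inter> ball x r)" by (rule negligible_subset[OF r(2)]) auto
    then show "\<exists>r>0. negligible (Z \<inter> S \<inter> ball x r)" using r(1) by blast
  qed
  from this[of A] this[of "- A"] SP show ?thesis by (auto simp: Diff_eq Int_commute)
qed

section \<open>Total variation and additivity of the perimeter\<close>

definition pairing :: "('a::euclidean_space \<Rightarrow> real) \<Rightarrow> ('a \<Rightarrow> 'a) \<Rightarrow> real" where
  "pairing u \<psi> = (LINT x|lebesgue. u x * divergence \<psi> x)"

definition unit_fields :: "'a::euclidean_space set \<Rightarrow> ('a \<Rightarrow> 'a) set" where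
  "unit_fields S = {\<psi> \<in> C1c_fields S. \<forall>x. norm (\<psi> x) \<le> 1}"

lemma C1c_fields_divergence_outside:
  assumes "\<psi> \<in> C1c_fields S" "x \<notin> S" shows "divergence \<psi> x = 0"
proof -
  obtain K where "compact K" "K \<subseteq> S" "\<And>x. x \<notin> K \<Longrightarrow> \<psi> x = 0"
    using assms(1) unfolding C1c_fields_iff by auto
  then show ?thesis using assms(2) by (intro divergence_zero_outside[of K]) (auto intro: compact_imp_closed)
qed

lemma TV_altdef: "TV u S = (SUP \<psi>\<in>unit_fields S. ereal (pairing u \<psi>))"
proof -
  have "(LINT x:S|lebesgue. u x * divergence \<psi> x) = pairing u \<psi>" if "\<psi> \<in> unit_fields S" for \<psi>
  proof -
    have "(\<lambda>x. indicat_real S x *\<^sub>R (u x * divergence \<psi> x)) = (\<lambda>x. u x * divergence \<psi> x)"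
      using that C1c_fields_divergence_outside[of \<psi> S] unfolding unit_fields_def
      by (auto simp: fun_eq_iff indicator_def)
    then show ?thesis unfolding pairing_def set_lebesgue_integral_def by simp
  qed
  then show ?thesis unfolding TV_def unit_fields_def by (intro SUP_cong) auto
qed

lemma pairing_le_TV: "\<psi> \<in> unit_fields S \<Longrightarrow> ereal (pairing u \<psi>) \<le> TV u S"
  unfolding TV_altdef by (rule SUP_upper)

lemma TV_leI: "(\<And>\<psi>. \<psi> \<in> unit_fields S \<Longrightarrow> ereal (pairing u \<psi>) \<le> c) \<Longrightarrow> TV u S \<le> c"
  unfolding TV_altdef by (rule SUP_least)

lemma zero_unit_field: "(\<lambda>_. 0) \<in> unit_fields S"
  unfolding unit_fields_def by (simp add: C1c_fields_zero)

lemma pairing_zero_field [simp]: "pairing u (\<lambda>_. 0) = 0"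
  unfolding pairing_def by (simp add: divergence_scaleR[of "\<lambda>_. 0" 0, simplified])

lemma TV_nonneg: "0 \<le> TV u S"
  using pairing_le_TV[OF zero_unit_field, of u S] by (simp add: zero_ereal_def)

lemma unit_field_near_TV:
  assumes "TV u S < \<infinity>" "e > 0"
  obtains \<psi> where "\<psi> \<in> unit_fields S" "real_of_ereal (TV u S) - e < pairing u \<psi>"
proof -
  have fin: "\<bar>TV u S\<bar> \<noteq> \<infinity>" using assms(1) TV_nonneg[of u S] by auto
  have "TV u S - ereal e < TV u S" using fin assms(2) by (cases "TV u S") auto
  then obtain \<psi> where \<psi>: "\<psi> \<in> unit_fields S" "TV u S - ereal e < ereal (pairing u \<psi>)"
    unfolding TV_altdef less_SUP_iff by auto
  then show thesis using fin by (intro that[of \<psi>]) (cases "TV u S"; simp)+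
qed

text \<open>Lebesgue measure is complete, so measurability is a property of the class modulo null sets.\<close>

lemma borel_measurable_lebesgue_AE:
  fixes f g :: "'a::euclidean_space \<Rightarrow> real"
  assumes "f \<in> borel_measurable lebesgue" "AE x in lebesgue. f x = g x"
  shows "g \<in> borel_measurable lebesgue"
proof (rule measurableI)
  fix B :: "real set" assume "B \<in> sets borel"
  with assms(1) have "f -` B \<inter> space lebesgue \<in> sets lebesgue" by (rule measurable_sets)
  then show "g -` B \<inter> space lebesgue \<in> sets lebesgue"
    by (rule completion.in_sets_AE[rotated]) (use assms(2) in \<open>auto elim!: AE_mp\<close>)
qed simp

lemma integral_lebesgue_cong_AE:
  fixes f g :: "'a::euclidean_space \<Rightarrow> real"
  assumes "AE x in lebesgue. f x = g x"
  shows "(LINT x|lebesgue. f x) = (LINT x|lebesgue. g x)"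
proof (cases "f \<in> borel_measurable lebesgue")
  case True
  then show ?thesis using assms borel_measurable_lebesgue_AE by (intro integral_cong_AE) auto
next
  case False
  have "AE x in lebesgue. g x = f x" using assms by eventually_elim auto
  then have "g \<notin> borel_measurable lebesgue" using False borel_measurable_lebesgue_AE by blast
  with False have "\<not> integrable lebesgue f" "\<not> integrable lebesgue g"
    using borel_measurable_integrable by metis+
  then show ?thesis by (simp add: not_integrable_integral_eq)
qed

lemma pairing_cong_AE:
  assumes "ae_eq S u v" "\<psi> \<in> C1c_fields S"
  shows "pairing u \<psi> = pairing v \<psi>"
  unfolding pairing_def
proof (rule integral_lebesgue_cong_AE)
  have "AE x in lebesgue. x \<in> S \<longrightarrow> u x = v x" using assms(1) unfolding ae_eq_def .
  then show "AE x in lebesgue. u x * divergence \<psi> x = v x * divergence \<psi> x"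
    by eventually_elim (use C1c_fields_divergence_outside[OF assms(2)] in auto)
qed

lemma TV_cong_AE: "ae_eq S u v \<Longrightarrow> TV u S = TV v S"
  unfolding TV_altdef by (intro SUP_cong) (auto simp: unit_fields_def pairing_cong_AE)

lemma pairing_ae_const:
  assumes "ae_eq S u (\<lambda>_. c)" "\<psi> \<in> C1c_fields S"
  shows "pairing u \<psi> = 0"
  using pairing_cong_AE[OF assms] integral_divergence_zero[OF assms(2)] unfolding pairing_def by simp

definition bounded_measurable :: "('a::euclidean_space \<Rightarrow> real) \<Rightarrow> bool" where
  "bounded_measurable u \<longleftrightarrow> u \<in> borel_measurable lebesgue \<and> (\<exists>M. \<forall>x. \<bar>u x\<bar> \<le> M)"

lemma bounded_measurable_indicator: "A \<in> sets lebesgue \<Longrightarrow> bounded_measurable (indicat_real A)"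
  unfolding bounded_measurable_def by (auto intro!: exI[of _ 1] simp: indicator_def)

lemma bounded_measurable_integrable: "bounded_measurable u \<Longrightarrow> \<psi> \<in> C1c_fields S \<Longrightarrow> integrable lebesgue (\<lambda>x. u x * divergence \<psi> x)"
  unfolding bounded_measurable_def by (auto intro!: integrable_bounded_mult C1c_fields_integrable_divergence)

lemma C1c_fields_C1: "\<psi> \<in> C1c_fields S \<Longrightarrow> C1 \<psi>"
  unfolding C1c_fields_iff by simp

lemma pairing_add_field:
  assumes "bounded_measurable u" "\<psi> \<in> C1c_fields S" "\<phi> \<in> C1c_fields S"
  shows "pairing u (\<lambda>x. \<psi> x + \<phi> x) = pairing u \<psi> + pairing u \<phi>"
  unfolding pairing_def divergence_add[OF C1c_fields_C1[OF assms(2)] C1c_fields_C1[OF assms(3)]] distrib_left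
  by (rule Bochner_Integration.integral_add; rule bounded_measurable_integrable; fact assms)

lemma pairing_scaleR_field:
  assumes "\<psi> \<in> C1c_fields S"
  shows "pairing u (\<lambda>x. c *\<^sub>R \<psi> x) = c * pairing u \<psi>"
proof -
  have "(\<lambda>x. u x * divergence (\<lambda>x. c *\<^sub>R \<psi> x) x) = (\<lambda>x. c * (u x * divergence \<psi> x))"
    by (simp add: fun_eq_iff divergence_scaleR[OF C1c_fields_C1[OF assms]])
  then show ?thesis unfolding pairing_def by simp
qed

lemma pairing_sum_field:
  assumes "bounded_measurable u" "finite I" "\<And>i. i \<in> I \<Longrightarrow> \<psi> i \<in> C1c_fields S"
  shows "pairing u (\<lambda>x. \<Sum>i\<in>I. \<psi> i x) = (\<Sum>i\<in>I. pairing u (\<psi> i))"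
  using assms(2,3)
proof (induction I rule: finite_induct)
  case (insert i I)
  have "(\<lambda>x. \<Sum>i\<in>I. \<psi> i x) \<in> C1c_fields S" by (rule C1c_fields_sum) (use insert in auto)
  with insert show ?case by (simp add: pairing_add_field[OF assms(1), of _ S])
qed simp

lemma pairing_add_left:
  assumes "bounded_measurable u" "bounded_measurable v" "\<psi> \<in> C1c_fields S"
  shows "pairing (\<lambda>x. u x + v x) \<psi> = pairing u \<psi> + pairing v \<psi>"
  unfolding pairing_def distrib_right
  by (rule Bochner_Integration.integral_add; rule bounded_measurable_integrable; fact assms)

lemma pairing_scale_left: "pairing (\<lambda>x. c * u x) \<psi> = c * pairing u \<psi>"
  unfolding pairing_def by (simp add: mult.assoc)

text \<open>The test fields are closed under sign change and, up to a factor, contain all bounded fields.\<close>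

lemma pairing_eq_0_if_nonpos:
  assumes le: "\<And>\<psi>. \<psi> \<in> unit_fields S \<Longrightarrow> pairing u \<psi> \<le> 0" and \<phi>: "\<phi> \<in> C1c_fields S"
  shows "pairing u \<phi> = 0"
proof -
  obtain K where K: "compact K" "\<And>x. x \<notin> K \<Longrightarrow> \<phi> x = 0" "C1 \<phi>"
    using \<phi> unfolding C1c_fields_iff by auto
  obtain M where M: "M > 0" "\<And>x. norm (\<phi> x) \<le> M"
  proof (rule bounded_continuous_compact_support[of "\<lambda>x. norm (\<phi> x)" K])
    show "continuous_on UNIV (\<lambda>x. norm (\<phi> x))"
      by (rule continuous_on_norm[OF C1_continuous[OF K(3)]])
  qed (use K in auto)
  have f: "(\<lambda>x. c *\<^sub>R \<phi> x) \<in> unit_fields S" if "\<bar>c\<bar> = 1 / M" for c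
    unfolding unit_fields_def using \<phi> M that by (auto intro!: C1c_fields_scaleR simp: divide_le_eq)
  have "(1 / M) * pairing u \<phi> \<le> 0" "(- 1 / M) * pairing u \<phi> \<le> 0"
    using le[OF f[of "1 / M"]] le[OF f[of "- 1 / M"]] M(1)
    unfolding pairing_scaleR_field[OF \<phi>] by auto
  then show ?thesis using M(1) by (simp add: field_simps)
qed



text \<open>Perimeter that \<open>E1\<close> had inside \<open>T\<close>, where \<open>E\<close> has none, would be wasted. Take a near-optimal field \<open>\<psi>\<close> for
  \<open>E\<close> and a field \<open>\<phi>\<close> supported in \<open>T\<close> that detects \<open>E1\<close>. Switching \<open>\<psi>\<close> off on the support of \<open>\<phi>\<close> costs nothing,
  as \<open>E\<close> is constant on \<open>T\<close>; then \<open>\<phi>\<close> may be added when testing \<open>E1\<close>, and the perimeters of \<open>E1\<close> and \<open>E2\<close> add up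
  to more than that of \<open>E\<close>.\<close>

lemma additive_perimeter_trivial_inside:
  fixes \<Omega> :: "'a::euclidean_space set"
  assumes T: "open T" "connected T" "T \<subseteq> \<Omega>"
    and E: "E \<in> sets lebesgue" "E1 \<in> sets lebesgue" "E2 \<in> sets lebesgue" "E1 \<inter> E2 = {}"
      "sym_diff E (E1 \<union> E2) \<in> null_sets lebesgue"
    and const: "ae_eq T (indicat_real E) (\<lambda>_. c)"
    and per: "Per E \<Omega> = Per E1 \<Omega> + Per E2 \<Omega>" "Per E \<Omega> < \<infinity>"
  shows "negligible (E1 \<inter> T) \<or> negligible (T - E1)"
proof -
  have bm: "bounded_measurable (indicat_real E)" "bounded_measurable (indicat_real E1)" "bounded_measurable (indicat_real E2)"
    using E by (auto intro: bounded_measurable_indicator)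
  have "AE x in lebesgue. x \<notin> sym_diff E (E1 \<union> E2)" using E(5) by (rule AE_not_in)
  then have "AE x in lebesgue. indicat_real E x = indicat_real E1 x + indicat_real E2 x"
    by eventually_elim (use E(4) in \<open>auto simp: indicator_def\<close>)
  then have ae: "ae_eq S (indicat_real E) (\<lambda>x. indicat_real E1 x + indicat_real E2 x)" for S
    unfolding ae_eq_def by eventually_elim auto
  have split: "pairing (indicat_real E) \<psi> = pairing (indicat_real E1) \<psi> + pairing (indicat_real E2) \<psi>"
    if "\<psi> \<in> C1c_fields S" for \<psi> S
    using pairing_cong_AE[OF ae that] pairing_add_left[OF bm(2,3) that] by simp
  have fin: "\<bar>Per E1 \<Omega>\<bar> \<noteq> \<infinity>" "\<bar>Per E2 \<Omega>\<bar> \<noteq> \<infinity>"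
    using per TV_nonneg[of "indicat_real E1" \<Omega>] TV_nonneg[of "indicat_real E2" \<Omega>]
    by (cases "Per E1 \<Omega>"; cases "Per E2 \<Omega>"; simp add: Per_def)+
  have key: "pairing (indicat_real E1) \<phi> \<le> 0" if \<phi>: "\<phi> \<in> unit_fields T" for \<phi>
  proof (rule ccontr)
    define p where "p = pairing (indicat_real E1) \<phi>"
    assume "\<not> ?thesis"
    then have p: "p > 0" unfolding p_def by simp
    obtain \<psi> where \<psi>: "\<psi> \<in> unit_fields \<Omega>" "real_of_ereal (Per E \<Omega>) - p < pairing (indicat_real E) \<psi>"
      using unit_field_near_TV[of "indicat_real E" \<Omega> p] per(2) p unfolding Per_def by blast
    have \<phi>T: "\<phi> \<in> C1c_fields T" and \<phi>1: "\<And>x. norm (\<phi> x) \<le> 1" using \<phi> unfolding unit_fields_def by auto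
    have \<psi>O: "\<psi> \<in> C1c_fields \<Omega>" and \<psi>1: "\<And>x. norm (\<psi> x) \<le> 1" using \<psi> unfolding unit_fields_def by auto
    obtain K where K: "compact K" "K \<subseteq> T" "\<And>x. x \<notin> K \<Longrightarrow> \<phi> x = 0"
      using \<phi>T unfolding C1c_fields_iff by auto
    obtain \<kappa> K' where \<kappa>: "C1 \<kappa>" "\<And>x. 0 \<le> \<kappa> x" "\<And>x. \<kappa> x \<le> (1::real)" "\<And>x. x \<in> K \<Longrightarrow> \<kappa> x = 1"
      and K': "compact K'" "K' \<subseteq> T" "\<And>x. x \<notin> K' \<Longrightarrow> \<kappa> x = 0"
      using C1_cutoff[OF T(1) K(1,2)] by metis
    define \<psi>' where "\<psi>' x = (1 - \<kappa> x) *\<^sub>R \<psi> x" for x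
    define \<psi>'' where "\<psi>'' x = \<kappa> x *\<^sub>R \<psi> x" for x
    have "C1 (\<lambda>x. 1 - \<kappa> x)" by (intro C1_diff C1_const \<kappa>(1))
    then have \<psi>'O: "\<psi>' \<in> C1c_fields \<Omega>" unfolding \<psi>'_def using \<psi>O by (rule C1c_fields_mult)
    have \<psi>''T: "\<psi>'' \<in> C1c_fields T"
      unfolding \<psi>''_def C1c_fields_iff using K' \<kappa>(1) C1c_fields_C1[OF \<psi>O]
      by (auto intro!: C1_scaleR exI[of _ K'])
    have \<psi>''O: "\<psi>'' \<in> C1c_fields \<Omega>" using \<psi>''T T(3) by (rule C1c_fields_mono)
    have \<phi>O: "\<phi> \<in> C1c_fields \<Omega>" using \<phi>T T(3) by (rule C1c_fields_mono)
    have "\<psi> = (\<lambda>x. \<psi>' x + \<psi>'' x)" unfolding \<psi>'_def \<psi>''_def by (simp add: algebra_simps)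
    then have e1: "pairing (indicat_real E) \<psi> = pairing (indicat_real E) \<psi>' + pairing (indicat_real E) \<psi>''"
      using pairing_add_field[OF bm(1) \<psi>'O \<psi>''O] by simp
    have e2: "pairing (indicat_real E) \<psi>'' = 0" by (rule pairing_ae_const[OF const \<psi>''T])
    have n': "norm (\<psi>' x) \<le> 1" for x
      unfolding \<psi>'_def using \<kappa>(2,3)[of x] \<psi>1[of x] by (auto intro!: mult_le_one)
    have u': "\<psi>' \<in> unit_fields \<Omega>" unfolding unit_fields_def using \<psi>'O n' by simp
    have "norm (\<psi>' x + \<phi> x) \<le> 1" for x
    proof (cases "x \<in> K")
      case True
      then have "\<psi>' x = 0" unfolding \<psi>'_def using \<kappa>(4) by simp
      then show ?thesis using \<phi>1 by simp
    next
      case False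
      then show ?thesis using K(3) n' by simp
    qed
    then have "(\<lambda>x. \<psi>' x + \<phi> x) \<in> unit_fields \<Omega>"
      unfolding unit_fields_def using C1c_fields_add[OF \<psi>'O \<phi>O] by simp
    then have "ereal (pairing (indicat_real E1) (\<lambda>x. \<psi>' x + \<phi> x)) \<le> Per E1 \<Omega>"
      unfolding Per_def by (rule pairing_le_TV)
    moreover have "pairing (indicat_real E1) (\<lambda>x. \<psi>' x + \<phi> x) = pairing (indicat_real E1) \<psi>' + p"
      unfolding p_def by (rule pairing_add_field[OF bm(2) \<psi>'O \<phi>O])
    moreover have "ereal (pairing (indicat_real E2) \<psi>') \<le> Per E2 \<Omega>"
      unfolding Per_def using u' by (rule pairing_le_TV)
    ultimately have "pairing (indicat_real E1) \<psi>' + p + pairing (indicat_real E2) \<psi>' \<le> real_of_ereal (Per E \<Omega>)"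
      using fin per(1) by (cases "Per E1 \<Omega>"; cases "Per E2 \<Omega>"; simp)
    with \<psi>(2) e1 e2 split[OF \<psi>'O] show False by simp
  qed
  show ?thesis
  proof (rule divergence_free_indicator_trivial[OF E(2) T(1,2)])
    fix \<phi> assume "\<phi> \<in> C1c_fields T"
    then show "(LINT x|lebesgue. indicator E1 x * divergence \<phi> x) = 0"
      using pairing_eq_0_if_nonpos[OF key] unfolding pairing_def by blast
  qed
qed

section \<open>Thin slabs and tubes, and the perimeter of half-spaces\<close>

text \<open>The volume of a thin set is bounded by packing: many disjoint translates of it fit into a slightly larger
  ball. This replaces Fubini arguments in rotated coordinates.\<close>

lemma measure_disjoint_translates:
  fixes v :: "'i \<Rightarrow> 'a::euclidean_space"
  assumes S: "S \<in> lmeasurable" "S \<subseteq> cball 0 R" and I: "finite I"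
    and v: "\<And>i. i \<in> I \<Longrightarrow> norm (v i) \<le> 1" "disjoint_family_on (\<lambda>i. (+) (v i) ` S) I"
  shows "real (card I) * measure lebesgue S \<le> measure lebesgue (cball (0::'a) (R + 1))"
proof -
  have m: "(+) (v i) ` S \<in> lmeasurable" for i using S(1) by (rule measurable_translation)
  have "real (card I) * measure lebesgue S = (\<Sum>i\<in>I. measure lebesgue ((+) (v i) ` S))"
    by (simp add: measure_translation)
  also have "\<dots> = measure lebesgue (\<Union>i\<in>I. (+) (v i) ` S)"
    using m I v(2) by (intro measure_UNION'[symmetric])
      (auto simp: pairwise_def disjnt_def disjoint_family_on_def)
  also have "\<dots> \<le> measure lebesgue (cball (0::'a) (R + 1))"
  proof (rule measure_mono_fmeasurable)
    show "(\<Union>i\<in>I. (+) (v i) ` S) \<subseteq> cball 0 (R + 1)"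
    proof clarify
      fix i x assume "i \<in> I" "x \<in> S"
      then have "norm (v i) \<le> 1" "norm x \<le> R" using v(1) S(2) by auto
      then show "v i + x \<in> cball 0 (R + 1)" using norm_triangle_ineq[of "v i" x] by simp
    qed
    show "(\<Union>i\<in>I. (+) (v i) ` S) \<in> sets lebesgue"
      using m I by (intro sets.finite_UN) (auto simp: fmeasurableD)
  qed simp
  finally show ?thesis .
qed

lemma lmeasurable_slab:
  "{x \<in> cball 0 R. 0 < n \<bullet> x - c \<and> n \<bullet> x - c < b} \<in> lmeasurable" for n :: "'a::euclidean_space"
proof -
  have "{x \<in> cball 0 R. 0 < n \<bullet> x - c \<and> n \<bullet> x - c < b}
      = cball 0 R \<inter> ({x. n \<bullet> x > c} \<inter> {x. n \<bullet> x < c + b})" by (auto simp: algebra_simps)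
  moreover have "open ({x. n \<bullet> x > c} \<inter> {x. n \<bullet> x < c + b})"
    by (intro open_Int open_halfspace_gt open_halfspace_lt)
  ultimately show ?thesis by (auto intro!: fmeasurable_Int_fmeasurable)
qed

lemma lmeasurable_tube:
  "{x \<in> cball 0 R. \<bar>n \<bullet> x - c\<bar> < a \<and> \<bar>m \<bullet> x - d\<bar> < a} \<in> lmeasurable" for n m :: "'a::euclidean_space"
proof -
  have "{x \<in> cball 0 R. \<bar>n \<bullet> x - c\<bar> < a \<and> \<bar>m \<bullet> x - d\<bar> < a} = cball 0 R \<inter>
      ({x. n \<bullet> x > c - a} \<inter> {x. n \<bullet> x < c + a} \<inter> {x. m \<bullet> x > d - a} \<inter> {x. m \<bullet> x < d + a})"
    by (auto simp: abs_less_iff)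
  moreover have "open ({x. n \<bullet> x > c - a} \<inter> {x. n \<bullet> x < c + a} \<inter> {x. m \<bullet> x > d - a} \<inter> {x. m \<bullet> x < d + a})"
    by (intro open_Int open_halfspace_gt open_halfspace_lt)
  ultimately show ?thesis by (auto intro!: fmeasurable_Int_fmeasurable)
qed

text \<open>The \<open>k\<close> translates by multiples of \<open>1 / k\<close> in the normal direction are disjoint.\<close>

lemma measure_slab:
  fixes n :: "'a::euclidean_space"
  assumes n: "norm n = 1"
  shows "real k * measure lebesgue {x \<in> cball 0 R. 0 < n \<bullet> x - c \<and> n \<bullet> x - c < 1 / real k}
    \<le> measure lebesgue (cball (0::'a) (R + 1))"
proof (cases "k = 0")
  case False
  define S where "S = {x \<in> cball 0 R. 0 < n \<bullet> x - c \<and> n \<bullet> x - c < 1 / real k}"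
  have nn: "n \<bullet> n = 1" using n by (simp add: norm_eq_1)
  have Sm: "S \<in> lmeasurable" unfolding S_def by (rule lmeasurable_slab)
  have "real (card {..<k}) * measure lebesgue S \<le> measure lebesgue (cball (0::'a) (R + 1))"
  proof (rule measure_disjoint_translates[where v="\<lambda>j. (real j / real k) *\<^sub>R n"])
    show "disjoint_family_on (\<lambda>j. (+) ((real j / real k) *\<^sub>R n) ` S) {..<k}"
      unfolding disjoint_family_on_def
    proof (intro ballI impI)
      fix i j :: nat assume "i \<noteq> j"
      have aux: False if "i < j" "x \<in> S" "y \<in> S" "(real i / real k) *\<^sub>R n + x = (real j / real k) *\<^sub>R n + y" for i j :: nat and x y
      proof -
        have "n \<bullet> ((real i / real k) *\<^sub>R n + x) = n \<bullet> ((real j / real k) *\<^sub>R n + y)" using that by simp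
        then have "real i / real k + n \<bullet> x = real j / real k + n \<bullet> y" by (simp add: inner_add_right nn)
        moreover have "n \<bullet> x - n \<bullet> y < 1 / real k" using that(2,3) unfolding S_def by simp
        ultimately have "(real j - real i) / real k < 1 / real k" by (simp add: diff_divide_distrib)
        then have "real j - real i < 1" using False by (simp add: divide_less_cancel)
        with that(1) show False by simp
      qed
      show "(+) ((real i / real k) *\<^sub>R n) ` S \<inter> (+) ((real j / real k) *\<^sub>R n) ` S = {}"
        using \<open>i \<noteq> j\<close> aux[of i j] aux[of j i] by (auto simp: nat_neq_iff) metis+
    qed
    show "norm ((real j / real k) *\<^sub>R n) \<le> 1" if "j \<in> {..<k}" for j
      using that n by (simp add: divide_le_eq)
  qed (use Sm S_def in auto)
  then show ?thesis unfolding S_def by simp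
qed simp

lemma dual_pair:
  fixes n m :: "'a::euclidean_space"
  assumes "norm n = 1" "norm m = 1" "n \<noteq> m" "n \<noteq> - m"
  obtains p q where "n \<bullet> p = 1" "m \<bullet> p = 0" "n \<bullet> q = 0" "m \<bullet> q = 1"
proof -
  define c where "c = n \<bullet> m"
  have nn: "n \<bullet> n = 1" "m \<bullet> m = 1" using assms by (simp_all add: norm_eq_1)
  have "\<bar>c\<bar> \<noteq> 1"
    using norm_cauchy_schwarz_abs_eq[of n m] assms unfolding c_def by auto
  then have c: "1 - c * c \<noteq> 0" by (metis abs_1 abs_minus_cancel abs_mult_self_eq eq_iff_diff_eq_0 mult_cancel_left1 square_eq_1_iff)
  show thesis
  proof (rule that)
    show "n \<bullet> ((1 / (1 - c * c)) *\<^sub>R (n - c *\<^sub>R m)) = 1" "m \<bullet> ((1 / (1 - c * c)) *\<^sub>R (n - c *\<^sub>R m)) = 0"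
      "n \<bullet> ((1 / (1 - c * c)) *\<^sub>R (m - c *\<^sub>R n)) = 0" "m \<bullet> ((1 / (1 - c * c)) *\<^sub>R (m - c *\<^sub>R n)) = 1"
      using c nn by (simp_all add: inner_diff_right c_def[symmetric] inner_commute[of m n])
  qed
qed

text \<open>A neighbourhood of width \<open>1 / k\<close> of a set of codimension two has volume of order \<open>1 / k\<^sup>2\<close>: translates along the
  dual basis of the two normals form a \<open>k \<times> k\<close> grid.\<close>

lemma measure_tube:
  fixes n m :: "'a::euclidean_space"
  assumes "norm n = 1" "norm m = 1" "n \<noteq> m" "n \<noteq> - m"
  shows "\<exists>P>0. \<forall>k::nat. k > 0 \<longrightarrow> (real k)\<^sup>2 * measure lebesgue
      {x \<in> cball 0 R. \<bar>n \<bullet> x - c\<bar> < 1 / (P * real k) \<and> \<bar>m \<bullet> x - d\<bar> < 1 / (P * real k)}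
    \<le> measure lebesgue (cball (0::'a) (R + 1))"
proof -
  obtain p q where pq: "n \<bullet> p = 1" "m \<bullet> p = 0" "n \<bullet> q = 0" "m \<bullet> q = 1"
    using dual_pair[OF assms] by metis
  \<comment> \<open>With this \<open>P\<close> the grid of spacing \<open>2 a = 2 / (P k)\<close> has diameter at most one.\<close>
  define P where "P = 2 * (norm p + norm q)"
  have "p \<noteq> 0" using pq(1) by auto
  then have P: "P > 0" unfolding P_def using norm_ge_zero[of q] by (simp add: add_pos_nonneg)
  have "(real k)\<^sup>2 * measure lebesgue
      {x \<in> cball 0 R. \<bar>n \<bullet> x - c\<bar> < 1 / (P * real k) \<and> \<bar>m \<bullet> x - d\<bar> < 1 / (P * real k)}
    \<le> measure lebesgue (cball (0::'a) (R + 1))" if k: "k > 0" for k :: nat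
  proof -
    define a where "a = 1 / (P * real k)"
    have a: "a > 0" unfolding a_def using P k by simp
    define S where "S = {x \<in> cball 0 R. \<bar>n \<bullet> x - c\<bar> < a \<and> \<bar>m \<bullet> x - d\<bar> < a}"
    have Sm: "S \<in> lmeasurable" unfolding S_def by (rule lmeasurable_tube)
    define v where "v = (\<lambda>(i, j). (2 * a) *\<^sub>R (real i *\<^sub>R p + real j *\<^sub>R q))"
    have "real (card ({..<k} \<times> {..<k})) * measure lebesgue S \<le> measure lebesgue (cball (0::'a) (R + 1))"
    proof (rule measure_disjoint_translates[where v=v])
      show "norm (v ij) \<le> 1" if ij: "ij \<in> {..<k} \<times> {..<k}" for ij
      proof -
        obtain i j where [simp]: "ij = (i, j)" "i < k" "j < k" using ij by auto
        have "norm (real i *\<^sub>R p + real j *\<^sub>R q) \<le> real i * norm p + real j * norm q"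
          using norm_triangle_ineq[of "real i *\<^sub>R p" "real j *\<^sub>R q"] by simp
        also have "\<dots> \<le> real k * norm p + real k * norm q"
          by (intro add_mono mult_right_mono) (auto simp: less_imp_le)
        also have "\<dots> = real k * P / 2" unfolding P_def by (simp add: algebra_simps)
        finally have "norm (v ij) \<le> 2 * a * (real k * P / 2)"
          unfolding v_def using a by (simp add: mult_left_mono)
        also have "\<dots> = 1" unfolding a_def using P k by simp
        finally show ?thesis .
      qed
      show "disjoint_family_on (\<lambda>ij. (+) (v ij) ` S) ({..<k} \<times> {..<k})"
        unfolding disjoint_family_on_def
      proof (intro ballI impI, rule ccontr)
        fix s t assume "s \<noteq> t" "(+) (v s) ` S \<inter> (+) (v t) ` S \<noteq> {}"
        then obtain x y where xy: "x \<in> S" "y \<in> S" "v s + x = v t + y" by auto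
        obtain i j where s: "s = (i, j)" by (cases s)
        obtain i' j' where t: "t = (i', j')" by (cases t)
        have small: "i = i'" if "\<bar>2 * a * real i - 2 * a * real i'\<bar> < 2 * a" for i i'
        proof -
          have "2 * a * \<bar>real i - real i'\<bar> < 2 * a * 1"
            using that a by (simp add: abs_mult flip: right_diff_distrib)
          then have "\<bar>real i - real i'\<bar> < 1" using a by (metis mult_less_cancel_left_pos mult_pos_pos zero_less_numeral)
          then show ?thesis by linarith
        qed
        have "n \<bullet> (v s + x) = n \<bullet> (v t + y)" "m \<bullet> (v s + x) = m \<bullet> (v t + y)" using xy(3) by simp_all
        then have "2 * a * real i + n \<bullet> x = 2 * a * real i' + n \<bullet> y" "2 * a * real j + m \<bullet> x = 2 * a * real j' + m \<bullet> y"
          by (simp_all add: s t v_def inner_add_right pq algebra_simps)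
        moreover have "\<bar>n \<bullet> x - c\<bar> < a" "\<bar>n \<bullet> y - c\<bar> < a" "\<bar>m \<bullet> x - d\<bar> < a" "\<bar>m \<bullet> y - d\<bar> < a"
          using xy(1,2) unfolding S_def by auto
        ultimately have "i = i'" "j = j'" by (intro small; linarith)+
        with \<open>s \<noteq> t\<close> s t show False by simp
      qed
    qed (use Sm S_def in auto)
    then show ?thesis unfolding S_def a_def by (simp add: power2_eq_square)
  qed
  with P show ?thesis by blast
qed

lemma integral_le_bound_on_set:
  fixes f :: "'a::euclidean_space \<Rightarrow> real"
  assumes "S \<in> lmeasurable" "0 \<le> M" "\<And>x. \<bar>f x\<bar> \<le> M * indicator S x"
  shows "\<bar>LINT x|lebesgue. f x\<bar> \<le> M * measure lebesgue S"
proof (cases "integrable lebesgue f")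
  case True
  have i: "integrable lebesgue (\<lambda>x. M * indicat_real S x)" 
    using assms(1) by (intro integrable_mult_right integrable_real_indicator) (auto simp: fmeasurable_def)
  have "\<bar>LINT x|lebesgue. f x\<bar> \<le> (LINT x|lebesgue. \<bar>f x\<bar>)" by (rule integral_abs_bound)
  also have "\<dots> \<le> (LINT x|lebesgue. M * indicat_real S x)"
    using True i assms(3) by (intro integral_mono) auto
  also have "\<dots> = M * measure lebesgue S" using assms(1) by simp
  finally show ?thesis .
qed (use assms in \<open>simp add: not_integrable_integral_eq\<close>)

lemma frechet_derivative_affine:
  "frechet_derivative (\<lambda>x. n \<bullet> x - c) (at x) h = n \<bullet> h" for n :: "'a::euclidean_space"
proof -
  have "((\<lambda>x. n \<bullet> x - c) has_derivative (\<lambda>h. n \<bullet> h)) (at x)"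
    by (auto intro!: derivative_eq_intros)
  then show ?thesis by (metis frechet_derivative_at)
qed

lemma C1_affine: "C1 (\<lambda>x. n \<bullet> x - c)"
  by (intro C1_diff C1_inner_left C1_const)

text \<open>Replace the indicator by the ramp of slope \<open>k\<close> and integrate by parts: the derivative of the ramp has size \<open>k\<close> on
  a slab of volume of order \<open>1 / k\<close>, which gives a bound that survives the limit.\<close>

lemma TV_halfspace_finite:
  fixes n :: "'a::euclidean_space"
  assumes n: "norm n = 1" and V: "bounded V"
  shows "TV (indicat_real {x. n \<bullet> x - c > 0}) V < \<infinity>"
proof -
  obtain R where R: "V \<subseteq> cball 0 R" using V unfolding bounded_iff by (auto simp: subset_iff)
  define B where "B = 2 * measure lebesgue (cball (0::'a) (R + 1))"
  have "TV (indicat_real {x. n \<bullet> x - c > 0}) V \<le> ereal B"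
  proof (rule TV_leI)
    fix \<psi> assume "\<psi> \<in> unit_fields V"
    then have \<psi>: "\<psi> \<in> C1c_fields V" "\<And>x. norm (\<psi> x) \<le> 1" unfolding unit_fields_def by auto
    note int = C1c_fields_integrable_divergence[OF \<psi>(1)]
    define r where "r k x = ramp (real k * (n \<bullet> x - c))" for k :: nat and x
    have C: "C1 (r k)" for k unfolding r_def by (intro C1_ramp C1_mult C1_affine C1_const)
    have r01: "0 \<le> r k x" "r k x \<le> 1" for k x unfolding r_def using ramp_range by auto
    have rm: "r k \<in> borel_measurable lebesgue" for k
      using borel_measurable_continuous_onI[OF C1_continuous[OF C]] by (intro measurable_completion) simp
    have Dr: "frechet_derivative (r k) (at x) h = ramp' (real k * (n \<bullet> x - c)) * (real k * (n \<bullet> h))" for k x h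
    proof -
      have "((\<lambda>x. real k * (n \<bullet> x - c)) has_derivative (\<lambda>h. real k * (n \<bullet> h))) (at x)"
        by (auto intro!: derivative_eq_intros)
      then have "frechet_derivative (\<lambda>x. real k * (n \<bullet> x - c)) (at x) h = real k * (n \<bullet> h)"
        by (metis frechet_derivative_at)
      moreover have "(r k has_derivative (\<lambda>h. ramp' (real k * (n \<bullet> x - c)) * frechet_derivative (\<lambda>x. real k * (n \<bullet> x - c)) (at x) h)) (at x)"
        unfolding r_def by (rule has_derivative_comp_real[OF ramp_deriv]) (intro C1_mult C1_affine C1_const)
      ultimately show ?thesis by (metis frechet_derivative_at)
    qed
    have le: "\<bar>pairing (r k) \<psi>\<bar> \<le> B" for k
    proof (cases "k = 0")
      case True
      then have "pairing (r k) \<psi> = 0" unfolding pairing_def r_def by (simp add: ramp_le0)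
      then show ?thesis unfolding B_def by simp
    next
      case False
      define S where "S = {x \<in> cball 0 R. 0 < n \<bullet> x - c \<and> n \<bullet> x - c < 1 / real k}"
      have Sm: "S \<in> lmeasurable" unfolding S_def by (rule lmeasurable_slab)
      have i1: "integrable lebesgue (\<lambda>x. r k x * divergence \<psi> x)"
        by (rule integrable_bounded_mult[OF int rm, of _ 1]) (use r01 in auto)
      have "(LINT x|lebesgue. divergence (\<lambda>x. r k x *\<^sub>R \<psi> x) x) = 0"
        by (rule integral_divergence_zero[OF C1c_fields_mult[OF C \<psi>(1)]])
      moreover have "integrable lebesgue (divergence (\<lambda>x. r k x *\<^sub>R \<psi> x))"
        by (rule C1c_fields_integrable_divergence[OF C1c_fields_mult[OF C \<psi>(1)]])
      moreover have d: "divergence (\<lambda>x. r k x *\<^sub>R \<psi> x) = (\<lambda>x. r k x * divergence \<psi> x + frechet_derivative (r k) (at x) (\<psi> x))"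
        by (rule ext) (rule divergence_mult[OF C C1c_fields_C1[OF \<psi>(1)]])
      ultimately have "0 = (LINT x|lebesgue. (r k x * divergence \<psi> x + frechet_derivative (r k) (at x) (\<psi> x)))"
        and i2: "integrable lebesgue (\<lambda>x. (r k x * divergence \<psi> x + frechet_derivative (r k) (at x) (\<psi> x)) - r k x * divergence \<psi> x)"
        using i1 by (auto simp only: intro: Bochner_Integration.integrable_diff)
      then have "pairing (r k) \<psi> = - (LINT x|lebesgue. frechet_derivative (r k) (at x) (\<psi> x))"
        using i1 i2 unfolding pairing_def by simp
      moreover have "\<bar>LINT x|lebesgue. frechet_derivative (r k) (at x) (\<psi> x)\<bar> \<le> (2 * real k) * measure lebesgue S"
      proof (rule integral_le_bound_on_set[OF Sm])
        fix x
        show "\<bar>frechet_derivative (r k) (at x) (\<psi> x)\<bar> \<le> 2 * real k * indicator S x"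
        proof (cases "x \<in> S")
          case True
          have "\<bar>n \<bullet> \<psi> x\<bar> \<le> 1" using Cauchy_Schwarz_ineq2[of n "\<psi> x"] n \<psi>(2)[of x] by simp
          then have "\<bar>ramp' (real k * (n \<bullet> x - c))\<bar> * (real k * \<bar>n \<bullet> \<psi> x\<bar>) \<le> 2 * (real k * 1)"
            using ramp'_nonneg ramp'_le2 by (intro mult_mono) auto
          then show ?thesis using True by (simp add: Dr abs_mult)
        next
          case False
          then consider "x \<notin> cball 0 R" | "n \<bullet> x - c \<le> 0" | "n \<bullet> x - c \<ge> 1 / real k" unfolding S_def by force
          then have "frechet_derivative (r k) (at x) (\<psi> x) = 0"
          proof cases
            case 1
            then have "\<psi> x = 0" using R \<psi>(1) unfolding C1c_fields_iff by blast
            then show ?thesis by (simp add: Dr)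
          next
            case 2
            then have "real k * (n \<bullet> x - c) \<le> 0" by (simp add: mult_nonneg_nonpos)
            then show ?thesis by (simp add: Dr ramp'_zero)
          next
            case 3
            then have "real k * (n \<bullet> x - c) \<ge> 1" using \<open>k \<noteq> 0\<close> by (simp add: field_simps)
            then show ?thesis by (simp add: Dr ramp'_zero)
          qed
          then show ?thesis by simp
        qed
      qed simp
      moreover have "(2 * real k) * measure lebesgue S \<le> B"
        using measure_slab[OF n, of k R c] unfolding S_def B_def by simp
      ultimately show ?thesis by simp
    qed
    have "(\<lambda>k. pairing (r k) \<psi>) \<longlonglongrightarrow> pairing (indicat_real {x. n \<bullet> x - c > 0}) \<psi>"
      unfolding pairing_def
    proof (rule integral_dominated_convergence[where w="\<lambda>x. \<bar>divergence \<psi> x\<bar>"])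
      have "open {x. n \<bullet> x - c > 0}" using open_halfspace_gt[where a=n and b=c] by (simp add: algebra_simps)
      then have "indicat_real {x. n \<bullet> x - c > 0} \<in> borel_measurable lebesgue"
        by (intro borel_measurable_indicator sets_completionI_sets) simp
      then show "(\<lambda>x. indicat_real {x. n \<bullet> x - c > 0} x * divergence \<psi> x) \<in> borel_measurable lebesgue"
        using int by (intro borel_measurable_times) auto
      show "(\<lambda>x. r k x * divergence \<psi> x) \<in> borel_measurable lebesgue" for k
        using int rm by (intro borel_measurable_times) auto
      show "integrable lebesgue (\<lambda>x. \<bar>divergence \<psi> x\<bar>)" using int by simp
      show "AE x in lebesgue. norm (r k x * divergence \<psi> x) \<le> \<bar>divergence \<psi> x\<bar>" for k
        using r01 by (intro AE_I2) (auto simp: abs_mult intro!: mult_left_le_one_le)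
      show "AE x in lebesgue. (\<lambda>k. r k x * divergence \<psi> x) \<longlonglongrightarrow> indicat_real {x. n \<bullet> x - c > 0} x * divergence \<psi> x"
      proof (intro AE_I2 tendsto_mult tendsto_const)
        fix x
        show "(\<lambda>k. r k x) \<longlonglongrightarrow> indicat_real {x. n \<bullet> x - c > 0} x"
          using ramp_tendsto_indicator[of "n \<bullet> x - c"] unfolding r_def by (simp add: indicator_def)
      qed
    qed
    then have "pairing (indicat_real {x. n \<bullet> x - c > 0}) \<psi> \<le> B"
      by (rule LIMSEQ_le_const2) (use le abs_le_D1 in blast)
    then show "ereal (pairing (indicat_real {x. n \<bullet> x - c > 0}) \<psi>) \<le> ereal B" by simp
  qed
  then show ?thesis by auto
qed

section \<open>Cutting off near intersections of hyperplanes\<close>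

text \<open>A cut-off of width \<open>a\<close> in one variable: \<open>1\<close> for \<open>\<bar>t\<bar> \<le> a / 2\<close> and \<open>0\<close> for \<open>\<bar>t\<bar> \<ge> a\<close>. Squaring \<open>t\<close> avoids the corner
  of the absolute value.\<close>

definition bump :: "real \<Rightarrow> real \<Rightarrow> real" where
  "bump a t = 1 - ramp (4 / a\<^sup>2 * t\<^sup>2 - 1)"

lemma bump_range: "0 \<le> bump a t" "bump a t \<le> 1"
  unfolding bump_def using ramp_range by auto

lemma bump_eq_1:
  assumes "a > 0" "\<bar>t\<bar> \<le> a / 2" shows "bump a t = 1"
proof -
  have "t\<^sup>2 \<le> (a / 2)\<^sup>2" using assms by (intro abs_le_square_iff[THEN iffD1]) auto
  then have "4 / a\<^sup>2 * t\<^sup>2 \<le> 1" using assms by (simp add: field_simps power2_eq_square)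
  then show ?thesis unfolding bump_def by (simp add: ramp_le0)
qed

lemma bump_eq_0:
  assumes "a > 0" "\<bar>t\<bar> \<ge> a" shows "bump a t = 0"
proof -
  have "a\<^sup>2 \<le> t\<^sup>2" using assms by (intro abs_le_square_iff[THEN iffD1]) auto
  then have "4 / a\<^sup>2 * t\<^sup>2 \<ge> 4" using assms by (simp add: field_simps power2_eq_square)
  then show ?thesis unfolding bump_def by (simp add: ramp_ge1)
qed

lemma bump_deriv:
  "(bump a has_real_derivative - (ramp' (4 / a\<^sup>2 * t\<^sup>2 - 1) * (4 / a\<^sup>2 * (2 * t)))) (at t)"
proof -
  have "((\<lambda>t. k * t\<^sup>2 - 1) has_real_derivative k * (2 * t)) (at t)" for k :: real
    by (auto intro!: derivative_eq_intros)
  from DERIV_chain2[OF ramp_deriv this, of "4 / a\<^sup>2"]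
  show ?thesis unfolding bump_def by (auto intro!: derivative_eq_intros)
qed

lemma bump_deriv_bound:
  assumes "a > 0" shows "\<bar>ramp' (4 / a\<^sup>2 * t\<^sup>2 - 1) * (4 / a\<^sup>2 * (2 * t))\<bar> \<le> 16 / a"
proof (cases "\<bar>t\<bar> \<ge> a")
  case True
  then have "a\<^sup>2 \<le> t\<^sup>2" using assms by (intro abs_le_square_iff[THEN iffD1]) auto
  then have "4 / a\<^sup>2 * t\<^sup>2 \<ge> 4" using assms by (simp add: field_simps power2_eq_square)
  then show ?thesis using assms by (simp add: ramp'_zero)
next
  case False
  have "\<bar>ramp' (4 / a\<^sup>2 * t\<^sup>2 - 1)\<bar> * (4 / a\<^sup>2 * (2 * \<bar>t\<bar>)) \<le> 2 * (4 / a\<^sup>2 * (2 * a))"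
    using False assms ramp'_nonneg ramp'_le2 by (intro mult_mono) auto
  also have "\<dots> = 16 / a" using assms by (simp add: power2_eq_square)
  finally show ?thesis using assms by (simp add: abs_mult)
qed

lemma C1_bump_affine: "C1 (\<lambda>x. bump a (n \<bullet> x - c))"
  unfolding bump_def power2_eq_square by (intro C1_diff C1_const C1_ramp C1_mult C1_affine)

lemma frechet_derivative_bump_affine:
  fixes n :: "'a::euclidean_space"
  assumes "norm n = 1" "a > 0"
  shows "\<bar>frechet_derivative (\<lambda>x. bump a (n \<bullet> x - c)) (at x) h\<bar> \<le> 16 / a * norm h"
proof -
  define r where "r = - (ramp' (4 / a\<^sup>2 * (n \<bullet> x - c)\<^sup>2 - 1) * (4 / a\<^sup>2 * (2 * (n \<bullet> x - c))))"
  have "((\<lambda>x. bump a (n \<bullet> x - c)) has_derivative (\<lambda>h. r * frechet_derivative (\<lambda>x. n \<bullet> x - c) (at x) h)) (at x)"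
    unfolding r_def by (rule has_derivative_comp_real[OF bump_deriv C1_affine])
  then have *: "frechet_derivative (\<lambda>x. bump a (n \<bullet> x - c)) (at x) h = r * (n \<bullet> h)"
    unfolding frechet_derivative_affine by (metis frechet_derivative_at)
  have "\<bar>r\<bar> \<le> 16 / a" unfolding r_def abs_minus_cancel by (rule bump_deriv_bound[OF assms(2)])
  moreover have "\<bar>n \<bullet> h\<bar> \<le> norm h" using Cauchy_Schwarz_ineq2[of n h] assms(1) by simp
  ultimately have "\<bar>r\<bar> * \<bar>n \<bullet> h\<bar> \<le> 16 / a * norm h" using assms(2) by (intro mult_mono) auto
  then show ?thesis unfolding * abs_mult .
qed

text \<open>Sets of codimension two have zero capacity for gradients in \<open>L\<^sup>1\<close>: the cut-off at scale \<open>a\<close> has gradient of order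
  \<open>1 / a\<close> on a tube of volume of order \<open>a\<^sup>2\<close>, so it changes the pairing by an amount of order \<open>a\<close>. Parallel distinct
  hyperplanes do not meet and need no cut-off.\<close>

lemma cut_off_near_two_hyperplanes:
  fixes n m :: "'a::euclidean_space"
  assumes nm: "norm n = 1" "norm m = 1" "{x. n \<bullet> x - c = 0} \<noteq> {x. m \<bullet> x - d = 0}"
    and u: "bounded_measurable u" and \<Omega>: "bounded \<Omega>" and \<psi>: "\<psi> \<in> unit_fields \<Omega>" and e: "e > 0"
  obtains \<phi> \<delta> where "\<phi> \<in> unit_fields \<Omega>" "\<bar>pairing u \<psi> - pairing u \<phi>\<bar> \<le> e" "\<delta> > 0"
    "\<And>x. \<bar>n \<bullet> x - c\<bar> \<le> \<delta> \<Longrightarrow> \<bar>m \<bullet> x - d\<bar> \<le> \<delta> \<Longrightarrow> \<phi> x = 0" "\<And>x. \<psi> x = 0 \<Longrightarrow> \<phi> x = 0"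
proof -
  consider "n = m" | "n = - m" | "n \<noteq> m" "n \<noteq> - m" by blast
  then show thesis
  proof cases
    case 1
    then have "c \<noteq> d" using nm(3) by auto
    show thesis
    proof (rule that[OF \<psi>, of "\<bar>c - d\<bar> / 3"])
      fix x assume "\<bar>n \<bullet> x - c\<bar> \<le> \<bar>c - d\<bar> / 3" "\<bar>m \<bullet> x - d\<bar> \<le> \<bar>c - d\<bar> / 3"
      then show "\<psi> x = 0" using 1 \<open>c \<noteq> d\<close> by (simp add: abs_if split: if_splits)
    qed (use e \<open>c \<noteq> d\<close> in auto)
  next
    case 2
    have "c \<noteq> - d"
    proof
      assume "c = - d"
      then have "{x. n \<bullet> x - c = 0} = {x. m \<bullet> x - d = 0}" using 2 by auto
      with nm(3) show False by simp
    qed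
    show thesis
    proof (rule that[OF \<psi>, of "\<bar>c + d\<bar> / 3"])
      fix x assume "\<bar>n \<bullet> x - c\<bar> \<le> \<bar>c + d\<bar> / 3" "\<bar>m \<bullet> x - d\<bar> \<le> \<bar>c + d\<bar> / 3"
      then show "\<psi> x = 0" using 2 \<open>c \<noteq> - d\<close> by (simp add: abs_if split: if_splits)
    qed (use e \<open>c \<noteq> - d\<close> in auto)
  next
    case 3
    obtain R where R: "\<Omega> \<subseteq> cball 0 R" using \<Omega> unfolding bounded_iff by (auto simp: subset_iff)
    define C where "C = measure lebesgue (cball (0::'a) (R + 1))"
    obtain P where P: "P > 0" "\<forall>k::nat. k > 0 \<longrightarrow> (real k)\<^sup>2 * measure lebesgue
      {x \<in> cball 0 R. \<bar>n \<bullet> x - c\<bar> < 1 / (P * real k) \<and> \<bar>m \<bullet> x - d\<bar> < 1 / (P * real k)} \<le> C"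
      using measure_tube[OF nm(1,2) 3, of R c d] unfolding C_def by blast
    have C: "C \<ge> 0" unfolding C_def by simp
    have \<psi>O: "\<psi> \<in> C1c_fields \<Omega>" and \<psi>1: "\<And>x. norm (\<psi> x) \<le> 1" using \<psi> unfolding unit_fields_def by auto
    obtain K where K: "compact K" "K \<subseteq> \<Omega>" "\<And>x. x \<notin> K \<Longrightarrow> \<psi> x = 0"
      using \<psi>O unfolding C1c_fields_iff by auto
    obtain M' where M': "M' > 0" "\<And>x. \<bar>divergence \<psi> x\<bar> \<le> M'"
      using bounded_continuous_compact_support[OF continuous_divergence[OF C1c_fields_C1[OF \<psi>O]] K(1)
          divergence_zero_outside[OF compact_imp_closed[OF K(1)] K(3)]] by blast
    obtain M0 where M0: "\<And>x. \<bar>u x\<bar> \<le> M0" using u unfolding bounded_measurable_def by blast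
    define M where "M = max M0 1"
    have M: "M > 0" "\<And>x. \<bar>u x\<bar> \<le> M" unfolding M_def using M0 by (auto intro: le_max_iff_disj[THEN iffD2])
    define B where "B = M * (M' + 32 * P) * C"
    obtain k :: nat where k: "k > 0" "B / real k \<le> e"
    proof -
      obtain k :: nat where "real k > max (B / e) 0" using reals_Archimedean2 by blast
      then have "k > 0" "B / e < real k" by auto
      then have "B / real k \<le> e" using e by (simp add: field_simps)
      with \<open>k > 0\<close> show thesis by (rule that)
    qed
    define a where "a = 1 / (P * real k)"
    have a: "a > 0" unfolding a_def using P k by simp
    define S where "S = {x \<in> cball 0 R. \<bar>n \<bullet> x - c\<bar> < a \<and> \<bar>m \<bullet> x - d\<bar> < a}"
    have Sm: "S \<in> lmeasurable" unfolding S_def by (rule lmeasurable_tube)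
    have SC: "(real k)\<^sup>2 * measure lebesgue S \<le> C" unfolding S_def a_def using P(2) k(1) by blast
    define \<eta> where "\<eta> x = bump a (n \<bullet> x - c) * bump a (m \<bullet> x - d)" for x
    have \<eta>C: "C1 \<eta>" unfolding \<eta>_def by (intro C1_mult C1_bump_affine)
    have \<eta>01: "0 \<le> \<eta> x" "\<eta> x \<le> 1" for x
      unfolding \<eta>_def using bump_range by (auto intro!: mult_nonneg_nonneg mult_le_one)
    have D\<eta>: "\<bar>frechet_derivative \<eta> (at x) h\<bar> \<le> 32 / a * norm h" for x h
    proof -
      have "(\<eta> has_derivative (\<lambda>h. bump a (n \<bullet> x - c) * frechet_derivative (\<lambda>x. bump a (m \<bullet> x - d)) (at x) h
          + frechet_derivative (\<lambda>x. bump a (n \<bullet> x - c)) (at x) h * bump a (m \<bullet> x - d))) (at x)"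
        unfolding \<eta>_def by (rule has_derivative_mult[OF C1_has_derivative C1_has_derivative]; rule C1_bump_affine)
      from fun_cong[OF frechet_derivative_at[symmetric, OF this], of h]
      have "frechet_derivative \<eta> (at x) h = bump a (n \<bullet> x - c) * frechet_derivative (\<lambda>x. bump a (m \<bullet> x - d)) (at x) h
          + frechet_derivative (\<lambda>x. bump a (n \<bullet> x - c)) (at x) h * bump a (m \<bullet> x - d)" .
      moreover have "\<bar>bump a (n \<bullet> x - c) * frechet_derivative (\<lambda>x. bump a (m \<bullet> x - d)) (at x) h\<bar> \<le> 1 * (16 / a * norm h)"
        unfolding abs_mult using bump_range frechet_derivative_bump_affine[OF nm(2) a] by (intro mult_mono) auto
      moreover have "\<bar>frechet_derivative (\<lambda>x. bump a (n \<bullet> x - c)) (at x) h * bump a (m \<bullet> x - d)\<bar> \<le> (16 / a * norm h) * 1"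
        unfolding abs_mult using bump_range frechet_derivative_bump_affine[OF nm(1) a] a by (intro mult_mono) auto
      moreover have "32 / a * norm h = 16 / a * norm h + 16 / a * norm h" by (simp add: add_divide_distrib[symmetric] distrib_right[symmetric])
      ultimately show ?thesis by linarith
    qed
    have \<eta>0: "\<eta> x * divergence \<psi> x + frechet_derivative \<eta> (at x) (\<psi> x) = 0" if "x \<notin> S" for x
    proof (cases "x \<in> cball 0 R")
      case False
      then have "\<psi> x = 0" "divergence \<psi> x = 0"
        using R K(2,3) C1c_fields_divergence_outside[OF \<psi>O] by blast+
      then show ?thesis using linear_0[OF has_derivative_linear[OF C1_has_derivative[OF \<eta>C]]] by simp
    next
      case True
      have z: "\<eta> y = 0" if "\<bar>n \<bullet> y - c\<bar> \<ge> a \<or> \<bar>m \<bullet> y - d\<bar> \<ge> a" for y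
        using that bump_eq_0[OF a] unfolding \<eta>_def by auto
      have x: "\<bar>n \<bullet> x - c\<bar> \<ge> a \<or> \<bar>m \<bullet> x - d\<bar> \<ge> a" using True that unfolding S_def by auto
      \<comment> \<open>Outside the tube \<open>\<eta>\<close> attains its minimum, so its derivative vanishes there as well.\<close>
      have "frechet_derivative \<eta> (at x) = (\<lambda>h. 0)"
        by (rule differential_zero_maxmin[of x UNIV \<eta>])
           (use \<eta>01 z[OF x] C1_has_derivative[OF \<eta>C] in auto)
      then show ?thesis using z[OF x] by simp
    qed
    have \<eta>\<psi>: "(\<lambda>x. \<eta> x *\<^sub>R \<psi> x) \<in> C1c_fields \<Omega>" by (rule C1c_fields_mult[OF \<eta>C \<psi>O])
    have "\<bar>LINT x|lebesgue. u x * divergence (\<lambda>x. \<eta> x *\<^sub>R \<psi> x) x\<bar> \<le> (M * (M' + 32 / a)) * measure lebesgue S"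
    proof (rule integral_le_bound_on_set[OF Sm])
      fix x
      show "\<bar>u x * divergence (\<lambda>x. \<eta> x *\<^sub>R \<psi> x) x\<bar> \<le> M * (M' + 32 / a) * indicator S x"
      proof (cases "x \<in> S")
        case True
        have "\<bar>\<eta> x * divergence \<psi> x + frechet_derivative \<eta> (at x) (\<psi> x)\<bar> \<le> 1 * M' + 32 / a * 1"
        proof (rule order_trans[OF abs_triangle_ineq add_mono])
          show "\<bar>\<eta> x * divergence \<psi> x\<bar> \<le> 1 * M'"
            unfolding abs_mult using \<eta>01 M' by (intro mult_mono) auto
          have "32 / a * norm (\<psi> x) \<le> 32 / a * 1" using \<psi>1 a by (intro mult_left_mono) auto
          then show "\<bar>frechet_derivative \<eta> (at x) (\<psi> x)\<bar> \<le> 32 / a * 1" using D\<eta>[of x "\<psi> x"] by linarith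
        qed
        then have "\<bar>u x\<bar> * \<bar>divergence (\<lambda>x. \<eta> x *\<^sub>R \<psi> x) x\<bar> \<le> M * (M' + 32 / a)"
          unfolding divergence_mult[OF \<eta>C C1c_fields_C1[OF \<psi>O]] using M by (intro mult_mono) auto
        then show ?thesis using True by (simp add: abs_mult)
      next
        case False
        then show ?thesis using \<eta>0 unfolding divergence_mult[OF \<eta>C C1c_fields_C1[OF \<psi>O]] by simp
      qed
    qed (use M M' a in simp)
    also have "\<dots> \<le> B / real k"
    proof -
      have "M' + 32 / a \<le> (M' + 32 * P) * real k"
      proof -
        have "M' * 1 \<le> M' * real k" using M' k by (intro mult_left_mono) auto
        then show ?thesis unfolding a_def by (simp add: algebra_simps)
      qed
      then have "(M * (M' + 32 / a)) * measure lebesgue S \<le> (M * ((M' + 32 * P) * real k)) * measure lebesgue S"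
        using M by (intro mult_right_mono mult_left_mono) auto
      also have "\<dots> = (M * (M' + 32 * P)) * ((real k)\<^sup>2 * measure lebesgue S) / real k"
        using k by (simp add: power2_eq_square)
      also have "\<dots> \<le> (M * (M' + 32 * P)) * C / real k"
        using SC M M' P by (intro divide_right_mono mult_left_mono) auto
      finally show ?thesis unfolding B_def .
    qed
    finally have small: "\<bar>pairing u (\<lambda>x. \<eta> x *\<^sub>R \<psi> x)\<bar> \<le> e" using k(2) unfolding pairing_def by linarith
    define \<phi> where "\<phi> x = (1 - \<eta> x) *\<^sub>R \<psi> x" for x
    have "C1 (\<lambda>x. 1 - \<eta> x)" by (intro C1_diff C1_const \<eta>C)
    then have \<phi>O: "\<phi> \<in> C1c_fields \<Omega>" unfolding \<phi>_def by (rule C1c_fields_mult[OF _ \<psi>O])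
    have "norm (\<phi> x) \<le> 1" for x
      unfolding \<phi>_def using \<eta>01[of x] \<psi>1[of x] by (auto intro!: mult_le_one)
    then have \<phi>: "\<phi> \<in> unit_fields \<Omega>" using \<phi>O unfolding unit_fields_def by simp
    have "\<psi> = (\<lambda>x. \<phi> x + \<eta> x *\<^sub>R \<psi> x)" unfolding \<phi>_def by (simp add: algebra_simps)
    then have "pairing u \<psi> = pairing u \<phi> + pairing u (\<lambda>x. \<eta> x *\<^sub>R \<psi> x)"
      using pairing_add_field[OF u \<phi>O \<eta>\<psi>] by simp
    then have "\<bar>pairing u \<psi> - pairing u \<phi>\<bar> \<le> e" using small by simp
    then show thesis
    proof (rule that[OF \<phi>, of "a / 2"])
      fix x assume "\<bar>n \<bullet> x - c\<bar> \<le> a / 2" "\<bar>m \<bullet> x - d\<bar> \<le> a / 2"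
      then have "\<eta> x = 1" unfolding \<eta>_def using bump_eq_1[OF a] by simp
      then show "\<phi> x = 0" unfolding \<phi>_def by simp
    qed (use a \<phi>_def in auto)
  qed
qed

lemma cut_off_near_hyperplane_pairs:
  fixes n :: "'h \<Rightarrow> 'a::euclidean_space"
  assumes "finite Q"
    and nm: "\<And>h l. (h, l) \<in> Q \<Longrightarrow> norm (n h) = 1 \<and> norm (n l) = 1 \<and> {x. n h \<bullet> x - c h = 0} \<noteq> {x. n l \<bullet> x - c l = 0}"
    and u: "bounded_measurable u" and \<Omega>: "bounded \<Omega>" and \<psi>: "\<psi> \<in> unit_fields \<Omega>" and e: "e > 0"
  shows "\<exists>\<phi> \<delta>. \<phi> \<in> unit_fields \<Omega> \<and> \<bar>pairing u \<psi> - pairing u \<phi>\<bar> \<le> e \<and> \<delta> > 0 \<and>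
    (\<forall>(h, l)\<in>Q. \<forall>x. \<bar>n h \<bullet> x - c h\<bar> \<le> \<delta> \<longrightarrow> \<bar>n l \<bullet> x - c l\<bar> \<le> \<delta> \<longrightarrow> \<phi> x = 0)"
  using assms(1) nm e
proof (induction Q arbitrary: e rule: finite_induct)
  case empty
  then show ?case using \<psi> by (intro exI[of _ \<psi>] exI[of _ 1]) auto
next
  case (insert q Q)
  obtain h l where q: "q = (h, l)" by (cases q)
  obtain \<phi> \<delta> where \<phi>: "\<phi> \<in> unit_fields \<Omega>" "\<bar>pairing u \<psi> - pairing u \<phi>\<bar> \<le> e / 2" "\<delta> > 0"
    "\<And>h l x. (h, l) \<in> Q \<Longrightarrow> \<bar>n h \<bullet> x - c h\<bar> \<le> \<delta> \<Longrightarrow> \<bar>n l \<bullet> x - c l\<bar> \<le> \<delta> \<Longrightarrow> \<phi> x = 0"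
    using insert.IH[of "e / 2"] insert.prems by fastforce
  have nm': "norm (n h) = 1" "norm (n l) = 1" "{x. n h \<bullet> x - c h = 0} \<noteq> {x. n l \<bullet> x - c l = 0}"
    using insert.prems(1)[of h l] q by auto
  obtain \<phi>' \<delta>' where \<phi>': "\<phi>' \<in> unit_fields \<Omega>" "\<bar>pairing u \<phi> - pairing u \<phi>'\<bar> \<le> e / 2" "\<delta>' > 0"
    "\<And>x. \<bar>n h \<bullet> x - c h\<bar> \<le> \<delta>' \<Longrightarrow> \<bar>n l \<bullet> x - c l\<bar> \<le> \<delta>' \<Longrightarrow> \<phi>' x = 0" "\<And>x. \<phi> x = 0 \<Longrightarrow> \<phi>' x = 0"
    using cut_off_near_two_hyperplanes[OF nm' u \<Omega> \<phi>(1), of "e / 2"] insert.prems(2) by (metis half_gt_zero)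
  show ?case
  proof (intro exI[of _ \<phi>'] exI[of _ "min \<delta> \<delta>'"] conjI)
    show "\<bar>pairing u \<psi> - pairing u \<phi>'\<bar> \<le> e" using \<phi>(2) \<phi>'(2) by linarith
    show "\<forall>(h, l)\<in>insert q Q. \<forall>x. \<bar>n h \<bullet> x - c h\<bar> \<le> min \<delta> \<delta>' \<longrightarrow> \<bar>n l \<bullet> x - c l\<bar> \<le> min \<delta> \<delta>' \<longrightarrow> \<phi>' x = 0"
      using \<phi>(4) \<phi>'(4,5) q by auto
  qed (use \<phi> \<phi>' in auto)
qed

section \<open>Total variation of piecewise constant functions\<close>

text \<open>The cells of \<open>\<T>\<close> enter only through the finitely many hyperplanes that contain their boundaries. The
  hyperplanes are pairwise distinct as sets; otherwise two of them would meet in codimension one.\<close>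

locale hyperplane_partition =
  fixes \<Omega> :: "'a::euclidean_space set" and \<T> :: "'a set set"
    and H :: "'h set" and n :: "'h \<Rightarrow> 'a" and c :: "'h \<Rightarrow> real"
  assumes Omega: "open \<Omega>" "bounded \<Omega>"
    and T: "finite \<T>" "\<T> \<noteq> {}" "pairwise disjnt \<T>" "\<And>T. T \<in> \<T> \<Longrightarrow> open T" "\<And>T. T \<in> \<T> \<Longrightarrow> T \<subseteq> \<Omega>"
    and cover: "\<Omega> \<subseteq> (\<Union>T\<in>\<T>. closure T)"
    and H: "finite H" "\<And>h. h \<in> H \<Longrightarrow> norm (n h) = 1"
    and H_distinct: "\<And>h l. h \<in> H \<Longrightarrow> l \<in> H \<Longrightarrow> h \<noteq> l \<Longrightarrow> {x. n h \<bullet> x - c h = 0} \<noteq> {x. n l \<bullet> x - c l = 0}"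
    and frontier_T: "\<And>T. T \<in> \<T> \<Longrightarrow> frontier T \<subseteq> (\<Union>h\<in>H. {x. n h \<bullet> x - c h = 0})"
begin

definition sdist :: "'h \<Rightarrow> 'a \<Rightarrow> real" where "sdist h x = n h \<bullet> x - c h"

lemma sdist_cont: "continuous_on S (sdist h)" unfolding sdist_def by (intro continuous_intros)

lemma open_sdist: "open {x. sdist h x < 0}" "open {x. 0 < sdist h x}"
  by (intro open_Collect_less continuous_on_const sdist_cont)+

definition pw_const :: "('a set \<Rightarrow> real) \<Rightarrow> 'a \<Rightarrow> real" where
  "pw_const v x = (\<Sum>T\<in>\<T>. v T * indicator T x)"

lemma pw_const_eq: "T \<in> \<T> \<Longrightarrow> x \<in> T \<Longrightarrow> pw_const v x = v T"
proof -
  assume a: "T \<in> \<T>" "x \<in> T"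
  have "pw_const v x = (\<Sum>T'\<in>\<T>. if T' = T then v T else 0)"
    unfolding pw_const_def using a T(3) by (intro sum.cong) (auto simp: indicator_def pairwise_def disjnt_iff)
  then show ?thesis using a T(1) by simp
qed

lemma bounded_measurable_pw_const: "bounded_measurable (pw_const v)"
  unfolding bounded_measurable_def
proof
  show "pw_const v \<in> borel_measurable lebesgue"
    unfolding pw_const_def using T(4)
    by (intro borel_measurable_sum borel_measurable_times borel_measurable_indicator) auto
  show "\<exists>M. \<forall>x. \<bar>pw_const v x\<bar> \<le> M"
  proof (intro exI allI)
    fix x
    have "\<bar>pw_const v x\<bar> \<le> (\<Sum>T\<in>\<T>. \<bar>v T * indicator T x\<bar>)" unfolding pw_const_def by (rule sum_abs)
    also have "\<dots> \<le> (\<Sum>T\<in>\<T>. \<bar>v T\<bar>)" by (intro sum_mono) (auto simp: indicator_def)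
    finally show "\<bar>pw_const v x\<bar> \<le> (\<Sum>T\<in>\<T>. \<bar>v T\<bar>)" .
  qed
qed

lemma frontier_sdistD: "T \<in> \<T> \<Longrightarrow> x \<in> frontier T \<Longrightarrow> \<exists>h\<in>H. sdist h x = 0"
  using frontier_T unfolding sdist_def by auto

lemma in_cell:
  assumes "x \<in> \<Omega>" "\<And>h. h \<in> H \<Longrightarrow> sdist h x \<noteq> 0"
  obtains T where "T \<in> \<T>" "x \<in> T"
proof -
  obtain T where T': "T \<in> \<T>" "x \<in> closure T" using cover assms(1) by blast
  then have "x \<notin> frontier T" using frontier_sdistD assms(2) by blast
  then have "x \<in> T" using T' T(4) unfolding frontier_def by (simp add: interior_open)
  with T'(1) show thesis by (rule that)
qed

text \<open>A connected set that avoids all hyperplanes cannot cross the boundary of a cell of \<open>\<T>\<close>.\<close>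

lemma cell_in_simplex:
  assumes "connected Q" "\<And>h x. h \<in> H \<Longrightarrow> x \<in> Q \<Longrightarrow> sdist h x \<noteq> 0"
  shows "\<exists>T\<in>\<T>. Q \<inter> \<Omega> \<subseteq> T"
proof (cases "Q \<inter> \<Omega> = {}")
  case True
  then show ?thesis using T(2) by blast
next
  case False
  then obtain x where x: "x \<in> Q" "x \<in> \<Omega>" by blast
  obtain T where T': "T \<in> \<T>" "x \<in> T" using in_cell[OF x(2)] assms(2) x(1) by metis
  have "Q \<inter> frontier T = {}" using frontier_sdistD[OF T'(1)] assms(2) by blast
  then have "Q - T = {}" using connected_Int_frontier[OF assms(1), of T] x T' by blast
  with T'(1) show ?thesis by blast
qed

definition side_sign :: "'h set \<Rightarrow> 'h \<Rightarrow> real" where "side_sign \<sigma> l = (if l \<in> \<sigma> then 1 else -1)"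

text \<open>An edge \<open>(h, \<sigma>)\<close> is a piece of the hyperplane \<open>h\<close> cut out by the other hyperplanes; \<open>\<sigma>\<close> lists those of
  which it lies on the positive side.\<close>

definition edges :: "('h \<times> 'h set) set" where "edges = (SIGMA h:H. Pow (H - {h}))"

text \<open>The points that are nearer to \<open>h\<close> than to any other hyperplane, on the sides prescribed by \<open>\<sigma>\<close>. These open sets are
  pairwise disjoint, and each is crossed by one hyperplane only.\<close>

definition edge_nbhd :: "'h \<times> 'h set \<Rightarrow> 'a set" where
  "edge_nbhd e = {x \<in> \<Omega>. \<forall>l\<in>H - {fst e}. \<bar>sdist (fst e) x\<bar> < side_sign (snd e) l * sdist l x}"

lemma finite_edges: "finite edges" unfolding edges_def using H(1) by auto

lemma edge_nbhd_subset: "edge_nbhd e \<subseteq> \<Omega>" unfolding edge_nbhd_def by blast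

lemma edge_nbhd_disjoint:
  assumes "e \<in> edges" "e' \<in> edges" "x \<in> edge_nbhd e" "x \<in> edge_nbhd e'" shows "e = e'"
proof -
  obtain h \<sigma> where e: "e = (h, \<sigma>)" "h \<in> H" "\<sigma> \<subseteq> H - {h}" using assms(1) unfolding edges_def by auto
  obtain h' \<sigma>' where e': "e' = (h', \<sigma>')" "h' \<in> H" "\<sigma>' \<subseteq> H - {h'}" using assms(2) unfolding edges_def by auto
  have abs_side_sign: "\<bar>side_sign \<sigma> l * t\<bar> = \<bar>t\<bar>" for \<sigma> l t unfolding side_sign_def by auto
  have 1: "\<bar>sdist h x\<bar> < side_sign \<sigma> l * sdist l x" if "l \<in> H - {h}" for l using assms(3) that e unfolding edge_nbhd_def by simp
  have 2: "\<bar>sdist h' x\<bar> < side_sign \<sigma>' l * sdist l x" if "l \<in> H - {h'}" for l using assms(4) that e' unfolding edge_nbhd_def by simp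
  have hh: "h = h'"
  proof (rule ccontr)
    assume "h \<noteq> h'"
    then have "\<bar>sdist h x\<bar> < \<bar>sdist h' x\<bar>" "\<bar>sdist h' x\<bar> < \<bar>sdist h x\<bar>"
      using 1[of h'] 2[of h] e e' abs_side_sign abs_ge_self by (metis Diff_iff empty_iff insert_iff order_less_le_trans)+
    then show False by simp
  qed
  have "l \<in> \<sigma> \<longleftrightarrow> l \<in> \<sigma>'" for l
  proof (cases "l \<in> H - {h}")
    case True
    then have "0 < side_sign \<sigma> l * sdist l x" "0 < side_sign \<sigma>' l * sdist l x" using 1[of l] 2[of l] hh by auto
    then show ?thesis unfolding side_sign_def by (auto split: if_splits)
  qed (use e e' hh in auto)
  then show ?thesis using e e' hh by auto
qed

text \<open>Each of the two halves of an edge neighbourhood lies in a convex set that avoids all hyperplanes.\<close>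

lemma ex_cells:
  "\<exists>i j. \<forall>e\<in>edges. i e \<in> \<T> \<and> j e \<in> \<T> \<and> edge_nbhd e \<inter> {x. 0 < sdist (fst e) x} \<subseteq> i e \<and> edge_nbhd e \<inter> {x. sdist (fst e) x < 0} \<subseteq> j e"
proof -
  have cvx: "convex {x. 0 < r * sdist l x}" for r l
  proof -
    have "{x. 0 < r * sdist l x} = {x. (r *\<^sub>R n l) \<bullet> x > r * c l}" unfolding sdist_def by (auto simp: algebra_simps)
    then show ?thesis by (simp only: convex_halfspace_gt)
  qed
  have ex: "\<exists>T\<in>\<T>. edge_nbhd e \<inter> {x. 0 < r * sdist (fst e) x} \<subseteq> T" if "e \<in> edges" for e r
  proof -
    define Q where "Q = {x. 0 < r * sdist (fst e) x} \<inter> (\<Inter>l\<in>H - {fst e}. {x. 0 < side_sign (snd e) l * sdist l x})"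
    have "convex Q" unfolding Q_def by (intro convex_Int convex_INT cvx)
    then have "connected Q" by (rule convex_connected)
    moreover have "sdist h x \<noteq> 0" if "h \<in> H" "x \<in> Q" for h x
    proof (cases "h = fst e")
      case True
      with that show ?thesis unfolding Q_def by auto
    next
      case False
      then have "0 < side_sign (snd e) h * sdist h x" using that unfolding Q_def by blast
      then show ?thesis by auto
    qed
    ultimately have "\<exists>T\<in>\<T>. Q \<inter> \<Omega> \<subseteq> T" by (rule cell_in_simplex)
    moreover have "edge_nbhd e \<inter> {x. 0 < r * sdist (fst e) x} \<subseteq> Q \<inter> \<Omega>"
      unfolding edge_nbhd_def Q_def by (auto intro: le_less_trans[OF abs_ge_zero])
    ultimately show ?thesis by blast
  qed
  have "\<forall>e\<in>edges. \<exists>T. T \<in> \<T> \<and> edge_nbhd e \<inter> {x. 0 < sdist (fst e) x} \<subseteq> T" using ex[where r=1] unfolding mult_1 by blast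
  moreover have "\<forall>e\<in>edges. \<exists>T. T \<in> \<T> \<and> edge_nbhd e \<inter> {x. sdist (fst e) x < 0} \<subseteq> T" using ex[where r="-1"] by (simp add: Bex_def)
  ultimately obtain i j where "\<forall>e\<in>edges. i e \<in> \<T> \<and> edge_nbhd e \<inter> {x. 0 < sdist (fst e) x} \<subseteq> i e"
    "\<forall>e\<in>edges. j e \<in> \<T> \<and> edge_nbhd e \<inter> {x. sdist (fst e) x < 0} \<subseteq> j e" by (metis bchoice)
  then show ?thesis by blast
qed

text \<open>If one half of the neighbourhood is empty, the cell chosen on that side is arbitrary; the weight of the edge
  is then zero.\<close>

definition ends :: "('h \<times> 'h set \<Rightarrow> 'a set) \<times> ('h \<times> 'h set \<Rightarrow> 'a set)" where
  "ends = (SOME (i, j). \<forall>e\<in>edges. i e \<in> \<T> \<and> j e \<in> \<T> \<and> edge_nbhd e \<inter> {x. 0 < sdist (fst e) x} \<subseteq> i e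
      \<and> edge_nbhd e \<inter> {x. sdist (fst e) x < 0} \<subseteq> j e)"
definition "pos_cell = fst ends"
definition "neg_cell = snd ends"

lemma ends:
  assumes "e \<in> edges"
  shows "pos_cell e \<in> \<T>" "neg_cell e \<in> \<T>" "x \<in> edge_nbhd e \<Longrightarrow> 0 < sdist (fst e) x \<Longrightarrow> x \<in> pos_cell e"
    "x \<in> edge_nbhd e \<Longrightarrow> sdist (fst e) x < 0 \<Longrightarrow> x \<in> neg_cell e"
proof -
  have "case ends of (i, j) \<Rightarrow> \<forall>e\<in>edges. i e \<in> \<T> \<and> j e \<in> \<T> \<and> edge_nbhd e \<inter> {x. 0 < sdist (fst e) x} \<subseteq> i e
      \<and> edge_nbhd e \<inter> {x. sdist (fst e) x < 0} \<subseteq> j e"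
    unfolding ends_def by (rule someI_ex) (use ex_cells in auto)
  then show "pos_cell e \<in> \<T>" "neg_cell e \<in> \<T>" "x \<in> edge_nbhd e \<Longrightarrow> 0 < sdist (fst e) x \<Longrightarrow> x \<in> pos_cell e"
    "x \<in> edge_nbhd e \<Longrightarrow> sdist (fst e) x < 0 \<Longrightarrow> x \<in> neg_cell e"
    using assms unfolding pos_cell_def neg_cell_def by (auto simp: case_prod_beta)
qed

abbreviation half :: "'h \<times> 'h set \<Rightarrow> 'a \<Rightarrow> real" where
  "half e \<equiv> indicat_real {x. 0 < sdist (fst e) x}"

text \<open>The area of the edge, as the perimeter of a half-space in the edge neighbourhood. It is finite because half-spaces
  have finite perimeter in bounded sets.\<close>

definition weight :: "'h \<times> 'h set \<Rightarrow> real" where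
  "weight e = real_of_ereal (TV (half e) (edge_nbhd e))"

lemma TV_half: assumes "e \<in> edges" shows "TV (half e) (edge_nbhd e) = ereal (weight e)"
proof -
  have "fst e \<in> H" using assms unfolding edges_def by auto
  moreover have "bounded (edge_nbhd e)" using Omega(2) edge_nbhd_subset by (rule bounded_subset)
  ultimately have "TV (half e) (edge_nbhd e) < \<infinity>"
    unfolding sdist_def by (intro TV_halfspace_finite H(2))
  then show ?thesis unfolding weight_def using TV_nonneg[of "half e" "edge_nbhd e"]
    by (intro ereal_real'[symmetric]) auto
qed

lemma weight_nonneg: "0 \<le> weight e"
  unfolding weight_def using TV_nonneg by (rule real_of_ereal_pos)

lemma half_meas: "{x. 0 < sdist h x} \<in> sets lebesgue" using open_sdist by auto

lemma sdist_zero_negligible: "h \<in> H \<Longrightarrow> negligible {x. sdist h x = 0}"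
  using negligible_hyperplane[of "n h" "c h"] H(2)[of h] unfolding sdist_def by force

lemma pairing_on_edge_nbhd:
  assumes e: "e \<in> edges" and \<psi>: "\<psi> \<in> C1c_fields (edge_nbhd e)"
  shows "pairing (pw_const v) \<psi> = (v (pos_cell e) - v (neg_cell e)) * pairing (half e) \<psi>"
proof -
  have "fst e \<in> H" using e unfolding edges_def by auto
  then have "AE x in lebesgue. x \<notin> {x. sdist (fst e) x = 0}"
    using sdist_zero_negligible by (intro AE_not_in) (auto simp: negligible_iff_null_sets)
  then have "ae_eq (edge_nbhd e) (pw_const v) (\<lambda>x. (v (pos_cell e) - v (neg_cell e)) * half e x + v (neg_cell e))"
    unfolding ae_eq_def
  proof eventually_elim
    case (elim x)
    show ?case
    proof
      assume x: "x \<in> edge_nbhd e"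
      show "pw_const v x = (v (pos_cell e) - v (neg_cell e)) * half e x + v (neg_cell e)"
      proof (cases "0 < sdist (fst e) x")
        case True
        then show ?thesis using pw_const_eq[OF ends(1)[OF e] ends(3)[OF e x]] by simp
      next
        case False
        then have "sdist (fst e) x < 0" using elim by auto
        then show ?thesis using pw_const_eq[OF ends(2)[OF e] ends(4)[OF e x]] by simp
      qed
    qed
  qed
  from pairing_cong_AE[OF this \<psi>]
  have "pairing (pw_const v) \<psi> = pairing (\<lambda>x. (v (pos_cell e) - v (neg_cell e)) * half e x + v (neg_cell e)) \<psi>" .
  also have "\<dots> = pairing (\<lambda>x. (v (pos_cell e) - v (neg_cell e)) * half e x) \<psi> + pairing (\<lambda>x. v (neg_cell e)) \<psi>"
  proof (rule pairing_add_left[OF _ _ \<psi>])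
    show "bounded_measurable (\<lambda>x. v (neg_cell e))" unfolding bounded_measurable_def by auto
    show "bounded_measurable (\<lambda>x. (v (pos_cell e) - v (neg_cell e)) * half e x)"
      unfolding bounded_measurable_def
    proof
      show "(\<lambda>x. (v (pos_cell e) - v (neg_cell e)) * half e x) \<in> borel_measurable lebesgue"
        by (intro borel_measurable_times borel_measurable_const borel_measurable_indicator half_meas)
    qed (auto intro!: exI[of _ "\<bar>v (pos_cell e) - v (neg_cell e)\<bar>"] simp: indicator_def)
  qed
  also have "pairing (\<lambda>x. v (neg_cell e)) \<psi> = 0"
    by (rule pairing_ae_const[OF _ \<psi>, of _ "v (neg_cell e)"]) (simp add: ae_eq_def)
  finally show ?thesis by (simp add: pairing_scale_left)
qed

text \<open>The total variation of \<open>v\<close> on the weighted graph whose vertices are the cells of \<open>\<T>\<close>.\<close>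

definition gtv :: "('a set \<Rightarrow> real) \<Rightarrow> real" where
  "gtv v = (\<Sum>e\<in>edges. weight e * \<bar>v (pos_cell e) - v (neg_cell e)\<bar>)"

text \<open>Near-optimal fields for the separate edges, each with the sign of its jump, have disjoint supports, so their
  sum is an admissible field.\<close>

lemma gtv_le_TV: "ereal (gtv v) \<le> TV (pw_const v) \<Omega>"
proof (rule ccontr)
  assume "\<not> ?thesis"
  then have lt: "TV (pw_const v) \<Omega> < ereal (gtv v)" by simp
  then obtain r where r: "TV (pw_const v) \<Omega> = ereal r" using TV_nonneg[of "pw_const v" \<Omega>]
    by (cases "TV (pw_const v) \<Omega>") auto
  define D where "D = (\<Sum>e\<in>edges. \<bar>v (pos_cell e) - v (neg_cell e)\<bar>)"
  have D: "D \<ge> 0" unfolding D_def by (intro sum_nonneg) auto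
  define \<epsilon> where "\<epsilon> = (gtv v - r) / (2 * (D + 1))"
  have eps: "\<epsilon> > 0" using lt D unfolding r \<epsilon>_def by simp
  have "\<forall>e\<in>edges. \<exists>\<psi>. \<psi> \<in> unit_fields (edge_nbhd e) \<and> weight e - \<epsilon> < pairing (half e) \<psi>"
  proof
    fix e assume e: "e \<in> edges"
    obtain \<psi> where "\<psi> \<in> unit_fields (edge_nbhd e)"
      "real_of_ereal (TV (half e) (edge_nbhd e)) - \<epsilon> < pairing (half e) \<psi>"
      by (rule unit_field_near_TV[OF _ eps, of "half e" "edge_nbhd e"]) (use TV_half[OF e] in auto)
    then show "\<exists>\<psi>. \<psi> \<in> unit_fields (edge_nbhd e) \<and> weight e - \<epsilon> < pairing (half e) \<psi>"
      unfolding TV_half[OF e] by auto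
  qed
  then obtain \<psi> where \<psi>: "\<And>e. e \<in> edges \<Longrightarrow> \<psi> e \<in> unit_fields (edge_nbhd e)"
    "\<And>e. e \<in> edges \<Longrightarrow> weight e - \<epsilon> < pairing (half e) (\<psi> e)" by metis
  define s where "s e = sgn (v (pos_cell e) - v (neg_cell e))" for e
  define \<Psi> where "\<Psi> x = (\<Sum>e\<in>edges. s e *\<^sub>R \<psi> e x)" for x
  have \<psi>V: "\<psi> e \<in> C1c_fields (edge_nbhd e)" if "e \<in> edges" for e using \<psi>(1)[OF that] unfolding unit_fields_def by simp
  have s\<psi>: "(\<lambda>x. s e *\<^sub>R \<psi> e x) \<in> C1c_fields \<Omega>" if "e \<in> edges" for e
    using C1c_fields_mono[OF \<psi>V[OF that] edge_nbhd_subset] by (rule C1c_fields_scaleR)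
  have norm: "norm (\<Psi> x) \<le> 1" for x
  proof (cases "\<exists>e\<in>edges. x \<in> edge_nbhd e")
    case True
    then obtain e where e: "e \<in> edges" "x \<in> edge_nbhd e" by blast
    have "\<psi> e' x = 0" if "e' \<in> edges" "e' \<noteq> e" for e'
      using that e edge_nbhd_disjoint \<psi>V[OF that(1)] unfolding C1c_fields_iff by blast
    then have "\<Psi> x = (\<Sum>e'\<in>edges. if e' = e then s e *\<^sub>R \<psi> e x else 0)"
      unfolding \<Psi>_def by (intro sum.cong) auto
    then have "\<Psi> x = s e *\<^sub>R \<psi> e x" using e(1) finite_edges by simp
    moreover have "norm (\<psi> e x) \<le> 1" using \<psi>(1)[OF e(1)] unfolding unit_fields_def by simp
    ultimately show ?thesis unfolding s_def by (auto simp: sgn_if)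
  next
    case False
    then have "\<psi> e x = 0" if "e \<in> edges" for e
      using that \<psi>V[OF that] unfolding C1c_fields_iff by blast
    then show ?thesis unfolding \<Psi>_def by simp
  qed
  have "\<Psi> \<in> unit_fields \<Omega>"
    using norm C1c_fields_sum[OF s\<psi>] unfolding unit_fields_def \<Psi>_def by simp
  then have "pairing (pw_const v) \<Psi> \<le> r" using pairing_le_TV[of \<Psi> \<Omega> "pw_const v"] unfolding r by simp
  have "pairing (pw_const v) \<Psi> = (\<Sum>e\<in>edges. pairing (pw_const v) (\<lambda>x. s e *\<^sub>R \<psi> e x))"
    unfolding \<Psi>_def by (rule pairing_sum_field[OF bounded_measurable_pw_const finite_edges s\<psi>])
  also have "\<dots> \<ge> (\<Sum>e\<in>edges. (weight e - \<epsilon>) * \<bar>v (pos_cell e) - v (neg_cell e)\<bar>)"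
  proof (rule sum_mono)
    fix e assume e: "e \<in> edges"
    have "pairing (pw_const v) (\<lambda>x. s e *\<^sub>R \<psi> e x) = s e * (v (pos_cell e) - v (neg_cell e)) * pairing (half e) (\<psi> e)"
      using pairing_scaleR_field[OF \<psi>V[OF e]] pairing_on_edge_nbhd[OF e \<psi>V[OF e]] by simp
    also have "s e * (v (pos_cell e) - v (neg_cell e)) = \<bar>v (pos_cell e) - v (neg_cell e)\<bar>" unfolding s_def by (simp add: sgn_if)
    also have "\<dots> * pairing (half e) (\<psi> e) \<ge> \<bar>v (pos_cell e) - v (neg_cell e)\<bar> * (weight e - \<epsilon>)"
      using \<psi>(2)[OF e] by (intro mult_left_mono) auto
    finally show "(weight e - \<epsilon>) * \<bar>v (pos_cell e) - v (neg_cell e)\<bar> \<le> pairing (pw_const v) (\<lambda>x. s e *\<^sub>R \<psi> e x)"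
      by (simp add: mult.commute)
  qed
  also have "(\<Sum>e\<in>edges. (weight e - \<epsilon>) * \<bar>v (pos_cell e) - v (neg_cell e)\<bar>) = gtv v - \<epsilon> * D"
    unfolding gtv_def D_def by (simp add: left_diff_distrib sum_subtractf sum_distrib_left)
  finally have "gtv v - \<epsilon> * D \<le> r" using \<open>pairing (pw_const v) \<Psi> \<le> r\<close> by simp
  moreover have "\<epsilon> * D < gtv v - r"
  proof -
    have "\<epsilon> * D \<le> \<epsilon> * (D + 1)" using eps by simp
    also have "\<dots> = (gtv v - r) / 2"
    proof -
      have "x / (2 * q) * q = x / 2" if "q > 0" for x q :: real using that by simp
      from this[of "D + 1" "gtv v - r"] show ?thesis unfolding \<epsilon>_def using D by simp
    qed
    finally show ?thesis using lt unfolding r by simp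
  qed
  ultimately show False by simp
qed

lemma pairing_le_weight:
  assumes e: "e \<in> edges" and \<psi>: "\<psi> \<in> unit_fields (edge_nbhd e)"
  shows "pairing (pw_const v) \<psi> \<le> weight e * \<bar>v (pos_cell e) - v (neg_cell e)\<bar>"
proof -
  have \<psi>V: "\<psi> \<in> C1c_fields (edge_nbhd e)" using \<psi> unfolding unit_fields_def by simp
  have "(\<lambda>x. (-1) *\<^sub>R \<psi> x) \<in> unit_fields (edge_nbhd e)"
    using \<psi> C1c_fields_scaleR[of \<psi> "edge_nbhd e" "-1"] unfolding unit_fields_def by auto
  then have "pairing (half e) (\<lambda>x. (-1) *\<^sub>R \<psi> x) \<le> weight e"
    using pairing_le_TV[of _ "edge_nbhd e" "half e"] unfolding TV_half[OF e] by simp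
  moreover have "pairing (half e) \<psi> \<le> weight e"
    using pairing_le_TV[OF \<psi>, of "half e"] unfolding TV_half[OF e] by simp
  ultimately have "\<bar>pairing (half e) \<psi>\<bar> \<le> weight e"
    unfolding pairing_scaleR_field[OF \<psi>V] by simp
  then have "\<bar>v (pos_cell e) - v (neg_cell e)\<bar> * \<bar>pairing (half e) \<psi>\<bar>
      \<le> \<bar>v (pos_cell e) - v (neg_cell e)\<bar> * weight e" by (intro mult_left_mono) auto
  then show ?thesis unfolding pairing_on_edge_nbhd[OF e \<psi>V]
    by (simp add: mult.commute flip: abs_mult)
qed

text \<open>Away from the intersections of two hyperplanes, a field splits into parts supported in single edge neighbourhoods
  and a part that avoids all hyperplanes. The latter lives inside the cells, where the function is constant, and
  contributes nothing; each of the former contributes at most the weight times the jump.\<close>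

lemma pairing_away_from_edges:
  assumes \<psi>: "\<psi> \<in> unit_fields \<Omega>" and \<delta>: "\<delta> > 0"
    and z: "\<And>h l x. h \<in> H \<Longrightarrow> l \<in> H \<Longrightarrow> h \<noteq> l \<Longrightarrow> \<bar>sdist h x\<bar> \<le> \<delta> \<Longrightarrow> \<bar>sdist l x\<bar> \<le> \<delta> \<Longrightarrow> \<psi> x = 0"
  shows "pairing (pw_const v) \<psi> \<le> gtv v"
proof -
  have \<psi>O: "\<psi> \<in> C1c_fields \<Omega>" and \<psi>1: "\<And>x. norm (\<psi> x) \<le> 1" using \<psi> unfolding unit_fields_def by auto
  obtain K where K: "compact K" "K \<subseteq> \<Omega>" "\<And>x. x \<notin> K \<Longrightarrow> \<psi> x = 0"
    using \<psi>O unfolding C1c_fields_iff by auto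
  \<comment> \<open>Half the width \<open>\<delta>\<close>, so that the supports for different hyperplanes are disjoint with room to spare.\<close>
  define \<eta> where "\<eta> h x = bump (\<delta> / 2) (sdist h x)" for h x
  have \<eta>C: "C1 (\<eta> h)" for h unfolding \<eta>_def sdist_def by (rule C1_bump_affine)
  have \<eta>01: "0 \<le> \<eta> h x" "\<eta> h x \<le> 1" for h x unfolding \<eta>_def using bump_range by auto
  define \<phi> where "\<phi> h x = \<eta> h x *\<^sub>R \<psi> x" for h x
  have \<phi>O: "\<phi> h \<in> C1c_fields \<Omega>" for h unfolding \<phi>_def by (rule C1c_fields_mult[OF \<eta>C \<psi>O])
  have closed_le: "closed {x. \<bar>sdist h x\<bar> \<le> r}" and closed_ge: "closed {x. r \<le> \<bar>sdist h x\<bar>}" for h r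
    by (intro closed_Collect_le continuous_intros sdist_cont)+
  \<comment> \<open>The support of the part near \<open>h\<close> keeps the distance \<open>\<delta>\<close> from all other hyperplanes, hence twice its distance from \<open>h\<close>.\<close>
  define F where "F h = K \<inter> {x. \<bar>sdist h x\<bar> \<le> \<delta> / 2} \<inter> (\<Inter>l\<in>H - {h}. {x. \<delta> \<le> \<bar>sdist l x\<bar>})" for h
  have Fc: "compact (F h)" for h
    unfolding F_def using K(1) by (intro compact_Int_closed closed_le closed_INT ballI closed_ge)
  have \<phi>F: "\<phi> h x = 0" if "h \<in> H" "x \<notin> F h" for h x
  proof (rule ccontr)
    assume a: "\<phi> h x \<noteq> 0"
    then have "\<psi> x \<noteq> 0" "\<eta> h x \<noteq> 0" unfolding \<phi>_def by auto
    then have "x \<in> K" "\<bar>sdist h x\<bar> \<le> \<delta> / 2" using K(3) bump_eq_0[of "\<delta> / 2" "sdist h x"] \<delta> unfolding \<eta>_def by force+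
    moreover have "\<delta> \<le> \<bar>sdist l x\<bar>" if "l \<in> H - {h}" for l
      using z[of h l x] that \<open>h \<in> H\<close> \<open>\<psi> x \<noteq> 0\<close> \<open>\<bar>sdist h x\<bar> \<le> \<delta> / 2\<close> \<delta> by force
    ultimately show False using that(2) unfolding F_def by blast
  qed
  define S where "S h \<sigma> = (\<Inter>l\<in>H - {h}. {x. 0 < side_sign \<sigma> l * sdist l x})" for h \<sigma>
  define S' where "S' h \<sigma> = (\<Union>l\<in>H - {h}. {x. side_sign \<sigma> l * sdist l x < 0})" for h \<sigma>
  have S: "open (S h \<sigma>)" "open (S' h \<sigma>)" for h \<sigma>
    unfolding S_def S'_def using H(1) by (auto intro!: open_INT open_Collect_less continuous_intros sdist_cont)
  have SS': "S h \<sigma> \<inter> S' h \<sigma> = {}" for h \<sigma> unfolding S_def S'_def by force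
  have FS: "F h \<subseteq> S h \<sigma> \<union> S' h \<sigma>" for h \<sigma>
  proof
    fix x assume "x \<in> F h"
    then have ge: "\<delta> \<le> \<bar>sdist l x\<bar>" if "l \<in> H - {h}" for l using that unfolding F_def by blast
    have nz: "side_sign \<sigma> l * sdist l x \<noteq> 0" if "l \<in> H - {h}" for l
      using \<delta> ge[OF that] unfolding side_sign_def by auto
    show "x \<in> S h \<sigma> \<union> S' h \<sigma>"
    proof (cases "x \<in> S' h \<sigma>")
      case False
      then have "0 < side_sign \<sigma> l * sdist l x" if "l \<in> H - {h}" for l
      proof -
        have "\<not> side_sign \<sigma> l * sdist l x < 0" using False that unfolding S'_def by blast
        then show ?thesis using nz[OF that] by linarith
      qed
      then show ?thesis unfolding S_def by blast
    qed simp
  qed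
  have FV: "F h \<inter> S h \<sigma> \<subseteq> edge_nbhd (h, \<sigma>)" for h \<sigma>
  proof
    fix x assume x: "x \<in> F h \<inter> S h \<sigma>"
    have "\<bar>sdist h x\<bar> < side_sign \<sigma> l * sdist l x" if "l \<in> H - {h}" for l
    proof -
      have "\<bar>sdist h x\<bar> \<le> \<delta> / 2" "\<delta> \<le> \<bar>sdist l x\<bar>" "0 < side_sign \<sigma> l * sdist l x" using x that unfolding F_def S_def by auto
      moreover have "\<bar>side_sign \<sigma> l * sdist l x\<bar> = \<bar>sdist l x\<bar>" unfolding side_sign_def by auto
      ultimately show ?thesis using \<delta> by linarith
    qed
    moreover have "x \<in> \<Omega>" using x K(2) unfolding F_def by blast
    ultimately show "x \<in> edge_nbhd (h, \<sigma>)" unfolding edge_nbhd_def by simp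
  qed
  define \<theta> where "\<theta> h \<sigma> x = indicat_real (S h \<sigma>) x *\<^sub>R \<phi> h x" for h \<sigma> x
  have \<theta>V: "\<theta> h \<sigma> \<in> unit_fields (edge_nbhd (h, \<sigma>))" if "h \<in> H" for h \<sigma>
  proof -
    have "\<theta> h \<sigma> \<in> C1c_fields (edge_nbhd (h, \<sigma>))"
      unfolding \<theta>_def by (rule C1c_fields_restrict[OF C1c_fields_C1[OF \<phi>O] Fc \<phi>F[OF that] S SS' FS FV])
    moreover have "norm (\<phi> h x) \<le> 1" for x
      unfolding \<phi>_def using \<eta>01[of h x] \<psi>1[of x] by (auto intro!: mult_le_one)
    then have "norm (\<theta> h \<sigma> x) \<le> 1" for x unfolding \<theta>_def by (simp add: indicator_def)
    ultimately show ?thesis unfolding unit_fields_def by simp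
  qed
  have \<theta>O: "\<theta> h \<sigma> \<in> C1c_fields \<Omega>" if "h \<in> H" for h \<sigma>
    using \<theta>V[OF that, of \<sigma>] C1c_fields_mono[OF _ edge_nbhd_subset] unfolding unit_fields_def by blast
  have \<phi>\<theta>: "\<phi> h x = (\<Sum>\<sigma>\<in>Pow (H - {h}). \<theta> h \<sigma> x)" if h: "h \<in> H" for h x
  proof (cases "\<phi> h x = 0")
    case True
    then show ?thesis unfolding \<theta>_def by simp
  next
    case False
    then have x: "x \<in> F h" using \<phi>F[OF h] by blast
    define \<tau> where "\<tau> = {l \<in> H - {h}. sdist l x > 0}"
    have ge: "\<delta> \<le> \<bar>sdist l x\<bar>" if "l \<in> H - {h}" for l using x that unfolding F_def by blast
    have nz: "sdist l x \<noteq> 0" if "l \<in> H - {h}" for l using ge[OF that] \<delta> by auto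
    have iff: "x \<in> S h \<sigma> \<longleftrightarrow> \<sigma> = \<tau>" if "\<sigma> \<in> Pow (H - {h})" for \<sigma>
    proof
      assume "x \<in> S h \<sigma>"
      then have "0 < side_sign \<sigma> l * sdist l x" if "l \<in> H - {h}" for l using that unfolding S_def by blast
      then have "l \<in> \<sigma> \<longleftrightarrow> sdist l x > 0" if "l \<in> H - {h}" for l using that unfolding side_sign_def by (fastforce split: if_splits)
      then show "\<sigma> = \<tau>" using \<open>\<sigma> \<in> Pow (H - {h})\<close> unfolding \<tau>_def by blast
    next
      assume "\<sigma> = \<tau>"
      then have "0 < side_sign \<sigma> l * sdist l x" if "l \<in> H - {h}" for l
        using nz[OF that] that unfolding side_sign_def \<tau>_def by auto
      then show "x \<in> S h \<sigma>" unfolding S_def by blast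
    qed
    have "(\<Sum>\<sigma>\<in>Pow (H - {h}). \<theta> h \<sigma> x) = (\<Sum>\<sigma>\<in>Pow (H - {h}). if \<sigma> = \<tau> then \<phi> h x else 0)"
      unfolding \<theta>_def using iff by (intro sum.cong) (auto simp: indicator_def)
    also have "\<dots> = \<phi> h x" using H(1) by (subst sum.delta) (auto simp: \<tau>_def)
    finally show ?thesis by simp
  qed
  have near: "pairing (pw_const v) (\<phi> h) \<le> (\<Sum>\<sigma>\<in>Pow (H - {h}). weight (h, \<sigma>) * \<bar>v (pos_cell (h, \<sigma>)) - v (neg_cell (h, \<sigma>))\<bar>)"
    if h: "h \<in> H" for h
  proof -
    have "pairing (pw_const v) (\<phi> h) = (\<Sum>\<sigma>\<in>Pow (H - {h}). pairing (pw_const v) (\<theta> h \<sigma>))"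
      unfolding \<phi>\<theta>[OF h, abs_def] 
      by (rule pairing_sum_field[OF bounded_measurable_pw_const _ \<theta>O[OF h]]) (use H(1) in auto)
    also have "\<dots> \<le> (\<Sum>\<sigma>\<in>Pow (H - {h}). weight (h, \<sigma>) * \<bar>v (pos_cell (h, \<sigma>)) - v (neg_cell (h, \<sigma>))\<bar>)"
      using h by (intro sum_mono pairing_le_weight \<theta>V) (auto simp: edges_def)
    finally show ?thesis .
  qed
  \<comment> \<open>What remains vanishes within \<open>\<delta> / 4\<close> of every hyperplane.\<close>
  define \<psi>0 where "\<psi>0 x = \<psi> x + (\<Sum>h\<in>H. - \<phi> h x)" for x
  have \<Sigma>\<phi>O: "(\<lambda>x. \<Sum>h\<in>H. \<phi> h x) \<in> C1c_fields \<Omega>" by (intro C1c_fields_sum \<phi>O)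
  have \<psi>0O: "\<psi>0 \<in> C1c_fields \<Omega>"
    unfolding \<psi>0_def by (intro C1c_fields_add C1c_fields_sum C1c_fields_uminus \<phi>O \<psi>O)
  define G where "G = K \<inter> (\<Inter>h\<in>H. {x. \<delta> / 4 \<le> \<bar>sdist h x\<bar>})"
  have Gc: "compact G" unfolding G_def using K(1) by (intro compact_Int_closed closed_INT ballI closed_ge)
  have \<psi>0G: "\<psi>0 x = 0" if "x \<notin> G" for x
  proof (cases "x \<in> K")
    case False
    then show ?thesis unfolding \<psi>0_def \<phi>_def using K(3) by simp
  next
    case True
    then obtain h where h: "h \<in> H" "\<bar>sdist h x\<bar> < \<delta> / 4" using \<open>x \<notin> G\<close> unfolding G_def by force
    show ?thesis
    proof (cases "\<psi> x = 0")
      case True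
      then show ?thesis unfolding \<psi>0_def \<phi>_def by simp
    next
      case False
      have "\<eta> l x = 0" if "l \<in> H" "l \<noteq> h" for l
      proof -
        have "\<bar>sdist l x\<bar> > \<delta>" using z[of h l x] h that False \<delta> by force
        then show ?thesis unfolding \<eta>_def using \<delta> by (intro bump_eq_0) auto
      qed
      moreover have "\<eta> h x = 1" unfolding \<eta>_def using h \<delta> by (intro bump_eq_1) auto
      ultimately have "(\<Sum>l\<in>H. - \<phi> l x) = (\<Sum>l\<in>H. if l = h then - \<psi> x else 0)"
        unfolding \<phi>_def by (intro sum.cong) auto
      also have "\<dots> = - \<psi> x" using H(1) h(1) by simp
      finally show ?thesis unfolding \<psi>0_def by simp
    qed
  qed
  define \<zeta> where "\<zeta> T x = indicat_real T x *\<^sub>R \<psi>0 x" for T x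
  have Gf: "sdist h x \<noteq> 0" if "x \<in> G" "h \<in> H" for x h using that \<delta> unfolding G_def by force
  have \<zeta>T: "\<zeta> T \<in> C1c_fields T" if T': "T \<in> \<T>" for T
    unfolding \<zeta>_def
  proof (rule C1c_fields_restrict[OF C1c_fields_C1[OF \<psi>0O] Gc \<psi>0G])
    show "open T" using T(4)[OF T'] .
    show "open (- closure T)" by (rule open_Compl[OF closed_closure])
    show "T \<inter> - closure T = {}" using closure_subset by blast
    show "G \<subseteq> T \<union> - closure T"
    proof
      fix x assume "x \<in> G"
      then have "x \<notin> frontier T" using Gf frontier_sdistD[OF T'] by blast
      then show "x \<in> T \<union> - closure T" unfolding frontier_def using T(4)[OF T'] by (auto simp: interior_open)
    qed
  qed auto
  have "\<psi>0 x = (\<Sum>T\<in>\<T>. \<zeta> T x)" for x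
  proof (cases "x \<in> G")
    case True
    then have "x \<in> \<Omega>" using K(2) unfolding G_def by blast
    then obtain T0 where T0: "T0 \<in> \<T>" "x \<in> T0" using in_cell Gf[OF True] by metis
    have "(\<Sum>T\<in>\<T>. \<zeta> T x) = (\<Sum>T\<in>\<T>. if T = T0 then \<psi>0 x else 0)"
      unfolding \<zeta>_def using T0 T(3) by (intro sum.cong) (auto simp: indicator_def pairwise_def disjnt_iff)
    then show ?thesis using T0 T(1) by simp
  qed (simp add: \<psi>0G \<zeta>_def)
  then have \<psi>0: "\<psi>0 = (\<lambda>x. \<Sum>T\<in>\<T>. \<zeta> T x)" by blast
  have \<zeta>O: "\<zeta> T \<in> C1c_fields \<Omega>" if "T \<in> \<T>" for T using C1c_fields_mono[OF \<zeta>T[OF that] T(5)[OF that]] .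
  have "pairing (pw_const v) \<psi>0 = (\<Sum>T\<in>\<T>. pairing (pw_const v) (\<zeta> T))"
    unfolding \<psi>0 by (rule pairing_sum_field[OF bounded_measurable_pw_const T(1) \<zeta>O])
  also have "\<dots> = 0"
  proof (rule sum.neutral, rule ballI)
    fix T assume T': "T \<in> \<T>"
    show "pairing (pw_const v) (\<zeta> T) = 0"
      by (rule pairing_ae_const[OF _ \<zeta>T[OF T'], of _ "v T"]) (simp add: ae_eq_def pw_const_eq[OF T'])
  qed
  finally have far: "pairing (pw_const v) \<psi>0 = 0" .
  have "\<psi> = (\<lambda>x. \<psi>0 x + (\<Sum>h\<in>H. \<phi> h x))" unfolding \<psi>0_def by (simp add: sum_negf)
  then have "pairing (pw_const v) \<psi> = pairing (pw_const v) \<psi>0 + pairing (pw_const v) (\<lambda>x. \<Sum>h\<in>H. \<phi> h x)"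
    using pairing_add_field[OF bounded_measurable_pw_const \<psi>0O \<Sigma>\<phi>O, of v] by simp
  also have "\<dots> = (\<Sum>h\<in>H. pairing (pw_const v) (\<phi> h))"
    using far pairing_sum_field[OF bounded_measurable_pw_const H(1) \<phi>O, of v] by simp
  also have "\<dots> \<le> (\<Sum>h\<in>H. \<Sum>\<sigma>\<in>Pow (H - {h}). weight (h, \<sigma>) * \<bar>v (pos_cell (h, \<sigma>)) - v (neg_cell (h, \<sigma>))\<bar>)"
    by (rule sum_mono[OF near])
  also have "\<dots> = gtv v"
    unfolding gtv_def edges_def using H(1) by (subst sum.Sigma) (auto simp: case_prod_beta)
  finally show ?thesis .
qed

text \<open>The jump formula without surface measure. It turns every statement about \<open>P0\<close> into one about finitely many
  coefficients.\<close>

lemma TV_pw_const: "TV (pw_const v) \<Omega> = ereal (gtv v)"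
proof (rule antisym)
  show "TV (pw_const v) \<Omega> \<le> ereal (gtv v)"
  proof (rule TV_leI)
    fix \<psi> assume \<psi>: "\<psi> \<in> unit_fields \<Omega>"
    define Q where "Q = {(h, l). h \<in> H \<and> l \<in> H \<and> h \<noteq> l}"
    have "Q \<subseteq> H \<times> H" unfolding Q_def by auto
    then have Q: "finite Q" using H(1) by (meson finite_SigmaI finite_subset)
    have "pairing (pw_const v) \<psi> \<le> gtv v + \<epsilon>" if eps: "\<epsilon> > 0" for \<epsilon>
    proof -
      have nm: "\<And>h l. (h, l) \<in> Q \<Longrightarrow> norm (n h) = 1 \<and> norm (n l) = 1 \<and> {x. n h \<bullet> x - c h = 0} \<noteq> {x. n l \<bullet> x - c l = 0}"
        using H(2) H_distinct unfolding Q_def by blast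
      from cut_off_near_hyperplane_pairs[where n=n and c=c, OF Q nm bounded_measurable_pw_const[of v] Omega(2) \<psi> eps]
      obtain \<phi> \<delta> where \<phi>: "\<phi> \<in> unit_fields \<Omega>" "\<bar>pairing (pw_const v) \<psi> - pairing (pw_const v) \<phi>\<bar> \<le> \<epsilon>" "\<delta> > 0"
        "\<forall>(h, l)\<in>Q. \<forall>x. \<bar>n h \<bullet> x - c h\<bar> \<le> \<delta> \<longrightarrow> \<bar>n l \<bullet> x - c l\<bar> \<le> \<delta> \<longrightarrow> \<phi> x = 0"
        by blast
      have "pairing (pw_const v) \<phi> \<le> gtv v"
        by (rule pairing_away_from_edges[OF \<phi>(1,3)]) (use \<phi>(4) in \<open>auto simp: Q_def sdist_def\<close>)
      then show ?thesis using \<phi>(2) by linarith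
    qed
    then have "pairing (pw_const v) \<psi> \<le> gtv v" by (rule field_le_epsilon)
    then show "ereal (pairing (pw_const v) \<psi>) \<le> ereal (gtv v)" by simp
  qed
qed (rule gtv_le_TV)

end

section \<open>Extremal points of the unit ball\<close>

text \<open>The condition on \<open>interior\<close> excludes slits: unions of closed cells must not swallow boundary points of \<open>\<Omega>\<close>.\<close>

locale triangulated_domain = hyperplane_partition \<Omega> \<T> H n c
  for \<Omega> :: "'a::euclidean_space set" and \<T> :: "'a set set"
    and H :: "'h set" and n :: "'h \<Rightarrow> 'a" and c :: "'h \<Rightarrow> real" +
  assumes conn: "connected \<Omega>"
    and T_conn: "\<And>T. T \<in> \<T> \<Longrightarrow> connected T"
    and T_ne: "\<And>T. T \<in> \<T> \<Longrightarrow> T \<noteq> {}"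
    and int_closure: "interior (\<Union>T\<in>\<T>. closure T) \<subseteq> \<Omega>"
begin

lemma T_unique: "T \<in> \<T> \<Longrightarrow> T' \<in> \<T> \<Longrightarrow> x \<in> T \<Longrightarrow> x \<in> T' \<Longrightarrow> T = T'"
  using T(3) unfolding pairwise_def disjnt_iff by blast

lemma T_not_negligible: "T \<in> \<T> \<Longrightarrow> \<not> negligible T"
  using open_not_negligible[of T] T(4) T_ne by blast

lemma T_lmeasurable: "T \<in> \<T> \<Longrightarrow> T \<in> lmeasurable"
  using T(4,5) Omega(2) bounded_subset lmeasurable_open by metis

lemma AE_in_T: "AE x in lebesgue. x \<in> \<Omega> \<longrightarrow> x \<in> \<Union>\<T>"
proof -
  have "negligible (\<Union>h\<in>H. {x. sdist h x = 0})"
    using H(1) sdist_zero_negligible by (intro negligible_Union) auto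
  moreover have "\<Omega> - \<Union>\<T> \<subseteq> (\<Union>h\<in>H. {x. sdist h x = 0})"
  proof
    fix x assume "x \<in> \<Omega> - \<Union>\<T>"
    then show "x \<in> (\<Union>h\<in>H. {x. sdist h x = 0})" using in_cell[of x] by blast
  qed
  ultimately have "negligible (\<Omega> - \<Union>\<T>)" by (rule negligible_subset)
  then have "AE x in lebesgue. x \<notin> \<Omega> - \<Union>\<T>" by (intro AE_not_in) (simp add: negligible_iff_null_sets)
  then show ?thesis by eventually_elim auto
qed

lemma ae_eqI:
  assumes "\<And>T. T \<in> \<T> \<Longrightarrow> ae_eq T u (\<lambda>_. v T)"
  shows "ae_eq \<Omega> u (pw_const v)"
proof -
  have "AE x in lebesgue. \<forall>T\<in>\<T>. x \<in> T \<longrightarrow> u x = v T"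
    by (rule AE_finite_allI[OF T(1)]) (rule assms[unfolded ae_eq_def])
  with AE_in_T show ?thesis unfolding ae_eq_def
  proof eventually_elim
    case (elim x)
    show ?case
    proof
      assume "x \<in> \<Omega>"
      with elim(1) obtain T where T': "T \<in> \<T>" "x \<in> T" by blast
      with elim(2) show "u x = pw_const v x" using pw_const_eq[OF T', of v] by simp
    qed
  qed
qed

lemma ae_eq_pw_const_D:
  assumes "ae_eq \<Omega> (pw_const v) (pw_const v')" "T \<in> \<T>" shows "v T = v' T"
proof (rule ccontr)
  assume ne: "v T \<noteq> v' T"
  have "AE x in lebesgue. x \<notin> T"
    using assms(1) unfolding ae_eq_def
  proof eventually_elim
    case (elim x)
    then show ?case
      using ne T(5)[OF assms(2)] pw_const_eq[OF assms(2), of x v] pw_const_eq[OF assms(2), of x v'] by auto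
  qed
  then have "negligible T"
    using AE_iff_null_sets[of T lebesgue] T(4)[OF assms(2)] by (simp add: negligible_iff_null_sets)
  with T_not_negligible[OF assms(2)] show False by simp
qed

lemma pw_const_cong: "(\<And>T. T \<in> \<T> \<Longrightarrow> v T = v' T) \<Longrightarrow> pw_const v = pw_const v'"
  unfolding pw_const_def by auto

lemma ae_eq_trans: "ae_eq S u v \<Longrightarrow> ae_eq S v z \<Longrightarrow> ae_eq S u z"
  unfolding ae_eq_def by (auto elim: AE_mp)

lemma ae_eq_sym: "ae_eq S u v \<Longrightarrow> ae_eq S v u"
  unfolding ae_eq_def by (auto elim: AE_mp)

lemma P0_iff: "u \<in> P0 \<Omega> \<T> \<longleftrightarrow> (\<exists>v. ae_eq \<Omega> u (pw_const v))"
proof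
  assume "u \<in> P0 \<Omega> \<T>"
  then obtain g where g: "\<And>T. T \<in> \<T> \<Longrightarrow> g constant_on T" "ae_eq \<Omega> u g" unfolding P0_def by auto
  obtain v where "\<And>T x. T \<in> \<T> \<Longrightarrow> x \<in> T \<Longrightarrow> g x = v T" using g(1) unfolding constant_on_def by metis
  then have "ae_eq \<Omega> g (pw_const v)" by (intro ae_eqI) (auto simp: ae_eq_def)
  with g(2) show "\<exists>v. ae_eq \<Omega> u (pw_const v)" using ae_eq_trans by blast
next
  assume "\<exists>v. ae_eq \<Omega> u (pw_const v)"
  then show "u \<in> P0 \<Omega> \<T>" unfolding P0_def constant_on_def using pw_const_eq by blast
qed

definition vol :: "'a set \<Rightarrow> real" where "vol T = measure lebesgue T"

lemma vol_pos: "T \<in> \<T> \<Longrightarrow> vol T > 0"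
  using T_not_negligible T_lmeasurable unfolding vol_def by (metis negligible_iff_measure zero_less_measure_iff)

lemma integral_pw_const:
  assumes "ae_eq \<Omega> u (pw_const v)"
  shows "(LINT x:\<Omega>|lebesgue. u x) = (\<Sum>T\<in>\<T>. v T * vol T)"
proof -
  have z: "pw_const v x = 0" if "x \<notin> \<Omega>" for x
    using that T(5) unfolding pw_const_def by (intro sum.neutral) (auto simp: indicator_def)
  have "(LINT x:\<Omega>|lebesgue. u x) = (LINT x|lebesgue. pw_const v x)"
    unfolding set_lebesgue_integral_def
  proof (rule integral_lebesgue_cong_AE)
    have "AE x in lebesgue. x \<in> \<Omega> \<longrightarrow> u x = pw_const v x" using assms unfolding ae_eq_def .
    then show "AE x in lebesgue. indicat_real \<Omega> x *\<^sub>R u x = pw_const v x"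
      by eventually_elim (use z in \<open>auto simp: indicator_def\<close>)
  qed
  also have "\<dots> = (\<Sum>T\<in>\<T>. v T * vol T)"
  proof -
    have i: "integrable lebesgue (indicat_real T)" if "T \<in> \<T>" for T
      using T_lmeasurable[OF that] by (intro integrable_real_indicator) (auto simp: fmeasurable_def)
    have "(LINT x|lebesgue. pw_const v x) = (\<Sum>T\<in>\<T>. LINT x|lebesgue. v T * indicator T x)"
      unfolding pw_const_def by (rule Bochner_Integration.integral_sum) (use i in auto)
    then show ?thesis unfolding vol_def by simp
  qed
  finally show ?thesis .
qed

definition total_vol :: real where "total_vol = (\<Sum>T\<in>\<T>. vol T)"

lemma measure_Omega: "measure lebesgue \<Omega> = total_vol"
proof -
  have "ae_eq \<Omega> (\<lambda>_. 1) (pw_const (\<lambda>_. 1))" by (rule ae_eqI) (simp add: ae_eq_def)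
  from integral_pw_const[OF this] have "(LINT x:\<Omega>|lebesgue. 1) = total_vol" unfolding total_vol_def by simp
  then show ?thesis unfolding set_lebesgue_integral_def by simp
qed

lemma total_vol_pos: "total_vol > 0"
  unfolding total_vol_def using T(1,2) vol_pos by (intro sum_pos) auto

definition mean :: "('a set \<Rightarrow> real) \<Rightarrow> real" where "mean v = (\<Sum>T\<in>\<T>. v T * vol T) / total_vol"

lemma avg_eq: "ae_eq \<Omega> u (pw_const v) \<Longrightarrow> avg \<Omega> u = mean v"
  unfolding avg_def mean_def by (simp add: integral_pw_const measure_Omega)

lemma mean_affine: "mean (\<lambda>T. a * v T + b) = a * mean v + b"
proof -
  have "(\<Sum>T\<in>\<T>. (a * v T + b) * vol T) = a * (\<Sum>T\<in>\<T>. v T * vol T) + b * total_vol"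
    unfolding total_vol_def by (simp add: distrib_right sum.distrib sum_distrib_left mult.assoc)
  then show ?thesis unfolding mean_def using total_vol_pos by (simp add: add_divide_distrib)
qed

lemma mean_cong: "(\<And>T. T \<in> \<T> \<Longrightarrow> v T = v' T) \<Longrightarrow> mean v = mean v'"
  unfolding mean_def by (simp cong: sum.cong)

lemma mean_add: "mean (\<lambda>T. v T + v' T) = mean v + mean v'"
  unfolding mean_def by (simp add: distrib_right sum.distrib add_divide_distrib)

lemma gtv_affine: "gtv (\<lambda>T. a * v T + b) = \<bar>a\<bar> * gtv v"
  unfolding gtv_def by (simp add: sum_distrib_left abs_mult mult.left_commute flip: right_diff_distrib)

lemma gtv_cong: "(\<And>T. T \<in> \<T> \<Longrightarrow> v T = v' T) \<Longrightarrow> gtv v = gtv v'"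
  unfolding gtv_def using ends(1,2) by (intro sum.cong) auto

lemma gtv_nonneg: "0 \<le> gtv v"
  unfolding gtv_def using weight_nonneg by (intro sum_nonneg) auto

definition ind :: "'a set set \<Rightarrow> 'a set \<Rightarrow> real" where "ind F T = of_bool (T \<in> F)"

lemma pw_const_ind: "F \<subseteq> \<T> \<Longrightarrow> pw_const (ind F) = indicat_real (\<Union>F)"
proof
  fix x assume F: "F \<subseteq> \<T>"
  show "pw_const (ind F) x = indicat_real (\<Union>F) x"
  proof (cases "\<exists>T\<in>\<T>. x \<in> T")
    case True
    then obtain T where T': "T \<in> \<T>" "x \<in> T" by blast
    have "x \<in> \<Union>F \<longleftrightarrow> T \<in> F" using T' F T_unique[OF _ T'(1) _ T'(2)] by blast
    then show ?thesis using pw_const_eq[OF T'] unfolding ind_def by (simp add: indicator_def)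
  next
    case False
    then have "x \<notin> \<Union>F" using F by blast
    moreover have "pw_const (ind F) x = 0" using False unfolding pw_const_def by (intro sum.neutral) auto
    ultimately show ?thesis by simp
  qed
qed

text \<open>Connectedness of \<open>\<Omega>\<close> enters here. A sublevel set of \<open>v\<close> would be a set of zero perimeter
  in \<open>\<Omega>\<close>, hence trivial by the constancy theorem.\<close>

lemma gtv_zero_imp_constant:
  assumes "gtv v = 0" "T1 \<in> \<T>" "T2 \<in> \<T>" shows "v T1 = v T2"
proof -
  have le: "v T2 \<le> v T1" if T12: "T1 \<in> \<T>" "T2 \<in> \<T>" for T1 T2
  proof (rule ccontr)
    assume lt: "\<not> v T2 \<le> v T1"
    define F where "F = {T \<in> \<T>. v T \<le> v T1}"
    have F: "F \<subseteq> \<T>" unfolding F_def by blast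
    have "weight e * \<bar>v (pos_cell e) - v (neg_cell e)\<bar> = 0" if "e \<in> edges" for e
      using assms(1) that finite_edges weight_nonneg unfolding gtv_def
      by (subst (asm) sum_nonneg_eq_0_iff) auto
    then have "weight e * \<bar>ind F (pos_cell e) - ind F (neg_cell e)\<bar> = 0" if "e \<in> edges" for e
      using that ends(1,2)[OF that] unfolding ind_def F_def by fastforce
    then have "gtv (ind F) = 0" unfolding gtv_def by (intro sum.neutral) blast
    then have TV0: "TV (indicat_real (\<Union>F)) \<Omega> = 0" using TV_pw_const[of "ind F"] unfolding pw_const_ind[OF F] by (simp add: zero_ereal_def)
    have meas: "\<Union>F \<in> sets lebesgue" using F T(4) by (intro sets_completionI_sets) (auto intro!: borel_open open_Union)
    have "negligible (\<Union>F \<inter> \<Omega>) \<or> negligible (\<Omega> - \<Union>F)"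
    proof (rule divergence_free_indicator_trivial[OF meas Omega(1) conn])
      fix \<phi> assume \<phi>: "\<phi> \<in> C1c_fields \<Omega>"
      have "pairing (indicat_real (\<Union>F)) \<psi> \<le> 0" if "\<psi> \<in> unit_fields \<Omega>" for \<psi>
        using pairing_le_TV[OF that, of "indicat_real (\<Union>F)"] unfolding TV0 by simp
      from pairing_eq_0_if_nonpos[OF this \<phi>]
      show "(LINT x|lebesgue. indicator (\<Union>F) x * divergence \<phi> x) = 0" unfolding pairing_def .
    qed
    moreover have T1F: "T1 \<in> F" and T2F: "T2 \<notin> F" using T12 lt unfolding F_def by auto
    moreover have "T1 \<subseteq> \<Union>F \<inter> \<Omega>" using T1F T(5)[OF T12(1)] by blast
    moreover have "T2 \<subseteq> \<Omega> - \<Union>F"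
    proof
      fix x assume x: "x \<in> T2"
      have "x \<notin> \<Union>F" using T_unique[OF T12(2) _ x] T2F F by blast
      then show "x \<in> \<Omega> - \<Union>F" using x T(5)[OF T12(2)] by blast
    qed
    ultimately show False using T_not_negligible[OF T12(1)] T_not_negligible[OF T12(2)] negligible_subset by metis
  qed
  show ?thesis using le[OF assms(2,3)] le[OF assms(3,2)] by simp
qed

text \<open>The unit ball and its extremal points, transported to the coefficients of piecewise constant functions.\<close>

definition in_ball :: "('a set \<Rightarrow> real) \<Rightarrow> bool" where "in_ball v \<longleftrightarrow> mean v = 0 \<and> gtv v \<le> 1"

definition extremal :: "('a set \<Rightarrow> real) \<Rightarrow> bool" where
  "extremal v \<longleftrightarrow> in_ball v \<and> (\<forall>s v1 v2. 0 < s \<and> s < 1 \<and> in_ball v1 \<and> in_ball v2 \<and>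
     (\<forall>T\<in>\<T>. v T = (1 - s) * v1 T + s * v2 T) \<longrightarrow> (\<forall>T\<in>\<T>. v1 T = v2 T))"

lemma extremalD:
  "extremal v \<Longrightarrow> 0 < s \<Longrightarrow> s < 1 \<Longrightarrow> in_ball v1 \<Longrightarrow> in_ball v2 \<Longrightarrow>
     (\<And>T. T \<in> \<T> \<Longrightarrow> v T = (1 - s) * v1 T + s * v2 T) \<Longrightarrow> T \<in> \<T> \<Longrightarrow> v1 T = v2 T"
  unfolding extremal_def by blast

lemma extremal_cong:
  assumes v: "extremal v" and eq: "\<And>T. T \<in> \<T> \<Longrightarrow> v' T = v T"
  shows "extremal v'"
  unfolding extremal_def
proof (intro conjI allI impI ballI; (elim conjE)?)
  show "in_ball v'" using v mean_cong[OF eq] gtv_cong[OF eq] unfolding extremal_def in_ball_def by simp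
  fix s v1 v2 T
  assume s: "0 < s" "s < 1" "in_ball v1" "in_ball v2" "\<forall>T\<in>\<T>. v' T = (1 - s) * v1 T + s * v2 T" and T': "T \<in> \<T>"
  have "v T = (1 - s) * v1 T + s * v2 T" if "T \<in> \<T>" for T using s(5) eq[OF that] that by simp
  from extremalD[OF v s(1-4) this T'] show "v1 T = v2 T" .
qed

lemma unit_ball_iff: "u \<in> unit_ball_P0 \<Omega> \<T> \<longleftrightarrow> (\<exists>v. ae_eq \<Omega> u (pw_const v) \<and> in_ball v)"
  unfolding unit_ball_P0_def P0_centred_def mem_Collect_eq P0_iff in_ball_def
  by (auto simp: avg_eq TV_cong_AE TV_pw_const one_ereal_def)

text \<open>Equality almost everywhere on \<open>\<Omega>\<close> is equality of the coefficients, because every cell has positive volume.\<close>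

lemma extremal_iff:
  "u \<in> extremal_points \<Omega> (unit_ball_P0 \<Omega> \<T>) \<longleftrightarrow> (\<exists>v. ae_eq \<Omega> u (pw_const v) \<and> extremal v)"
proof -
  have comb: "(\<lambda>x. a * pw_const v1 x + b * pw_const v2 x) = pw_const (\<lambda>T. a * v1 T + b * v2 T)" for a b v1 v2
    unfolding pw_const_def by (simp add: fun_eq_iff sum_distrib_left sum.distrib algebra_simps)
  show ?thesis
  proof
    assume u: "u \<in> extremal_points \<Omega> (unit_ball_P0 \<Omega> \<T>)"
    then obtain v where v: "ae_eq \<Omega> u (pw_const v)" "in_ball v"
      unfolding extremal_points_def unit_ball_iff by blast
    have "extremal v" unfolding extremal_def
    proof (intro conjI allI impI ballI v(2); elim conjE)
      fix s v1 v2 T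
      assume s: "0 < s" "s < 1" "in_ball v1" "in_ball v2" "\<forall>T\<in>\<T>. v T = (1 - s) * v1 T + s * v2 T" and T': "T \<in> \<T>"
      have "pw_const v = (\<lambda>x. (1 - s) * pw_const v1 x + s * pw_const v2 x)"
        unfolding comb by (rule pw_const_cong) (use s in auto)
      then have "ae_eq \<Omega> u (\<lambda>x. (1 - s) * pw_const v1 x + s * pw_const v2 x)" using v(1) by simp
      moreover have "pw_const v1 \<in> unit_ball_P0 \<Omega> \<T>" "pw_const v2 \<in> unit_ball_P0 \<Omega> \<T>"
        unfolding unit_ball_iff using s(3,4) by (auto simp: ae_eq_def)
      ultimately have "ae_eq \<Omega> (pw_const v1) (pw_const v2)"
        using u s(1,2) unfolding extremal_points_def by blast
      then show "v1 T = v2 T" using T' by (rule ae_eq_pw_const_D)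
    qed
    with v(1) show "\<exists>v. ae_eq \<Omega> u (pw_const v) \<and> extremal v" by blast
  next
    assume "\<exists>v. ae_eq \<Omega> u (pw_const v) \<and> extremal v"
    then obtain v where v: "ae_eq \<Omega> u (pw_const v)" "extremal v" by blast
    have "ae_eq \<Omega> u1 u2" if s: "0 < s" "s < 1" and u12: "u1 \<in> unit_ball_P0 \<Omega> \<T>" "u2 \<in> unit_ball_P0 \<Omega> \<T>"
      and eq: "ae_eq \<Omega> u (\<lambda>x. (1 - s) * u1 x + s * u2 x)" for s u1 u2
    proof -
      obtain v1 v2 where v12: "ae_eq \<Omega> u1 (pw_const v1)" "in_ball v1" "ae_eq \<Omega> u2 (pw_const v2)" "in_ball v2"
        using u12 unfolding unit_ball_iff by blast
      have "AE x in lebesgue. x \<in> \<Omega> \<longrightarrow> pw_const v x = (1 - s) * pw_const v1 x + s * pw_const v2 x"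
        using v(1) v12(1,3) eq unfolding ae_eq_def by eventually_elim auto
      then have "ae_eq \<Omega> (pw_const v) (pw_const (\<lambda>T. (1 - s) * v1 T + s * v2 T))"
        unfolding ae_eq_def comb[symmetric] .
      then have "v T = (1 - s) * v1 T + s * v2 T" if "T \<in> \<T>" for T using that by (rule ae_eq_pw_const_D)
      then have "v1 T = v2 T" if "T \<in> \<T>" for T using extremalD[OF v(2) s v12(2,4)] that by blast
      then have "pw_const v1 = pw_const v2" by (rule pw_const_cong)
      then show ?thesis using v12(1,3) ae_eq_trans ae_eq_sym by metis
    qed
    moreover have "u \<in> unit_ball_P0 \<Omega> \<T>" using v unfolding unit_ball_iff extremal_def by blast
    ultimately show "u \<in> extremal_points \<Omega> (unit_ball_P0 \<Omega> \<T>)"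
      unfolding extremal_points_def by blast
  qed
qed

text \<open>The coefficients of the centred indicator of \<open>\<Union>F\<close>, divided by the perimeter.\<close>

definition unit_ind :: "'a set set \<Rightarrow> 'a set \<Rightarrow> real" where
  "unit_ind F T = (ind F T - mean (ind F)) / gtv (ind F)"

lemma unit_ind_affine: "unit_ind F = (\<lambda>T. 1 / gtv (ind F) * ind F T + - mean (ind F) / gtv (ind F))"
  unfolding unit_ind_def by (simp add: fun_eq_iff diff_divide_distrib)

lemma in_ball_unit_ind: "gtv (ind F) > 0 \<Longrightarrow> in_ball (unit_ind F)"
  unfolding in_ball_def unit_ind_affine mean_affine gtv_affine by simp

lemma gtv_ind_pos:
  assumes "F \<subseteq> \<T>" "T1 \<in> F" "T2 \<in> \<T> - F" shows "gtv (ind F) > 0"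
proof (rule ccontr)
  assume "\<not> ?thesis"
  then have "gtv (ind F) = 0" using gtv_nonneg[of "ind F"] by simp
  then have "ind F T1 = ind F T2" using assms by (intro gtv_zero_imp_constant) auto
  then show False using assms unfolding ind_def by auto
qed

lemma mean_ind_less_1:
  assumes "F \<subseteq> \<T>" "T2 \<in> \<T> - F" shows "mean (ind F) < 1"
proof -
  have "(\<Sum>T\<in>\<T>. ind F T * vol T) < total_vol"
    unfolding total_vol_def using T(1) assms vol_pos
    by (intro sum_strict_mono_ex1) (auto simp: ind_def less_imp_le intro!: bexI[of _ T2])
  then show ?thesis unfolding mean_def using total_vol_pos by simp
qed

lemma mean_ind_nonneg: "0 \<le> mean (ind F)"
  unfolding mean_def using vol_pos total_vol_pos by (intro divide_nonneg_pos sum_nonneg) (auto simp: ind_def less_imp_le)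

lemma extremal_uminus: "extremal v \<Longrightarrow> extremal (\<lambda>T. - v T)"
proof -
  assume v: "extremal v"
  have b: "in_ball (\<lambda>T. - z T)" if "in_ball z" for z
    using that mean_affine[of "-1" z 0] gtv_affine[of "-1" z 0] unfolding in_ball_def by simp
  show ?thesis unfolding extremal_def
  proof (intro conjI allI impI ballI; (elim conjE)?)
    show "in_ball (\<lambda>T. - v T)" using v b unfolding extremal_def by blast
    fix s v1 v2 T
    assume s: "0 < s" "s < 1" "in_ball v1" "in_ball v2" "\<forall>T\<in>\<T>. - v T = (1 - s) * v1 T + s * v2 T" and T': "T \<in> \<T>"
    have "v T = (1 - s) * - v1 T + s * - v2 T" if "T \<in> \<T>" for T
    proof -
      have "- v T = (1 - s) * v1 T + s * v2 T" using s(5) that by blast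
      then show ?thesis by (simp add: algebra_simps)
    qed
    from extremalD[OF v s(1,2) b[OF s(3)] b[OF s(4)] this T'] show "v1 T = v2 T" by simp
  qed
qed

text \<open>A nonzero element of norm less than one lies inside a segment from the origin to another element. The origin is the
  midpoint of a non-constant element and its negative; such an element exists because there are two cells.\<close>

lemma extremal_gtv:
  assumes card: "card \<T> \<ge> 2" and v: "extremal v"
  shows "gtv v = 1"
proof (rule ccontr)
  assume ne: "gtv v \<noteq> 1"
  have vb: "mean v = 0" "gtv v \<le> 1" using v unfolding extremal_def in_ball_def by auto
  with ne have lt: "gtv v < 1" by simp
  have zero: "in_ball (\<lambda>_. 0)" using mean_affine[of 0 v 0] gtv_affine[of 0 v 0] unfolding in_ball_def by simp
  show False
  proof (cases "\<forall>T\<in>\<T>. v T = 0")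
    case True
    obtain T1 T2 where T12: "T1 \<in> \<T>" "T2 \<in> \<T>" "T1 \<noteq> T2"
      using card T(1) by (metis One_nat_def card_le_Suc0_iff_eq not_less_eq_eq numeral_2_eq_2)
    have pos: "gtv (ind {T1}) > 0" using T12 by (intro gtv_ind_pos[of _ T1 T2]) auto
    have "in_ball (\<lambda>T. - unit_ind {T1} T)"
      using in_ball_unit_ind[OF pos] mean_affine[of "-1" "unit_ind {T1}" 0] gtv_affine[of "-1" "unit_ind {T1}" 0] unfolding in_ball_def by simp
    from extremalD[OF v _ _ in_ball_unit_ind[OF pos] this, of "1/2"] True T12
    have "unit_ind {T1} T1 = 0" "unit_ind {T1} T2 = 0" by force+
    then show False using pos T12 unfolding unit_ind_def ind_def by simp
  next
    case False
    define s where "s = max (gtv v) (1/2)"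
    have s: "0 < s" "s < 1" "gtv v \<le> s" unfolding s_def using lt by auto
    have "in_ball (\<lambda>T. 1 / s * v T + 0)" unfolding in_ball_def mean_affine gtv_affine using vb s by simp
    from extremalD[OF v s(1,2) zero this] s have "\<And>T. T \<in> \<T> \<Longrightarrow> v T = 0" by simp
    with False show False by blast
  qed
qed

text \<open>The coarea formula in the form needed here: truncating from above and from below at the same level splits
  the variation additively.\<close>

lemma gtv_truncate: "gtv (\<lambda>T. min (v T) b) + gtv (\<lambda>T. max (v T) b) = gtv v"
  unfolding gtv_def sum.distrib[symmetric] distrib_left[symmetric]
  by (intro sum.cong refl arg_cong2[where f="(*)"]) (auto simp: min_def max_def abs_if)

text \<open>If \<open>v\<close> had a value \<open>b\<close> strictly between two others, the truncations of \<open>v\<close> at \<open>b\<close> would both be non-constant and,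
  centred and normalised, would exhibit \<open>v\<close> as a convex combination. They differ, since only the upper truncation
  separates \<open>b\<close> from the larger value.\<close>

lemma extremal_two_values:
  assumes v: "extremal v" "gtv v = 1" and T': "Ta \<in> \<T>" "Tb \<in> \<T>" "Tc \<in> \<T>"
  shows "\<not> (v Ta < v Tb \<and> v Tb < v Tc)"
proof
  assume lt: "v Ta < v Tb \<and> v Tb < v Tc"
  define b where "b = v Tb"
  define z1 where "z1 = (\<lambda>T. min (v T) b)"
  define z2 where "z2 = (\<lambda>T. max (v T) b)"
  have "gtv z1 \<noteq> 0" using gtv_zero_imp_constant[of z1 Ta Tb] T' lt unfolding z1_def b_def by auto
  then have p1: "gtv z1 > 0" using gtv_nonneg[of z1] by simp
  have "gtv z2 \<noteq> 0" using gtv_zero_imp_constant[of z2 Tb Tc] T' lt unfolding z2_def b_def by auto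
  then have p2: "gtv z2 > 0" using gtv_nonneg[of z2] by simp
  have sum: "gtv z1 + gtv z2 = 1" using gtv_truncate[of v b] v(2) unfolding z1_def z2_def by simp
  have b: "in_ball (\<lambda>T. 1 / gtv z * z T + - mean z / gtv z)" if "gtv z > 0" for z
    unfolding in_ball_def mean_affine gtv_affine using that by simp
  have avv: "mean v = 0" using v(1) unfolding extremal_def in_ball_def by simp
  have "(\<lambda>T. z1 T + z2 T) = (\<lambda>T. 1 * v T + b)" unfolding z1_def z2_def by (auto simp: min_def max_def)
  then have avs: "mean z1 + mean z2 = b" using mean_add[of z1 z2] mean_affine[of 1 v b] avv by simp
  have eq: "v T = (1 - gtv z2) * (1 / gtv z1 * z1 T + - mean z1 / gtv z1) + gtv z2 * (1 / gtv z2 * z2 T + - mean z2 / gtv z2)" for T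
  proof -
    have 1: "1 - gtv z2 = gtv z1" using sum by simp
    have "(1 - gtv z2) * (1 / gtv z1 * z1 T + - mean z1 / gtv z1) = z1 T - mean z1"
      unfolding 1 using p1 by (simp add: field_simps)
    moreover have "gtv z2 * (1 / gtv z2 * z2 T + - mean z2 / gtv z2) = z2 T - mean z2"
      using p2 by (simp add: field_simps)
    moreover have "z1 T + z2 T = v T + b" unfolding z1_def z2_def by (auto simp: min_def max_def)
    ultimately show ?thesis using avs by simp
  qed
  have "gtv z2 < 1" using sum p1 by simp
  from extremalD[OF v(1) p2 this b[OF p1] b[OF p2] eq]
  have "1 / gtv z1 * z1 Tb + - mean z1 / gtv z1 = 1 / gtv z2 * z2 Tb + - mean z2 / gtv z2"
    "1 / gtv z1 * z1 Tc + - mean z1 / gtv z1 = 1 / gtv z2 * z2 Tc + - mean z2 / gtv z2" using T' by auto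
  moreover have "z1 Tb = z1 Tc" unfolding z1_def b_def using lt by simp
  ultimately have "1 / gtv z2 * z2 Tb = 1 / gtv z2 * z2 Tc" by simp
  then have "z2 Tb = z2 Tc" using p2 by simp
  then show False unfolding z2_def b_def using lt by simp
qed

lemma extremal_imp_unit_ind:
  assumes card: "card \<T> \<ge> 2" and v: "extremal v"
  obtains F where "F \<subseteq> \<T>" "gtv (ind F) > 0" "\<And>T. T \<in> \<T> \<Longrightarrow> v T = unit_ind F T"
proof -
  have tv1: "gtv v = 1" by (rule extremal_gtv[OF card v])
  define a where "a = Min (v ` \<T>)"
  define b where "b = Max (v ` \<T>)"
  have "a \<in> v ` \<T>" "b \<in> v ` \<T>" unfolding a_def b_def using T(1,2) by (intro Min_in Max_in; simp)+
  then obtain Ta Tb where Tab: "Ta \<in> \<T>" "v Ta = a" "Tb \<in> \<T>" "v Tb = b" by blast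
  have ab: "a \<le> v T" "v T \<le> b" if "T \<in> \<T>" for T unfolding a_def b_def using T(1) that by auto
  define F where "F = {T \<in> \<T>. v T = b}"
  have val: "v T = (b - a) * ind F T + a" if "T \<in> \<T>" for T
  proof (cases "v T = b")
    case True
    then show ?thesis using that unfolding F_def ind_def by simp
  next
    case False
    then have "v T = a" using extremal_two_values[OF v tv1 Tab(1) that Tab(3)] ab[OF that] Tab by force
    then show ?thesis using False unfolding F_def ind_def by simp
  qed
  have "gtv v = \<bar>b - a\<bar> * gtv (ind F)" using gtv_cong[OF val] gtv_affine by simp
  moreover have "\<bar>b - a\<bar> = b - a" using ab[OF Tab(1)] by simp
  ultimately have 1: "(b - a) * gtv (ind F) = 1" using tv1 by simp
  then have "gtv (ind F) \<noteq> 0" by auto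
  then have pos: "gtv (ind F) > 0" using gtv_nonneg[of "ind F"] by simp
  have ba: "b - a = 1 / gtv (ind F)" using 1 pos by (simp add: field_simps)
  have "mean v = 0" using v unfolding extremal_def in_ball_def by simp
  then have "(b - a) * mean (ind F) + a = 0" using mean_cong[OF val] mean_affine by simp
  then have a: "a = - ((b - a) * mean (ind F))" by simp
  have "v T = unit_ind F T" if "T \<in> \<T>" for T
  proof -
    have "v T = (b - a) * ind F T - (b - a) * mean (ind F)" using val[OF that] a by linarith
    also have "\<dots> = unit_ind F T" unfolding unit_ind_def ba by (simp add: diff_divide_distrib)
    finally show ?thesis .
  qed
  with pos show thesis by (intro that[of F]) (auto simp: F_def)
qed

lemma Per_eq: "ae_eq \<Omega> (indicat_real E) (pw_const v) \<Longrightarrow> Per E \<Omega> = ereal (gtv v)"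
  unfolding Per_def by (simp add: TV_cong_AE TV_pw_const)

text \<open>The two parts of a decomposition are arbitrary measurable sets, but by additivity of the perimeter they are trivial
  in each cell, that is, unions of cells up to null sets. Their normalised centred indicators then
  give a convex combination, with different end points: at a cell of the first part the one is positive and the
  other is not.\<close>

lemma extremal_imp_indecomposable:
  assumes F: "F \<subseteq> \<T>" "gtv (ind F) > 0" and v: "extremal (unit_ind F)"
    and E: "E \<in> sets lebesgue" "E \<subseteq> \<Omega>" "ae_eq \<Omega> (indicat_real E) (pw_const (ind F))"
  shows "indecomposable \<Omega> E"
proof -
  have PerE: "Per E \<Omega> = ereal (gtv (ind F))" using E(3) by (rule Per_eq)
  have "\<not> decomposable \<Omega> E"
  proof
    assume "decomposable \<Omega> E"
    then obtain E1 E2 where E12: "E1 \<in> sets lebesgue" "E2 \<in> sets lebesgue" "E1 \<subseteq> \<Omega>" "E2 \<subseteq> \<Omega>"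
      "E1 \<inter> E2 = {}" "emeasure lebesgue E1 > 0" "emeasure lebesgue E2 > 0"
      "sym_diff E (E1 \<union> E2) \<in> null_sets lebesgue" and P: "Per E \<Omega> = Per E1 \<Omega> + Per E2 \<Omega>"
      unfolding decomposable_def by blast
    have constE: "ae_eq T (indicat_real E) (\<lambda>_. ind F T)" if "T \<in> \<T>" for T
    proof -
      have "AE x in lebesgue. x \<in> \<Omega> \<longrightarrow> indicat_real E x = pw_const (ind F) x" using E(3) unfolding ae_eq_def .
      then show ?thesis unfolding ae_eq_def
        by eventually_elim (use that T(5)[OF that] pw_const_eq[OF that, of _ "ind F"] in auto)
    qed
    have fin: "Per E \<Omega> < \<infinity>" unfolding PerE by simp
    have triv1: "negligible (E1 \<inter> T) \<or> negligible (T - E1)" if "T \<in> \<T>" for T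
      by (rule additive_perimeter_trivial_inside[OF T(4)[OF that] T_conn[OF that] T(5)[OF that] E(1)
            E12(1,2,5,8) constE[OF that] P fin])
    have triv2: "negligible (E2 \<inter> T) \<or> negligible (T - E2)" if "T \<in> \<T>" for T
    proof (rule additive_perimeter_trivial_inside[OF T(4)[OF that] T_conn[OF that] T(5)[OF that] E(1)
            E12(2,1) _ _ constE[OF that] _ fin])
      show "E2 \<inter> E1 = {}" using E12(5) by blast
      show "sym_diff E (E2 \<union> E1) \<in> null_sets lebesgue" using E12(8) by (simp add: Un_commute)
      show "Per E \<Omega> = Per E2 \<Omega> + Per E1 \<Omega>" using P by (simp add: add.commute)
    qed
    define G where "G A = {T \<in> \<T>. negligible (T - A)}" for A
    have G: "G A \<subseteq> \<T>" for A unfolding G_def by blast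
    have aeG: "ae_eq \<Omega> (indicat_real A) (pw_const (ind (G A)))"
      if triv: "\<And>T. T \<in> \<T> \<Longrightarrow> negligible (A \<inter> T) \<or> negligible (T - A)" for A
    proof (rule ae_eqI)
      fix T assume T': "T \<in> \<T>"
      show "ae_eq T (indicat_real A) (\<lambda>_. ind (G A) T)"
      proof (cases "T \<in> G A")
        case True
        then have "AE x in lebesgue. x \<notin> T - A" unfolding G_def
          by (intro AE_not_in) (auto simp: negligible_iff_null_sets)
        then show ?thesis unfolding ae_eq_def
          by eventually_elim (use True in \<open>auto simp: ind_def indicator_def\<close>)
      next
        case False
        then have "negligible (A \<inter> T)" using triv[OF T'] T' unfolding G_def by blast
        then have "AE x in lebesgue. x \<notin> A \<inter> T"
          by (intro AE_not_in) (auto simp: negligible_iff_null_sets)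
        then show ?thesis unfolding ae_eq_def
          by eventually_elim (use False in \<open>auto simp: ind_def indicator_def\<close>)
      qed
    qed
    have neG: "G A \<noteq> {}" if A: "A \<in> sets lebesgue" "A \<subseteq> \<Omega>" "emeasure lebesgue A > 0"
      and triv: "\<And>T. T \<in> \<T> \<Longrightarrow> negligible (A \<inter> T) \<or> negligible (T - A)" for A
    proof
      assume "G A = {}"
      have z: "pw_const (ind {}) = (\<lambda>_. 0)" unfolding pw_const_def ind_def by simp
      have "AE x in lebesgue. x \<in> \<Omega> \<longrightarrow> indicat_real A x = 0"
        using aeG[OF triv] unfolding \<open>G A = {}\<close> z ae_eq_def .
      then have "AE x in lebesgue. x \<notin> A" by eventually_elim (use A(2) in \<open>auto simp: indicator_def\<close>)
      then have "A \<in> null_sets lebesgue" using AE_iff_null_sets[OF A(1)] by blast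
      then show False using A(3) by auto
    qed
    have ae1: "ae_eq \<Omega> (indicat_real E1) (pw_const (ind (G E1)))" by (rule aeG[OF triv1])
    have ae2: "ae_eq \<Omega> (indicat_real E2) (pw_const (ind (G E2)))" by (rule aeG[OF triv2])
    obtain T1 where T1: "T1 \<in> G E1" using neG[OF E12(1,3,6) triv1] by blast
    obtain T2 where T2: "T2 \<in> G E2" using neG[OF E12(2,4,7) triv2] by blast
    have disj: "T \<notin> G E2" if "T \<in> G E1" for T
    proof
      assume "T \<in> G E2"
      then have "negligible ((T - E1) \<union> (T - E2))" "T \<in> \<T>" using that unfolding G_def by (auto intro: negligible_Un)
      moreover have "T \<subseteq> (T - E1) \<union> (T - E2)" using E12(5) by blast
      ultimately show False using T_not_negligible negligible_subset by blast
    qed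
    define p1 where "p1 = gtv (ind (G E1))"
    define p2 where "p2 = gtv (ind (G E2))"
    have p1: "p1 > 0" unfolding p1_def using T1 T2 disj G by (intro gtv_ind_pos[of _ T1 T2]) auto
    have p2: "p2 > 0" unfolding p2_def using T1 T2 disj G by (intro gtv_ind_pos[of _ T2 T1]) auto
    have p: "gtv (ind F) = p1 + p2" 
      using P Per_eq[OF ae1] Per_eq[OF ae2] PerE unfolding p1_def p2_def by simp
    have "AE x in lebesgue. x \<notin> sym_diff E (E1 \<union> E2)" using E12(8) by (rule AE_not_in)
    then have "AE x in lebesgue. indicat_real E x = indicat_real E1 x + indicat_real E2 x"
      by eventually_elim (use E12(5) in \<open>auto simp: indicator_def\<close>)
    then have "AE x in lebesgue. x \<in> \<Omega> \<longrightarrow> pw_const (ind F) x = pw_const (ind (G E1)) x + pw_const (ind (G E2)) x"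
      using E(3) ae1 ae2 unfolding ae_eq_def by eventually_elim auto
    moreover have "pw_const (ind (G E1)) x + pw_const (ind (G E2)) x = pw_const (\<lambda>T. ind (G E1) T + ind (G E2) T) x" for x
      unfolding pw_const_def by (simp add: distrib_right sum.distrib)
    ultimately have "ae_eq \<Omega> (pw_const (ind F)) (pw_const (\<lambda>T. ind (G E1) T + ind (G E2) T))" unfolding ae_eq_def by simp
    then have sum: "ind F T = ind (G E1) T + ind (G E2) T" if "T \<in> \<T>" for T using that by (rule ae_eq_pw_const_D)
    have avs: "mean (ind F) = mean (ind (G E1)) + mean (ind (G E2))" using mean_cong[OF sum] mean_add by simp
    \<comment> \<open>The weights of the convex combination are the shares of the perimeter.\<close>
    define s where "s = p2 / (p1 + p2)"
    have s: "0 < s" "s < 1" unfolding s_def using p1 p2 by auto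
    have s': "1 - s = p1 / (p1 + p2)" unfolding s_def using p1 p2 by (simp add: field_simps)
    have "unit_ind F T = (1 - s) * unit_ind (G E1) T + s * unit_ind (G E2) T" if "T \<in> \<T>" for T
      unfolding unit_ind_def p1_def[symmetric] p2_def[symmetric] p sum[OF that] avs s' unfolding s_def
      using p1 p2 by (simp add: add_divide_distrib[symmetric])
    from extremalD[OF v s in_ball_unit_ind in_ball_unit_ind this, of T1] p1 p2 T1 G
    have "unit_ind (G E1) T1 = unit_ind (G E2) T1" unfolding p1_def p2_def by blast
    moreover have "unit_ind (G E1) T1 > 0"
    proof -
      have "T2 \<in> \<T> - G E1" using T2 G disj by blast
      from mean_ind_less_1[OF G this] show ?thesis unfolding unit_ind_def using p1 T1 by (simp add: p1_def ind_def)
    qed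
    moreover have "unit_ind (G E2) T1 \<le> 0"
      unfolding unit_ind_def using p2 disj[OF T1] mean_ind_nonneg[of "G E2"] by (simp add: p2_def ind_def)
    ultimately show False by simp
  qed
  moreover have "finite_perimeter \<Omega> E" unfolding finite_perimeter_def PerE using E by simp
  ultimately show ?thesis unfolding indecomposable_def by blast
qed

lemma indecomposable_gtv:
  assumes E: "indecomposable \<Omega> E" "ae_eq \<Omega> (indicat_real E) (pw_const (ind F))" and F: "F \<subseteq> \<T>"
    and F12: "F1 \<union> F2 = F" "F1 \<inter> F2 = {}" "F1 \<noteq> {}" "F2 \<noteq> {}"
  shows "gtv (ind F) \<noteq> gtv (ind F1) + gtv (ind F2)"
proof
  assume eq: "gtv (ind F) = gtv (ind F1) + gtv (ind F2)"
  have sub: "F1 \<subseteq> \<T>" "F2 \<subseteq> \<T>" using F F12(1) by auto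
  have fp: "finite_perimeter \<Omega> E" using E(1) unfolding indecomposable_def by simp
  then have EO: "E \<subseteq> \<Omega>" unfolding finite_perimeter_def by simp
  have o: "open (\<Union>F1)" "open (\<Union>F2)" using sub T(4) by auto
  have pos: "emeasure lebesgue (\<Union>G) > 0" if G: "G \<subseteq> \<T>" "G \<noteq> {}" for G
  proof -
    obtain T where T': "T \<in> G" using G(2) by blast
    have "emeasure lebesgue T \<noteq> 0"
      using T_not_negligible[of T] T' G(1) T(4) by (subst negligible_iff_emeasure0[symmetric]) auto
    moreover have "open (\<Union>G)" using G(1) T(4) by blast
    then have "emeasure lebesgue T \<le> emeasure lebesgue (\<Union>G)"
      using T' by (intro emeasure_mono) auto
    ultimately show ?thesis by (metis le_zero_eq zero_less_iff_neq_zero)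
  qed
  have "decomposable \<Omega> E" unfolding decomposable_def
  proof (rule conjI[OF fp], rule exI[of _ "\<Union>F1"], rule exI[of _ "\<Union>F2"], intro conjI)
    show "\<Union>F1 \<in> sets lebesgue" "\<Union>F2 \<in> sets lebesgue" using o by auto
    show "\<Union>F1 \<subseteq> \<Omega>" "\<Union>F2 \<subseteq> \<Omega>" using sub T(5) by blast+
    show "\<Union>F1 \<inter> \<Union>F2 = {}" using sub F12(2) T(3) by (fastforce simp: pairwise_def disjnt_iff)
    show "emeasure lebesgue (\<Union>F1) > 0" "emeasure lebesgue (\<Union>F2) > 0" using pos sub F12 by auto
    have "AE x in lebesgue. x \<in> \<Omega> \<longrightarrow> indicat_real E x = indicat_real (\<Union>F) x"
      using E(2) unfolding pw_const_ind[OF F] ae_eq_def .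
    then have "AE x in lebesgue. x \<notin> sym_diff E (\<Union>F1 \<union> \<Union>F2)"
    proof eventually_elim
      case (elim x)
      have "\<Union>F1 \<union> \<Union>F2 = \<Union>F" using F12(1) by blast
      moreover have "x \<in> E \<or> x \<in> \<Union>F \<Longrightarrow> x \<in> \<Omega>" using EO F T(5) by blast
      ultimately show ?case using elim by (auto simp: indicator_def split: if_splits)
    qed
    moreover have "sym_diff E (\<Union>F1 \<union> \<Union>F2) \<in> sets lebesgue"
    proof -
      have "E \<in> sets lebesgue" "\<Union>F1 \<in> sets lebesgue" "\<Union>F2 \<in> sets lebesgue"
        using fp o unfolding finite_perimeter_def by auto
      then show ?thesis by (intro sets.Un sets.Diff)
    qed
    ultimately show "sym_diff E (\<Union>F1 \<union> \<Union>F2) \<in> null_sets lebesgue" using AE_iff_null_sets by blast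
    have "Per (\<Union>G) \<Omega> = ereal (gtv (ind G))" if "G \<subseteq> \<T>" for G
      by (rule Per_eq) (simp add: pw_const_ind[OF that] ae_eq_def)
    then show "Per E \<Omega> = Per (\<Union>F1) \<Omega> + Per (\<Union>F2) \<Omega>"
      using sub Per_eq[OF E(2)] eq by simp
  qed
  with E(1) show False unfolding indecomposable_def by simp
qed

text \<open>Otherwise a sublevel set of \<open>v\<close> would split \<open>F\<close> into two parts not joined by any edge of positive weight, so that the
  perimeter is additive.\<close>

lemma constant_on_indecomposable:
  fixes v :: "'a set \<Rightarrow> real"
  assumes F: "F \<subseteq> \<T>"
    and ind: "\<And>F1 F2. F1 \<union> F2 = F \<Longrightarrow> F1 \<inter> F2 = {} \<Longrightarrow> F1 \<noteq> {} \<Longrightarrow> F2 \<noteq> {} \<Longrightarrow>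
        gtv (ind F) \<noteq> gtv (ind F1) + gtv (ind F2)"
    and edge: "\<And>e. e \<in> edges \<Longrightarrow> weight e \<noteq> 0 \<Longrightarrow> (pos_cell e \<in> F \<longleftrightarrow> neg_cell e \<in> F) \<Longrightarrow> v (pos_cell e) = v (neg_cell e)"
  shows "v constant_on F"
proof -
  have le: "v T2 \<le> v T1" if T12: "T1 \<in> F" "T2 \<in> F" for T1 T2
  proof (rule ccontr)
    assume lt: "\<not> v T2 \<le> v T1"
    define F1 where "F1 = {T \<in> F. v T \<le> v T1}"
    define F2 where "F2 = {T \<in> F. \<not> v T \<le> v T1}"
    have "gtv (ind F) = gtv (ind F1) + gtv (ind F2)"
      unfolding gtv_def sum.distrib[symmetric] distrib_left[symmetric]
    proof (rule sum.cong[OF refl])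
      fix e assume "e \<in> edges"
      then show "weight e * \<bar>ind F (pos_cell e) - ind F (neg_cell e)\<bar>
        = weight e * (\<bar>ind F1 (pos_cell e) - ind F1 (neg_cell e)\<bar> + \<bar>ind F2 (pos_cell e) - ind F2 (neg_cell e)\<bar>)"
        using edge[of e] unfolding ind_def F1_def F2_def by (cases "weight e = 0") auto
    qed
    moreover have "F1 \<union> F2 = F" "F1 \<inter> F2 = {}" "T1 \<in> F1" "T2 \<in> F2"
      unfolding F1_def F2_def using T12 lt by auto
    ultimately show False using ind[of F1 F2] by blast
  qed
  then show ?thesis unfolding constant_on_def by (meson antisym)
qed

text \<open>The convex combination has norm \<open>1\<close> and its end points have norm at most \<open>1\<close>, so the triangle inequality is an
  equality at every edge of positive weight. Where the indicator of \<open>F\<close> does not jump, neither do \<open>v1\<close> and \<open>v2\<close>; being constant on \<open>F\<close> and on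
  its complement, and centred, they are multiples of the centred indicator, and the multiples are determined by the norm.\<close>

lemma simple_imp_extremal:
  assumes F: "F \<subseteq> \<T>" "gtv (ind F) > 0"
    and ind: "\<And>F1 F2. F1 \<union> F2 = F \<Longrightarrow> F1 \<inter> F2 = {} \<Longrightarrow> F1 \<noteq> {} \<Longrightarrow> F2 \<noteq> {} \<Longrightarrow>
        gtv (ind F) \<noteq> gtv (ind F1) + gtv (ind F2)"
    and ind': "\<And>F1 F2. F1 \<union> F2 = \<T> - F \<Longrightarrow> F1 \<inter> F2 = {} \<Longrightarrow> F1 \<noteq> {} \<Longrightarrow> F2 \<noteq> {} \<Longrightarrow>
        gtv (ind (\<T> - F)) \<noteq> gtv (ind F1) + gtv (ind F2)"
  shows "extremal (unit_ind F)"
  unfolding extremal_def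
proof (intro conjI allI impI ballI; (elim conjE)?)
  show "in_ball (unit_ind F)" using F(2) by (rule in_ball_unit_ind)
  fix s v1 v2 T
  assume s: "0 < s" "s < 1" and v12: "in_ball v1" "in_ball v2"
    and eq: "\<forall>T\<in>\<T>. unit_ind F T = (1 - s) * v1 T + s * v2 T" and T': "T \<in> \<T>"
  define d where "d v e = v (pos_cell e) - v (neg_cell e)" for v :: "'a set \<Rightarrow> real" and e
  have tvd: "gtv v = (\<Sum>e\<in>edges. weight e * \<bar>d v e\<bar>)" for v unfolding gtv_def d_def by simp
  have tv1: "gtv (unit_ind F) = 1" unfolding unit_ind_affine gtv_affine using F(2) by simp
  have deq: "d (unit_ind F) e = (1 - s) * d v1 e + s * d v2 e" if "e \<in> edges" for e
  proof -
    have "unit_ind F T = (1 - s) * v1 T + s * v2 T" if "T \<in> \<T>" for T using eq that by blast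
    note this[OF ends(1)[OF that]] this[OF ends(2)[OF that]]
    then show ?thesis unfolding d_def by (simp add: right_diff_distrib)
  qed
  have nn: "0 \<le> weight e * ((1 - s) * \<bar>d v1 e\<bar> + s * \<bar>d v2 e\<bar> - \<bar>d (unit_ind F) e\<bar>)" if "e \<in> edges" for e
  proof (rule mult_nonneg_nonneg[OF weight_nonneg])
    have "\<bar>d (unit_ind F) e\<bar> \<le> \<bar>(1 - s) * d v1 e\<bar> + \<bar>s * d v2 e\<bar>" unfolding deq[OF that] by (rule abs_triangle_ineq)
    then show "0 \<le> (1 - s) * \<bar>d v1 e\<bar> + s * \<bar>d v2 e\<bar> - \<bar>d (unit_ind F) e\<bar>" using s by (simp add: abs_mult)
  qed
  have "(\<Sum>e\<in>edges. weight e * ((1 - s) * \<bar>d v1 e\<bar> + s * \<bar>d v2 e\<bar> - \<bar>d (unit_ind F) e\<bar>))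
      = (1 - s) * gtv v1 + s * gtv v2 - gtv (unit_ind F)"
    unfolding tvd by (simp add: algebra_simps sum.distrib sum_subtractf sum_distrib_left)
  also have "\<dots> \<le> (1 - s) * 1 + s * 1 - 1"
    using v12 s tv1 unfolding in_ball_def by (intro diff_mono add_mono mult_left_mono) auto
  finally have "(\<Sum>e\<in>edges. weight e * ((1 - s) * \<bar>d v1 e\<bar> + s * \<bar>d v2 e\<bar> - \<bar>d (unit_ind F) e\<bar>)) \<le> 0" by simp
  moreover have "0 \<le> (\<Sum>e\<in>edges. weight e * ((1 - s) * \<bar>d v1 e\<bar> + s * \<bar>d v2 e\<bar> - \<bar>d (unit_ind F) e\<bar>))"
    by (rule sum_nonneg[OF nn])
  ultimately have "(\<Sum>e\<in>edges. weight e * ((1 - s) * \<bar>d v1 e\<bar> + s * \<bar>d v2 e\<bar> - \<bar>d (unit_ind F) e\<bar>)) = 0"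
    by (rule order_antisym)
  then have "\<forall>e\<in>edges. weight e * ((1 - s) * \<bar>d v1 e\<bar> + s * \<bar>d v2 e\<bar> - \<bar>d (unit_ind F) e\<bar>) = 0"
    using sum_nonneg_eq_0_iff[OF finite_edges nn] by simp
  then have zero: "weight e * ((1 - s) * \<bar>d v1 e\<bar> + s * \<bar>d v2 e\<bar> - \<bar>d (unit_ind F) e\<bar>) = 0" if "e \<in> edges" for e
    using that by blast
  have edge: "d v1 e = 0 \<and> d v2 e = 0" if e: "e \<in> edges" "weight e \<noteq> 0" "pos_cell e \<in> F \<longleftrightarrow> neg_cell e \<in> F" for e
  proof -
    have "d (unit_ind F) e = 0" using e(3) unfolding d_def unit_ind_def ind_def by simp
    then have "(1 - s) * \<bar>d v1 e\<bar> + s * \<bar>d v2 e\<bar> = 0" using zero[OF e(1)] e(2) by simp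
    moreover have "0 \<le> (1 - s) * \<bar>d v1 e\<bar>" "0 \<le> s * \<bar>d v2 e\<bar>" using s by auto
    ultimately have "(1 - s) * \<bar>d v1 e\<bar> = 0" "s * \<bar>d v2 e\<bar> = 0" by linarith+
    then show ?thesis using s by simp
  qed
  define a where "a = mean (ind F)"
  have form: "\<exists>l. (\<forall>T\<in>\<T>. v T = l * (ind F T - a)) \<and> \<bar>l\<bar> * gtv (ind F) \<le> 1"
    if vb: "in_ball v" and ed: "\<And>e. e \<in> edges \<Longrightarrow> weight e \<noteq> 0 \<Longrightarrow> (pos_cell e \<in> F \<longleftrightarrow> neg_cell e \<in> F) \<Longrightarrow> d v e = 0" for v
  proof -
    have "v constant_on F"
      using ed by (intro constant_on_indecomposable[OF F(1) ind]) (auto simp: d_def)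
    then obtain q where q: "\<And>T. T \<in> F \<Longrightarrow> v T = q" unfolding constant_on_def by blast
    have "v constant_on (\<T> - F)"
      using ed ends(1,2) by (intro constant_on_indecomposable[OF _ ind']) (auto simp: d_def)
    then obtain q' where q': "\<And>T. T \<in> \<T> - F \<Longrightarrow> v T = q'" unfolding constant_on_def by blast
    have val: "v T = (q - q') * ind F T + q'" if "T \<in> \<T>" for T
      using q[of T] q'[of T] that unfolding ind_def by (cases "T \<in> F") auto
    have "gtv v = \<bar>q - q'\<bar> * gtv (ind F)" using gtv_cong[OF val] gtv_affine by simp
    moreover have "mean v = (q - q') * a + q'" unfolding a_def using mean_cong[OF val] mean_affine by simp
    ultimately have 1: "\<bar>q - q'\<bar> * gtv (ind F) \<le> 1" "q' = - ((q - q') * a)" using vb unfolding in_ball_def by auto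
    have "v T = (q - q') * (ind F T - a)" if "T \<in> \<T>" for T
      using val[OF that] 1(2) by (simp add: right_diff_distrib)
    with 1(1) show ?thesis by blast
  qed
  obtain l1 where l1: "\<And>T. T \<in> \<T> \<Longrightarrow> v1 T = l1 * (ind F T - a)" "\<bar>l1\<bar> * gtv (ind F) \<le> 1"
    using form[OF v12(1)] edge by blast
  obtain l2 where l2: "\<And>T. T \<in> \<T> \<Longrightarrow> v2 T = l2 * (ind F T - a)" "\<bar>l2\<bar> * gtv (ind F) \<le> 1"
    using form[OF v12(2)] edge by blast
  define p where "p = gtv (ind F)"
  have p: "p > 0" using F(2) unfolding p_def .
  have "\<bar>l1\<bar> \<le> 1 / p" "\<bar>l2\<bar> \<le> 1 / p"
    using l1(2) l2(2) p unfolding p_def[symmetric] by (simp_all add: pos_le_divide_eq)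
  then have le: "l1 \<le> 1 / p" "l2 \<le> 1 / p" by linarith+
  show "v1 T = v2 T"
  proof (cases "ind F T - a = 0")
    case True
    then show ?thesis using l1(1)[OF T'] l2(1)[OF T'] by simp
  next
    case False
    have "unit_ind F T = (1 - s) * v1 T + s * v2 T" using eq T' by blast
    then have "1 / p * (ind F T - a) = ((1 - s) * l1 + s * l2) * (ind F T - a)"
      unfolding l1(1)[OF T'] l2(1)[OF T'] unit_ind_def p_def a_def by (simp add: distrib_right)
    then have c: "1 / p = (1 - s) * l1 + s * l2" using False by (simp only: mult_cancel_right) simp
    have "(1 - s) * (r - l1) + s * (r - l2) = r - ((1 - s) * l1 + s * l2)" for r
      by (simp add: algebra_simps)
    then have "(1 - s) * (1 / p - l1) + s * (1 / p - l2) = 0" unfolding c[symmetric] by simp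
    moreover have "0 \<le> (1 - s) * (1 / p - l1)" "0 \<le> s * (1 / p - l2)" using le s by auto
    ultimately have "(1 - s) * (1 / p - l1) = 0" "s * (1 / p - l2) = 0" by linarith+
    then have "l1 = l2" using s by simp
    then show ?thesis using l1(1)[OF T'] l2(1)[OF T'] by simp
  qed
qed

text \<open>Taking the interior of the union of the closures only adds boundary points of cells, which form a null set.\<close>

lemma simplex_union_ae:
  assumes F: "F \<subseteq> \<T>"
  shows "interior (\<Union>T\<in>F. closure T) \<subseteq> \<Omega>" "interior (\<Union>T\<in>F. closure T) \<in> sets lebesgue"
    "ae_eq \<Omega> (indicat_real (interior (\<Union>T\<in>F. closure T))) (pw_const (ind F))"
proof -
  define E where "E = interior (\<Union>T\<in>F. closure T)"
  have "E \<subseteq> interior (\<Union>T\<in>\<T>. closure T)" unfolding E_def using F by (intro interior_mono) auto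
  then show "interior (\<Union>T\<in>F. closure T) \<subseteq> \<Omega>" using int_closure unfolding E_def by blast
  show "interior (\<Union>T\<in>F. closure T) \<in> sets lebesgue" by auto
  have "indicat_real E x = ind F T" if T': "T \<in> \<T>" "x \<in> T" for x T
  proof (cases "T \<in> F")
    case True
    then have "T \<subseteq> E" unfolding E_def using T(4)[OF T'(1)] closure_subset by (intro interior_maximal) auto
    then show ?thesis using True T' unfolding ind_def by auto
  next
    case False
    have "T \<inter> closure T0 = {}" if "T0 \<in> F" for T0
    proof -
      have "T \<inter> T0 = {}" using T_unique[OF T'(1), of T0] that False F by blast
      then show ?thesis using open_Int_closure_eq_empty[OF T(4)[OF T'(1)]] by blast
    qed
    then have "x \<notin> E" unfolding E_def using T'(2) interior_subset by blast
    then show ?thesis using False unfolding ind_def by simp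
  qed
  then show "ae_eq \<Omega> (indicat_real (interior (\<Union>T\<in>F. closure T))) (pw_const (ind F))"
    unfolding E_def[symmetric] by (intro ae_eqI) (auto simp: ae_eq_def)
qed

lemma ae_eq_complement:
  assumes "ae_eq \<Omega> (indicat_real E) (pw_const (ind F))"
  shows "ae_eq \<Omega> (indicat_real (\<Omega> - E)) (pw_const (ind (\<T> - F)))"
proof (rule ae_eqI)
  fix T assume T': "T \<in> \<T>"
  have "AE x in lebesgue. x \<in> \<Omega> \<longrightarrow> indicat_real E x = pw_const (ind F) x" using assms unfolding ae_eq_def .
  then show "ae_eq T (indicat_real (\<Omega> - E)) (\<lambda>_. ind (\<T> - F) T)"
    unfolding ae_eq_def
  proof eventually_elim
    case (elim x)
    then show ?case using T(5)[OF T'] pw_const_eq[OF T', of x "ind F"] T'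
      by (auto simp: ind_def indicator_def split: if_splits)
  qed
qed

lemma extremal_points_unit_ball:
  assumes card: "card \<T> \<ge> 2"
  shows "extremal_points \<Omega> (unit_ball_P0 \<Omega> \<T>) =
    {u. \<exists>E. E \<in> simplex_union_sets \<T> \<and> simple_set \<Omega> E \<and> Per E \<Omega> > 0 \<and>
       ae_eq \<Omega> u (\<lambda>x. (1 / real_of_ereal (Per E \<Omega>)) * centred \<Omega> (indicat_real E) x)}"
    (is "?L = ?R")
proof -
  have norm: "ae_eq \<Omega> (\<lambda>x. (1 / real_of_ereal (Per E \<Omega>)) * centred \<Omega> (indicat_real E) x) (pw_const (unit_ind F))"
    if "ae_eq \<Omega> (indicat_real E) (pw_const (ind F))" for E F
  proof (rule ae_eqI)
    fix T assume T': "T \<in> \<T>"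
    have "AE x in lebesgue. x \<in> \<Omega> \<longrightarrow> indicat_real E x = pw_const (ind F) x" using that unfolding ae_eq_def .
    then show "ae_eq T (\<lambda>x. (1 / real_of_ereal (Per E \<Omega>)) * centred \<Omega> (indicat_real E) x) (\<lambda>_. unit_ind F T)"
      unfolding ae_eq_def
    proof eventually_elim
      case (elim x)
      then show ?case using T(5)[OF T'] pw_const_eq[OF T', of x "ind F"]
        by (auto simp: Per_eq[OF that] centred_def avg_eq[OF that] unit_ind_def)
    qed
  qed
  show ?thesis
  proof (intro equalityI subsetI)
    fix u assume "u \<in> ?L"
    then obtain v where v: "ae_eq \<Omega> u (pw_const v)" "extremal v" unfolding extremal_iff by blast
    obtain F where F: "F \<subseteq> \<T>" "gtv (ind F) > 0" and vF: "\<And>T. T \<in> \<T> \<Longrightarrow> v T = unit_ind F T"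
      using extremal_imp_unit_ind[OF card v(2)] by metis
    have ve: "extremal (unit_ind F)"
      by (rule extremal_cong[OF v(2)]) (simp add: vF)
    define E where "E = interior (\<Union>T\<in>F. closure T)"
    have E: "E \<subseteq> \<Omega>" "E \<in> sets lebesgue" "ae_eq \<Omega> (indicat_real E) (pw_const (ind F))"
      unfolding E_def by (rule simplex_union_ae[OF F(1)])+
    have i1: "indecomposable \<Omega> E" by (rule extremal_imp_indecomposable[OF F ve E(2,1,3)])
    have compl: "ind (\<T> - F) T = (-1) * ind F T + 1" if "T \<in> \<T>" for T using that unfolding ind_def by auto
    have tvc: "gtv (ind (\<T> - F)) = gtv (ind F)"
      using gtv_cong[OF compl] gtv_affine[of "-1" "ind F" 1] by simp
    have avc: "mean (ind (\<T> - F)) = 1 - mean (ind F)"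
      using mean_cong[OF compl] mean_affine[of "-1" "ind F" 1] by simp
    have cc: "unit_ind (\<T> - F) T = - unit_ind F T" if "T \<in> \<T>" for T
      unfolding unit_ind_def tvc avc compl[OF that] by (simp add: diff_divide_distrib)
    have "extremal (unit_ind (\<T> - F))"
      by (rule extremal_cong[OF extremal_uminus[OF ve]]) (rule cc)
    then have i2: "indecomposable \<Omega> (\<Omega> - E)"
      by (rule extremal_imp_indecomposable[rotated 2]) (use F E Omega(1) tvc ae_eq_complement[OF E(3)] in auto)
    have "Per E \<Omega> > 0" unfolding Per_eq[OF E(3)] using F(2) by simp
    moreover have "ae_eq \<Omega> u (\<lambda>x. (1 / real_of_ereal (Per E \<Omega>)) * centred \<Omega> (indicat_real E) x)"
      using ae_eq_trans[OF v(1)] ae_eq_sym[OF norm[OF E(3)]] pw_const_cong[OF vF] by simp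
    moreover have "E \<in> simplex_union_sets \<T>" unfolding simplex_union_sets_def E_def using F(1) by blast
    ultimately show "u \<in> ?R" using i1 i2 unfolding simple_set_def by blast
  next
    fix u assume "u \<in> ?R"
    then obtain E where E: "E \<in> simplex_union_sets \<T>" "indecomposable \<Omega> E" "indecomposable \<Omega> (\<Omega> - E)" "Per E \<Omega> > 0"
       and u: "ae_eq \<Omega> u (\<lambda>x. (1 / real_of_ereal (Per E \<Omega>)) * centred \<Omega> (indicat_real E) x)"
      unfolding simple_set_def by blast
    obtain F where F: "F \<subseteq> \<T>" "E = interior (\<Union>T\<in>F. closure T)" using E(1) unfolding simplex_union_sets_def by blast
    have ae: "ae_eq \<Omega> (indicat_real E) (pw_const (ind F))" unfolding F(2) by (rule simplex_union_ae(3)[OF F(1)])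
    have pos: "gtv (ind F) > 0" using E(4) unfolding Per_eq[OF ae] by simp
    have "extremal (unit_ind F)"
      using indecomposable_gtv[OF E(2) ae F(1)] indecomposable_gtv[OF E(3) ae_eq_complement[OF ae]]
      by (intro simple_imp_extremal[OF F(1) pos]) blast+
    then show "u \<in> ?L" unfolding extremal_iff using ae_eq_trans[OF u norm[OF ae]] by blast
  qed
qed

end

section \<open>Simplices and Lipschitz domains\<close>

text \<open>Just below a boundary point, in the direction of the local epigraph, there are points with a whole neighbourhood
  outside \<open>\<Omega>\<close>.\<close>

lemma interior_closure_lipschitz_domain:
  fixes \<Omega> :: "'a::euclidean_space set"
  assumes "open \<Omega>" "strongly_lipschitz_boundary \<Omega>"
  shows "interior (closure \<Omega>) \<subseteq> \<Omega>"
proof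
  fix x assume x: "x \<in> interior (closure \<Omega>)"
  show "x \<in> \<Omega>"
  proof (rule ccontr)
    assume nx: "x \<notin> \<Omega>"
    have "x \<in> closure \<Omega>" using x interior_subset by blast
    then have "x \<in> frontier \<Omega>" using nx assms(1) by (simp add: frontier_def interior_open)
    from bspec[OF assms(2)[unfolded strongly_lipschitz_boundary_def] this]
    obtain U e L and \<gamma> :: "'a \<Rightarrow> real" where U: "open U" "x \<in> U" "norm e = 1" "L-lipschitz_on {z. z \<bullet> e = 0} \<gamma>"
      "\<Omega> \<inter> U = {y \<in> U. \<gamma> (y - (y \<bullet> e) *\<^sub>R e) < y \<bullet> e}"
      by (elim exE conjE)
    have ee: "e \<bullet> e = 1" using U(3) by (simp add: norm_eq_1)
    have ge: "x \<bullet> e \<le> \<gamma> (x - (x \<bullet> e) *\<^sub>R e)" using U(2,5) nx by (auto simp: not_less[symmetric])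
    \<comment> \<open>Moving down from \<open>x\<close> by \<open>r / 2\<close> keeps the projection and leaves the epigraph strictly.\<close>
    have "open (U \<inter> interior (closure \<Omega>))" using U(1) by auto
    then obtain r where r: "r > 0" "ball x r \<subseteq> U \<inter> interior (closure \<Omega>)"
      using x U(2) unfolding open_contains_ball by blast
    define y where "y = x - (r / 2) *\<^sub>R e"
    have yball: "y \<in> ball x r" unfolding y_def using r(1) U(3) by (simp add: dist_norm)
    have proj: "y - (y \<bullet> e) *\<^sub>R e = x - (x \<bullet> e) *\<^sub>R e" and ye: "y \<bullet> e = x \<bullet> e - r / 2"
      unfolding y_def using ee by (simp_all add: inner_diff_left algebra_simps)
    define g where "g z = z \<bullet> e - \<gamma> (z - (z \<bullet> e) *\<^sub>R e)" for z
    have "continuous_on UNIV (\<lambda>z. \<gamma> (z - (z \<bullet> e) *\<^sub>R e))"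
    proof (rule continuous_on_compose2[OF lipschitz_on_continuous_on[OF U(4)]])
      show "continuous_on UNIV (\<lambda>z. z - (z \<bullet> e) *\<^sub>R e)" by (intro continuous_intros)
      show "(\<lambda>z. z - (z \<bullet> e) *\<^sub>R e) ` UNIV \<subseteq> {z. z \<bullet> e = 0}" using ee by (auto simp: inner_diff_left)
    qed
    then have "continuous_on UNIV g" unfolding g_def by (intro continuous_intros)
    then have "open {z. g z < 0}" by (intro open_Collect_less continuous_on_const)
    then have o: "open (U \<inter> {z. g z < 0})" using U(1) by blast
    have "g y < 0" unfolding g_def proj unfolding ye using ge r(1) by simp
    then have "y \<in> U \<inter> {z. g z < 0}" using yball r(2) by blast
    moreover have "(U \<inter> {z. g z < 0}) \<inter> \<Omega> = {}"
    proof -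
      have "g z > 0" if "z \<in> \<Omega> \<inter> U" for z using that unfolding U(5) g_def by simp
      then show ?thesis by force
    qed
    then have "(U \<inter> {z. g z < 0}) \<inter> closure \<Omega> = {}" using open_Int_closure_eq_empty[OF o] by blast
    moreover have "y \<in> closure \<Omega>" using yball r(2) interior_subset by blast
    ultimately show False by blast
  qed
qed

lemma frontier_finite_Inter_subset:
  "finite F \<Longrightarrow> frontier (\<Inter>F) \<subseteq> (\<Union>h\<in>F. frontier h)" for F :: "'a::euclidean_space set set"
proof (induction F rule: finite_induct)
  case (insert h F)
  have "frontier (\<Inter>(insert h F)) \<subseteq> frontier h \<union> frontier (\<Inter>F)"
    using frontier_Int_subset[of h "\<Inter>F"] by simp
  with insert.IH show ?case by blast
qed simp

lemma open_simplex_properties: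
  fixes T :: "'a::euclidean_space set"
  assumes "open_simplex T"
  shows "open T" "convex T" "T \<noteq> {}"
    "\<exists>\<H>. finite \<H> \<and> (\<forall>h\<in>\<H>. \<exists>n c. norm n = 1 \<and> h = {x. n \<bullet> x - c = 0}) \<and> frontier T \<subseteq> \<Union>\<H>"
proof -
  obtain S where S: "int DIM('a) simplex S" "T = interior S" using assms unfolding open_simplex_def by blast
  have poly: "polytope S" using S(1) by (rule simplex_imp_polytope)
  then have cS: "convex S" by (rule polytope_imp_convex)
  show "open T" "convex T" using S(2) cS by (auto intro: convex_interior)
  have "aff_dim S = int DIM('a)" using S(1) by (rule aff_dim_simplex)
  then have "affine hull S = UNIV" "S \<noteq> {}" using aff_dim_eq_full[of S] by auto
  then show "T \<noteq> {}" using S(2) cS rel_interior_interior[of S] rel_interior_eq_empty[of S] by simp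
  have "polyhedron S" using poly by (rule polytope_imp_polyhedron)
  then obtain F where F: "finite F" "S = \<Inter>F" "\<And>h. h \<in> F \<Longrightarrow> \<exists>a b. a \<noteq> 0 \<and> h = {x. a \<bullet> x \<le> b}"
    unfolding polyhedron_def by metis
  have "frontier T \<subseteq> frontier S" unfolding S(2) by (rule frontier_interior_subset)
  also have "\<dots> \<subseteq> \<Union>(frontier ` F)" unfolding F(2) by (rule frontier_finite_Inter_subset[OF F(1)])
  finally have "frontier T \<subseteq> \<Union>(frontier ` F)" .
  moreover have "\<exists>n c. norm n = 1 \<and> frontier h = {x. n \<bullet> x - c = 0}" if h: "h \<in> F" for h
  proof -
    obtain a b where ab: "a \<noteq> 0" "h = {x. a \<bullet> x \<le> b}" using F(3)[OF h] by blast
    have "frontier h = {x. a \<bullet> x = b}" unfolding ab(2) using ab(1) by (intro frontier_halfspace_le) simp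
    also have "\<dots> = {x. ((1 / norm a) *\<^sub>R a) \<bullet> x - b / norm a = 0}"
      using ab(1) by (auto simp: field_simps)
    finally show ?thesis using ab(1) by (intro exI[of _ "(1 / norm a) *\<^sub>R a"] exI[of _ "b / norm a"]) simp
  qed
  ultimately show "\<exists>\<H>. finite \<H> \<and> (\<forall>h\<in>\<H>. \<exists>n c. norm n = 1 \<and> h = {x. n \<bullet> x - c = 0}) \<and> frontier T \<subseteq> \<Union>\<H>"
    using F(1) by (intro exI[of _ "frontier ` F"]) auto
qed

theorem proposition3p4:
  fixes \<Omega> :: "'a::euclidean_space set" and \<T> :: "'a set set"
  assumes "polyhedral_domain \<Omega>"
    and "is_triangulation_of \<T> \<Omega>"
    and "card \<T> \<ge> 2"
  shows "extremal_points \<Omega> (unit_ball_P0 \<Omega> \<T>) =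
    {u. \<exists>E. E \<in> simplex_union_sets \<T> \<and> simple_set \<Omega> E \<and> Per E \<Omega> > 0 \<and>
       ae_eq \<Omega> u (\<lambda>x. (1 / real_of_ereal (Per E \<Omega>)) * centred \<Omega> (indicat_real E) x)}"
proof -
  have \<Omega>: "open \<Omega>" "bounded \<Omega>" "connected \<Omega>" "strongly_lipschitz_boundary \<Omega>"
    using assms(1) unfolding polyhedral_domain_def by auto
  have \<T>: "finite \<T>" "pairwise disjnt \<T>" "closure \<Omega> = (\<Union>T\<in>\<T>. closure T)"
    and simp: "\<And>T. T \<in> \<T> \<Longrightarrow> open_simplex T"
    using assms(2) unfolding is_triangulation_of_def by auto
  have ic: "interior (closure \<Omega>) \<subseteq> \<Omega>" using \<Omega>(1,4) by (rule interior_closure_lipschitz_domain)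
  obtain h where h: "\<And>T. T \<in> \<T> \<Longrightarrow> finite (h T)" "\<And>T. T \<in> \<T> \<Longrightarrow> frontier T \<subseteq> \<Union>(h T)"
    "\<And>T l. T \<in> \<T> \<Longrightarrow> l \<in> h T \<Longrightarrow> \<exists>n c. norm n = 1 \<and> l = {x. n \<bullet> x - c = 0}"
    using open_simplex_properties(4)[OF simp] by metis
  define H where "H = (\<Union>T\<in>\<T>. h T)"
  have "\<forall>l\<in>H. \<exists>n c. norm n = 1 \<and> l = {x. n \<bullet> x - c = 0}" unfolding H_def using h(3) by blast
  then obtain n c where nc: "\<And>l. l \<in> H \<Longrightarrow> norm (n l) = 1" "\<And>l. l \<in> H \<Longrightarrow> l = {x. n l \<bullet> x - c l = 0}"
    by metis
  interpret triangulated_domain \<Omega> \<T> H n c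
  proof
    show "open \<Omega>" "bounded \<Omega>" "finite \<T>" "pairwise disjnt \<T>" "connected \<Omega>" by fact+
    show "\<T> \<noteq> {}" using assms(3) by auto
    show "open T" "T \<noteq> {}" "connected T" if "T \<in> \<T>" for T
      using open_simplex_properties(1-3)[OF simp[OF that]] by (auto intro: convex_connected)
    show "T \<subseteq> \<Omega>" if "T \<in> \<T>" for T
    proof -
      have "T \<subseteq> closure \<Omega>" using that closure_subset unfolding \<T>(3) by blast
      then have "T \<subseteq> interior (closure \<Omega>)"
        using open_simplex_properties(1)[OF simp[OF that]] by (rule interior_maximal)
      with ic show ?thesis by blast
    qed
    show "\<Omega> \<subseteq> (\<Union>T\<in>\<T>. closure T)" using closure_subset[of \<Omega>] unfolding \<T>(3) .
    show "finite H" unfolding H_def using \<T>(1) h(1) by blast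
    show "norm (n l) = 1" if "l \<in> H" for l using nc(1)[OF that] .
    show "{x. n l \<bullet> x - c l = 0} \<noteq> {x. n k \<bullet> x - c k = 0}" if "l \<in> H" "k \<in> H" "l \<noteq> k" for l k
      using nc(2)[OF that(1)] nc(2)[OF that(2)] that(3) by metis
    show "frontier T \<subseteq> (\<Union>l\<in>H. {x. n l \<bullet> x - c l = 0})" if T: "T \<in> \<T>" for T
    proof
      fix x assume "x \<in> frontier T"
      then obtain l where "l \<in> h T" "x \<in> l" using h(2)[OF T] by blast
      then have "l \<in> H" unfolding H_def using T by blast
      moreover have "x \<in> {x. n l \<bullet> x - c l = 0}" using nc(2)[OF \<open>l \<in> H\<close>] \<open>x \<in> l\<close> by blast
      ultimately show "x \<in> (\<Union>l\<in>H. {x. n l \<bullet> x - c l = 0})" by blast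
    qed
    show "interior (\<Union>T\<in>\<T>. closure T) \<subseteq> \<Omega>" using ic unfolding \<T>(3) .
  qed
  show ?thesis by (rule extremal_points_unit_ball[OF assms(3)])
qed

end
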